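(* Let $f:U\to\mathbb{R}$ be a $C^k$ function on a neighborhood $U$ of $x_0$ in $\mathbb{R}^n$, $k\ge3$. Suppose that $\|f\|_{C^k}\le K$, and $$Df(x_0)=0,\qquad\operatorname{rank}D^2f(x_0)=n.$$ Let $$\delta=\frac{\sigma_n^{5/2}}{32(K+1)^{9/2}}\min\left(1,\ \frac{2\sigma_n^2}{3(n^2+n+1)},\ \frac{\sigma_n^{3/2}}{2(n^2+n+1)}\right),\quad\text{where }\sigma_n=\sigma_n(D^2f(x_0)).$$ Then there exists a $C^{k-1}$ diffeomorphism $$\varphi:\mathbf{B}^n_\delta\to\varphi(\mathbf{B}^n_\delta),\quad\text{with }\ \|D\varphi\|\le\frac{32(K+1)^5}{\sigma_n^{5/2}},$$ such that $$f\circ\varphi(x_1,\ldots,x_n)=f(x_0)+\sum_{i=1}^n\pm x_i^2.$$ Moreover, there exists a constant $M(K,\sigma_n,k)>0$ such that $\|\varphi\|_{C^{k-1}}\le M(K,\sigma_n,k)$.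
   Context: $\mathbf{B}^n_\delta$ is the ball of radius $\delta$ centered at $0$ in $\mathbb{R}^n$ (Euclidean norm). For a linear or multilinear mapping $A$, $\|A\|$ is the operator norm (supremum over unit vectors). For a $C^k$ mapping $f$ on $U$, $\|f\|_{C^k}=\max_{1\le p\le k}\sup_{x\in U}\|D^pf(x)\|$ (the values of $f$ itself are not included); $\|D\varphi\|$ denotes the supremum of $\|D\varphi(x)\|$ over the domain of $\varphi$. $\sigma_n(D^2f(x_0))$ is the smallest singular value of the Hessian matrix of $f$ at $x_0$, i.e. $\sigma_n(L)=\min_{\|x\|=1}\|Lx\|$.
   Formalization: The neighborhood U is additionally assumed to contain the ball around x_0 of radius 32(K+1)^5 σ_n^{-5/2} δ, since the claim fails for very small U (e.g. f(x)=x^2 on (-e,e) with e<δ). *)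

theory Defs
  imports "HOL-Analysis.Analysis"
begin

(* C^k on an open set U.  In finite dimension, x |-> Df(x) is C^k as a map into the
   linear maps iff x |-> Df(x) v is C^k for every v.  The derivatives are taken at
   interior points, so the definition is only meaningful for open U. *)
primrec Ck_on :: "nat \<Rightarrow> ('a::euclidean_space \<Rightarrow> 'b::euclidean_space) \<Rightarrow> 'a set \<Rightarrow> bool" where
  "Ck_on 0 f U \<longleftrightarrow> continuous_on U f"
| "Ck_on (Suc k) f U \<longleftrightarrow>
     (\<forall>x\<in>U. f differentiable (at x)) \<and>
     (\<forall>v. Ck_on k (\<lambda>x. frechet_derivative f (at x) v) U)"

(* The p-linear map D^p f(x), applied to the vectors v_1, ..., v_p given as a list of
   length p: multi_deriv f [v_1, ..., v_p] x = D^p f(x)(v_1, ..., v_p). *)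
primrec multi_deriv :: "('a::euclidean_space \<Rightarrow> 'b::euclidean_space) \<Rightarrow> 'a list \<Rightarrow> 'a \<Rightarrow> 'b" where
  "multi_deriv f [] = f"
| "multi_deriv f (v # vs) = multi_deriv (\<lambda>x. frechet_derivative f (at x) v) vs"

definition multi_deriv_norm :: "nat \<Rightarrow> ('a::euclidean_space \<Rightarrow> 'b::euclidean_space) \<Rightarrow> 'a \<Rightarrow> real" where
  "multi_deriv_norm p f x =
     (SUP vs\<in>{vs. length vs = p \<and> (\<forall>v\<in>set vs. norm v = 1)}. norm (multi_deriv f vs x))"

(* Extended-real valued, so that an unbounded derivative has norm \<infinity>. *)
definition Ck_norm :: "nat \<Rightarrow> ('a::euclidean_space \<Rightarrow> 'b::euclidean_space) \<Rightarrow> 'a set \<Rightarrow> ereal" where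
  "Ck_norm k f U = (MAX p\<in>{1..k}. SUP x\<in>U. ereal (multi_deriv_norm p f x))"

definition sup_deriv_norm :: "('a::euclidean_space \<Rightarrow> 'b::euclidean_space) \<Rightarrow> 'a set \<Rightarrow> ereal" where
  "sup_deriv_norm f U = (SUP x\<in>U. ereal (onorm (frechet_derivative f (at x))))"

definition Ck_diffeomorphism ::
    "nat \<Rightarrow> ('a::euclidean_space \<Rightarrow> 'b::euclidean_space) \<Rightarrow> 'a set \<Rightarrow> 'b set \<Rightarrow> bool" where
  "Ck_diffeomorphism k \<phi> S T \<longleftrightarrow>
     open S \<and> open T \<and> bij_betw \<phi> S T \<and> Ck_on k \<phi> S \<and> Ck_on k (inv_into S \<phi>) T"

definition hessian :: "(real^'n \<Rightarrow> real) \<Rightarrow> real^'n \<Rightarrow> real^'n^'n" where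
  "hessian f x = (\<chi> i j. multi_deriv f [axis i 1, axis j 1] x)"

(* The infimum is a minimum, by compactness of the unit sphere. *)
definition smallest_singular_value :: "real^'n^'n \<Rightarrow> real" where
  "smallest_singular_value L = (INF x\<in>sphere 0 1. norm (L *v x))"

end

theory Submission
  imports Defs
begin

text \<open>
  A linear change of coordinates of norm at most \<open>sqrt (2 / s)\<close> (spectral theorem) turns \<open>f - f x0\<close> into a
  function \<open>h\<close> whose quadratic part is \<open>q x = D x \<bullet> x\<close>, where \<open>D\<close> flips signs of coordinates, and for which
  \<open>D h\<close> and \<open>D q\<close> differ by at most \<open>norm x / 20\<close> on the ball of radius \<open>2 * \<delta>\<close>.  It then suffices to find
  a map \<open>\<Xi>\<close> with \<open>q (\<Xi> x) = h x\<close> whose derivative is within \<open>1/2\<close> of the identity; the chart is its inverse.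
  Dividing polynomials by the coordinates gives a Newton iteration that yields a polynomial map
  \<open>x + e x\<close> such that \<open>q (x + e x)\<close> agrees with the Taylor polynomial of \<open>h\<close> to order \<open>k\<close>.  A rational
  damping factor makes \<open>e\<close> small in \<open>C\<^sup>1\<close> on the whole ball without changing its jet at \<open>0\<close>; this is why
  \<open>\<delta>\<close> need not depend on \<open>k\<close>.  What remains of \<open>h\<close> is flat of order \<open>k\<close>, and it is absorbed by moving
  in the single direction \<open>D x\<close>: the equation \<open>q (x + \<epsilon> x + v *\<^sub>R D x) = h x\<close> is quadratic in the scalar \<open>v\<close>,
  so \<open>v\<close> has a closed form.  It is \<open>o(|x|^(k-2))\<close> together with the corresponding bounds on its
  derivatives, hence \<open>v *\<^sub>R D x\<close> is of class \<open>C^(k-1)\<close> at \<open>0\<close> and only one derivative is lost.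
\<close>

subsection \<open>Uniform symbol classes\<close>

text \<open>The textbook proof writes \<open>h x\<close> as a quadratic form whose coefficients are
  integrals of D^2 h along rays. These are in general only C^(k-2), and so is the resulting chart.
  Reaching C^(k-1) forces the split into a polynomial part, where division by coordinates is free,
  and a flat part, where dividing by |x|^2 costs two orders of vanishing but no derivative on the
  punctured ball, and the factor \<open>D x\<close> gives one order back. The second obstacle is
  that the final constant has to precede \<open>f\<close>: the index of the families finally ranges
  over all normalized germs with given bounds. Constants that merely exist cannot yield the explicit
  \<delta> or the bound on the derivative of \<phi>, so the C^1 bounds needed there are carried
  along as numbers: 1/20 for the input, 1/100 for the damped correction, 1/4 for the flat one. As
  1/100 + 1/4 is below 1/2, the inverse is 2-Lipschitz and defined on half the ball, which is why
  the work is done on radius 2 \<delta>.\<close>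

text \<open>
  \<open>|D\<^sup>j (F i) x| \<le> C |W i x| / |l x|\<^sup>j\<close> on \<open>S\<close> for \<open>j \<le> k\<close>, where \<open>C\<close> does not depend on \<open>i\<close>.  Working with
  families instead of single functions makes all constants uniform without ever computing them.
\<close>
primrec sym_class ::
    "nat \<Rightarrow> 'a::euclidean_space set \<Rightarrow> ('a \<Rightarrow> real) \<Rightarrow> ('i \<Rightarrow> 'a \<Rightarrow> real) \<Rightarrow> ('i \<Rightarrow> 'a \<Rightarrow> 'b::euclidean_space) \<Rightarrow> bool" where
  "sym_class 0 S l W F \<longleftrightarrow>
     (\<exists>C. \<forall>i. \<forall>x\<in>S. norm (F i x) \<le> C * \<bar>W i x\<bar>) \<and> (\<forall>i. continuous_on S (F i))"
| "sym_class (Suc k) S l W F \<longleftrightarrow>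
     (\<exists>C. \<forall>i. \<forall>x\<in>S. norm (F i x) \<le> C * \<bar>W i x\<bar>) \<and>
     (\<forall>i. \<forall>x\<in>S. F i differentiable (at x)) \<and>
     (\<forall>v. sym_class k S l (\<lambda>i x. W i x / l x) (\<lambda>i x. frechet_derivative (F i) (at x) v))"

abbreviation unif_class :: "nat \<Rightarrow> 'a::euclidean_space set \<Rightarrow> ('i \<Rightarrow> 'a \<Rightarrow> 'b::euclidean_space) \<Rightarrow> bool" where
  "unif_class k S F \<equiv> sym_class k S (\<lambda>_. 1) (\<lambda>_ _. 1) F"

section \<open>Closure properties of symbol classes\<close>

lemma sym_class_bound:
  assumes "sym_class k S l W F"
  obtains C where "C > 0" "\<And>i x. x \<in> S \<Longrightarrow> norm (F i x) \<le> C * \<bar>W i x\<bar>"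
proof -
  obtain C where C: "\<And>i x. x \<in> S \<Longrightarrow> norm (F i x) \<le> C * \<bar>W i x\<bar>"
    using assms by (cases k) auto
  have "norm (F i x) \<le> max C 1 * \<bar>W i x\<bar>" if "x \<in> S" for i x
    by (rule order_trans[OF C[OF that]]) (simp add: mult_right_mono)
  then show thesis by (intro that[of "max C 1"]) auto
qed

lemma sym_class_continuous: "sym_class k S l W F \<Longrightarrow> continuous_on S (F i)"
  by (cases k) (auto intro!: continuous_at_imp_continuous_on differentiable_imp_continuous_within)

lemma sym_class_derivative:
  assumes "sym_class (Suc k) S l W F" "x \<in> S"
  shows "(F i has_derivative frechet_derivative (F i) (at x)) (at x)"
  using assms by (simp add: frechet_derivative_works)

lemma frechet_derivative_cong_open:
  assumes "open S" "x \<in> S" "\<And>y. y \<in> S \<Longrightarrow> f y = g y"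
  shows "frechet_derivative f (at x) = frechet_derivative g (at x)"
proof -
  have "(f has_derivative f') (at x) \<longleftrightarrow> (g has_derivative f') (at x)" for f'
    using assms has_derivative_transform_within_open[of f f' x UNIV S g]
      has_derivative_transform_within_open[of g f' x UNIV S f] by auto
  then show ?thesis by (simp add: frechet_derivative_def)
qed

lemma sym_class_cong:
  assumes "open S" "sym_class k S l W F" "\<And>i x. x \<in> S \<Longrightarrow> F i x = G i x"
  shows "sym_class k S l W G"
  using assms(2,3)
proof (induction k arbitrary: W F G)
  case 0
  have "\<forall>i. continuous_on S (G i)"
    using 0 by (metis continuous_on_eq sym_class.simps(1))
  with 0 show ?case by fastforce
next
  case (Suc k)
  have "sym_class k S l (\<lambda>i x. W i x / l x) (\<lambda>i x. frechet_derivative (G i) (at x) v)" for v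
  proof (rule Suc.IH)
    show "sym_class k S l (\<lambda>i x. W i x / l x) (\<lambda>i x. frechet_derivative (F i) (at x) v)"
      using Suc.prems by simp
    show "frechet_derivative (F i) (at x) v = frechet_derivative (G i) (at x) v" if "x \<in> S" for i x
      using frechet_derivative_cong_open[OF assms(1) that, of "F i" "G i"] Suc.prems(2) by simp
  qed
  moreover have "G i differentiable (at x)" if "x \<in> S" for i x
  proof -
    have "F i differentiable (at x)" using Suc.prems that by simp
    then show ?thesis
      unfolding differentiable_def
      using has_derivative_transform_within_open[of "F i" _ x UNIV S "G i"] that assms(1) Suc.prems(2)
      by blast
  qed
  ultimately show ?case
    using Suc.prems by fastforce
qed

text \<open>The class is defined through \<open>frechet_derivative\<close>; this rule accepts any
  formula \<open>F'\<close> for the derivative. Openness of \<open>S\<close> is what allows the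
  exchange before differentiating again.\<close>

lemma sym_class_SucI:
  assumes "open S" "\<And>i x. x \<in> S \<Longrightarrow> norm (F i x) \<le> C * \<bar>W i x\<bar>"
    and "\<And>i x. x \<in> S \<Longrightarrow> (F i has_derivative F' i x) (at x)"
    and "\<And>v. sym_class k S l (\<lambda>i x. W i x / l x) (\<lambda>i x. F' i x v)"
  shows "sym_class (Suc k) S l W F"
proof -
  have "sym_class k S l (\<lambda>i x. W i x / l x) (\<lambda>i x. frechet_derivative (F i) (at x) v)" for v
    by (rule sym_class_cong[OF assms(1) assms(4)[of v]])
       (use frechet_derivative_at[OF assms(3)] in metis)
  moreover have "F i differentiable (at x)" if "x \<in> S" for i x
    using assms(3)[OF that] by (auto simp: differentiable_def)
  moreover have "\<exists>C. \<forall>i. \<forall>x\<in>S. norm (F i x) \<le> C * \<bar>W i x\<bar>"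
    using assms(2) by blast
  ultimately show ?thesis by simp
qed

lemma sym_class_0I:
  assumes "\<And>i x. x \<in> S \<Longrightarrow> norm (F i x) \<le> C * \<bar>W i x\<bar>" "\<And>i. continuous_on S (F i)"
  shows "sym_class 0 S l W F"
  using assms by auto

lemma sym_class_Suc_imp: "sym_class (Suc k) S l W F \<Longrightarrow> sym_class k S l W F"
proof (induction k arbitrary: W F)
  case 0
  then show ?case using sym_class_continuous[of "Suc 0" S l W F] by auto
next
  case (Suc k)
  then show ?case by (subst sym_class.simps, subst (asm) sym_class.simps) blast
qed

lemma sym_class_antimono:
  assumes "sym_class k S l W F" "j \<le> k" shows "sym_class j S l W F"
  using assms(2,1)
proof (induction rule: inc_induct)
  case (step n)
  then show ?case by (intro sym_class_Suc_imp[of n])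
qed simp

text \<open>A comparison of weights survives differentiation because both weights are divided by the
  same \<open>l\<close>.\<close>

lemma sym_class_weaken:
  assumes "sym_class k S l W F" "\<And>i x. x \<in> S \<Longrightarrow> \<bar>W i x\<bar> \<le> c * \<bar>W' i x\<bar>"
  shows "sym_class k S l W' F"
  using assms
proof (induction k arbitrary: W W' F)
  case (0 W W' F)
  obtain C where C: "C > 0" "\<And>i x. x \<in> S \<Longrightarrow> norm (F i x) \<le> C * \<bar>W i x\<bar>"
    using sym_class_bound[OF "0.prems"(1)] by blast
  have "norm (F i x) \<le> (C * c) * \<bar>W' i x\<bar>" if "x \<in> S" for i x
    using order_trans[OF C(2)[OF that, of i] mult_left_mono[OF 0(2)[OF that, of i], of C]] C(1)
    by (simp add: mult.assoc)
  with 0 show ?case by (intro sym_class_0I[where C="C * c"]) auto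
next
  case (Suc k)
  obtain C where C: "C > 0" "\<And>i x. x \<in> S \<Longrightarrow> norm (F i x) \<le> C * \<bar>W i x\<bar>"
    using sym_class_bound[OF Suc.prems(1)] by blast
  have 1: "norm (F i x) \<le> (C * c) * \<bar>W' i x\<bar>" if "x \<in> S" for i x
    using order_trans[OF C(2)[OF that, of i] mult_left_mono[OF Suc(3)[OF that, of i], of C]] C(1)
    by (simp add: mult.assoc)
  have "sym_class k S l (\<lambda>i x. W' i x / l x) (\<lambda>i x. frechet_derivative (F i) (at x) v)" for v
  proof (rule Suc.IH)
    show "sym_class k S l (\<lambda>i x. W i x / l x) (\<lambda>i x. frechet_derivative (F i) (at x) v)"
      using Suc.prems by simp
    show "\<bar>W i x / l x\<bar> \<le> c * \<bar>W' i x / l x\<bar>" if "x \<in> S" for i x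
      using divide_right_mono[OF Suc.prems(2)[OF that, of i], of "\<bar>l x\<bar>"] by (simp add: abs_divide)
  qed
  with 1 Suc.prems(1) show ?case by auto
qed

lemma sym_class_zero:
  fixes l :: "'a::euclidean_space \<Rightarrow> real"
  shows "sym_class k S l W (\<lambda>i x. 0)"
  by (induction k arbitrary: W) (auto intro!: exI[of _ 0])

lemma sym_class_const:
  fixes l :: "'a::euclidean_space \<Rightarrow> real" and c :: "'i \<Rightarrow> 'b::euclidean_space"
  assumes "\<And>i. norm (c i) \<le> C"
  shows "sym_class k S l (\<lambda>_ _. 1) (\<lambda>i x. c i)"
proof -
  have "\<exists>C. \<forall>i. \<forall>x\<in>S. norm (c i) \<le> C * \<bar>1\<bar>"
    using assms by (intro exI[of _ C]) simp
  then show ?thesis by (cases k) (simp_all add: sym_class_zero)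
qed

text \<open>The bound on \<open>norm x\<close> covers both uses: \<open>l = norm\<close> on a
  punctured ball with \<open>C = 1\<close>, and \<open>l = 1\<close> on a ball of radius
  \<open>C\<close>. One derivative leaves the constant \<open>w \<bullet> v\<close>, whose weight is
  \<open>l / l = 1\<close>.\<close>

lemma sym_class_inner_const:
  fixes v :: "'a::euclidean_space"
  assumes "open S" "\<And>x. x \<in> S \<Longrightarrow> l x \<noteq> 0" "\<And>x. x \<in> S \<Longrightarrow> norm x \<le> C * \<bar>l x\<bar>"
  shows "sym_class k S l (\<lambda>i. l) (\<lambda>i x. x \<bullet> v)"
proof -
  have 1: "norm (x \<bullet> v) \<le> (C * norm v) * \<bar>l x\<bar>" if "x \<in> S" for x
  proof -
    have "norm (x \<bullet> v) \<le> norm x * norm v" by (simp add: Cauchy_Schwarz_ineq2)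
    also have "\<dots> \<le> (C * \<bar>l x\<bar>) * norm v" using assms(3)[OF that] by (intro mult_right_mono) auto
    finally show ?thesis by (simp add: mult_ac)
  qed
  show ?thesis
  proof (cases k)
    case 0
    then show ?thesis using 1
      by (simp only:, intro sym_class_0I[where C="C * norm v"]) (auto intro!: continuous_intros)
  next
    case (Suc j)
    have "sym_class j S l (\<lambda>i x. l x / l x) (\<lambda>(i::'b) x. w \<bullet> v)" for w
      by (rule sym_class_weaken[OF sym_class_const[of _ "\<bar>w \<bullet> v\<bar>"], where c=1]) (use assms(2) in auto)
    then show ?thesis unfolding Suc
      by (intro sym_class_SucI[where C="C * norm v" and F'="\<lambda>i x w. w \<bullet> v"] assms)
         (use 1 in \<open>auto intro!: derivative_eq_intros\<close>)
  qed
qed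

lemma sym_class_add:
  assumes "open S" "sym_class k S l W F" "sym_class k S l W G"
  shows "sym_class k S l W (\<lambda>i x. F i x + G i x)"
  using assms(2,3)
proof (induction k arbitrary: W F G)
  case (0 W F G)
  obtain C where "C > 0" and C: "\<And>i x. x \<in> S \<Longrightarrow> norm (F i x) \<le> C * \<bar>W i x\<bar>"
    using sym_class_bound[OF "0.prems"(1)] by blast
  obtain D where "D > 0" and D: "\<And>i x. x \<in> S \<Longrightarrow> norm (G i x) \<le> D * \<bar>W i x\<bar>"
    using sym_class_bound[OF "0.prems"(2)] by blast
  have "norm (F i x + G i x) \<le> (C + D) * \<bar>W i x\<bar>" if "x \<in> S" for i x
    using norm_triangle_le[OF add_mono[OF C[OF that] D[OF that]]] by (simp add: algebra_simps)
  with 0 show ?case by (intro sym_class_0I) (auto intro!: continuous_intros)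
next
  case (Suc k)
  obtain C where "C > 0" and C: "\<And>i x. x \<in> S \<Longrightarrow> norm (F i x) \<le> C * \<bar>W i x\<bar>"
    using sym_class_bound[OF Suc.prems(1)] by blast
  obtain D where "D > 0" and D: "\<And>i x. x \<in> S \<Longrightarrow> norm (G i x) \<le> D * \<bar>W i x\<bar>"
    using sym_class_bound[OF Suc.prems(2)] by blast
  have "norm (F i x + G i x) \<le> (C + D) * \<bar>W i x\<bar>" if "x \<in> S" for i x
    using norm_triangle_le[OF add_mono[OF C[OF that] D[OF that]]] by (simp add: algebra_simps)
  moreover have "((\<lambda>x. F i x + G i x) has_derivative
      (\<lambda>v. frechet_derivative (F i) (at x) v + frechet_derivative (G i) (at x) v)) (at x)"
    if "x \<in> S" for i x
    using Suc.prems that by (intro derivative_intros sym_class_derivative)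
  ultimately show ?case
    by (rule sym_class_SucI[OF assms(1)]) (use Suc in auto)
qed

text \<open>In the Leibniz rule each summand puts the factor \<open>1 / l\<close> on one of the two
  weights. The general bilinear form makes products, scalings and inner products instances of one
  induction.\<close>

lemma sym_class_bilinear:
  fixes F :: "'i \<Rightarrow> 'a::euclidean_space \<Rightarrow> 'b::euclidean_space"
    and G :: "'i \<Rightarrow> 'a \<Rightarrow> 'c::euclidean_space" and p :: "'b \<Rightarrow> 'c \<Rightarrow> 'd::euclidean_space"
  assumes "open S" "bounded_bilinear p" "sym_class k S l W F" "sym_class k S l V G"
  shows "sym_class k S l (\<lambda>i x. W i x * V i x) (\<lambda>i x. p (F i x) (G i x))"
  using assms(3,4)
proof (induction k arbitrary: W F V G)
  interpret p: bounded_bilinear p by fact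
  obtain P where P: "P > 0" "\<And>a b. norm (p a b) \<le> norm a * norm b * P"
    using p.pos_bounded by blast
  have bd: "\<exists>C. \<forall>i. \<forall>x\<in>S. norm (p (F i x) (G i x)) \<le> C * \<bar>W i x * V i x\<bar>"
    if F: "sym_class k S l W F" and G: "sym_class k S l V G" for k W and F :: "'i \<Rightarrow> 'a \<Rightarrow> 'b" and V and G :: "'i \<Rightarrow> 'a \<Rightarrow> 'c"
  proof -
    obtain C where C: "C > 0" "\<And>i x. x \<in> S \<Longrightarrow> norm (F i x) \<le> C * \<bar>W i x\<bar>"
      using sym_class_bound[OF F] by blast
    obtain D where D: "D > 0" "\<And>i x. x \<in> S \<Longrightarrow> norm (G i x) \<le> D * \<bar>V i x\<bar>"
      using sym_class_bound[OF G] by blast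
    have "norm (p (F i x) (G i x)) \<le> (C * D * P) * \<bar>W i x * V i x\<bar>" if "x \<in> S" for i x
    proof -
      have "norm (p (F i x) (G i x)) \<le> norm (F i x) * norm (G i x) * P" by (rule P)
      also have "\<dots> \<le> (C * \<bar>W i x\<bar>) * (D * \<bar>V i x\<bar>) * P"
        using C D P that by (intro mult_mono) auto
      finally show ?thesis by (simp add: abs_mult mult_ac)
    qed
    then show ?thesis by blast
  qed
  { case (0 W F V G)
    show ?case
      using bd[OF 0] 0 by (auto intro!: p.continuous_on) }
  { case (Suc k W F V G)
    obtain C where C: "\<And>i x. x \<in> S \<Longrightarrow> norm (p (F i x) (G i x)) \<le> C * \<bar>W i x * V i x\<bar>"
      using bd[OF Suc.prems] by blast
    note F = sym_class_Suc_imp[OF Suc.prems(1)] and G = sym_class_Suc_imp[OF Suc.prems(2)]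
    show ?case
    proof (rule sym_class_SucI[OF assms(1) C])
      fix i x assume "x \<in> S"
      then show "((\<lambda>x. p (F i x) (G i x)) has_derivative
          (\<lambda>v. p (F i x) (frechet_derivative (G i) (at x) v) + p (frechet_derivative (F i) (at x) v) (G i x))) (at x)"
        using Suc.prems by (intro p.FDERIV sym_class_derivative)
    next
      fix v
      have "sym_class k S l (\<lambda>i x. W i x * (V i x / l x)) (\<lambda>i x. p (F i x) (frechet_derivative (G i) (at x) v))"
        using Suc.prems F by (intro Suc.IH) auto
      moreover have "sym_class k S l (\<lambda>i x. (W i x / l x) * V i x) (\<lambda>i x. p (frechet_derivative (F i) (at x) v) (G i x))"
        using Suc.prems G by (intro Suc.IH) auto
      ultimately show "sym_class k S l (\<lambda>i x. W i x * V i x / l x)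
         (\<lambda>i x. p (F i x) (frechet_derivative (G i) (at x) v) + p (frechet_derivative (F i) (at x) v) (G i x))"
        by (intro sym_class_add[OF assms(1)]) (simp_all add: field_simps)
    qed }
qed

lemmas sym_class_mult = sym_class_bilinear[OF _ bounded_bilinear_mult]
lemmas sym_class_scaleR = sym_class_bilinear[OF _ bounded_bilinear_scaleR]
lemmas sym_class_inner = sym_class_bilinear[OF _ bounded_bilinear_inner]

lemma sym_class_scaleR_const:
  assumes "open S" "sym_class k S l W F"
  shows "sym_class k S l W (\<lambda>i x. (c::real) *\<^sub>R F i x)"
  using sym_class_scaleR[OF assms(1) sym_class_const[of "\<lambda>_. c" "\<bar>c\<bar>"] assms(2)] by simp

lemma sym_class_mult_const:
  assumes "open S" "sym_class k S l W F"
  shows "sym_class k S l W (\<lambda>i x. (c::real) * F i x)"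
  using sym_class_mult[OF assms(1) sym_class_const[of "\<lambda>_. c" "\<bar>c\<bar>"] assms(2)] by simp

lemma sym_class_sum:
  assumes "open S" "\<And>b. b \<in> B \<Longrightarrow> sym_class k S l W (F b)"
  shows "sym_class k S l W (\<lambda>i x. \<Sum>b\<in>B. F b i x)"
proof (cases "finite B")
  case True
  then show ?thesis using assms(2)
    by (induction B rule: finite_induct) (auto intro: sym_class_zero sym_class_add[OF assms(1)])
qed (simp add: sym_class_zero)

lemma sym_class_power:
  fixes F :: "'i \<Rightarrow> 'a::euclidean_space \<Rightarrow> real"
  assumes "open S" "sym_class k S l W F"
  shows "sym_class k S l (\<lambda>i x. W i x ^ m) (\<lambda>i x. F i x ^ m)"
proof (induction m)
  case 0
  show ?case using sym_class_const[of "\<lambda>_. 1::real" 1] by simp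
next
  case (Suc m)
  show ?case using sym_class_mult[OF assms Suc] by simp
qed

lemma sym_class_components:
  assumes "open S"
  shows "sym_class k S l W F \<longleftrightarrow> (\<forall>b\<in>Basis. sym_class k S l W (\<lambda>i x. F i x \<bullet> b))"
proof
  assume "sym_class k S l W F"
  then show "\<forall>b\<in>Basis. sym_class k S l W (\<lambda>i x. F i x \<bullet> b)"
    using sym_class_inner[OF assms _ sym_class_const[of "\<lambda>_. b" "norm b" for b]] by fastforce
next
  assume *: "\<forall>b\<in>Basis. sym_class k S l W (\<lambda>i x. F i x \<bullet> b)"
  have "sym_class k S l W (\<lambda>i x. (F i x \<bullet> b) *\<^sub>R b)" if "b \<in> Basis" for b
    using sym_class_scaleR[OF assms *[rule_format, OF that] sym_class_const[of "\<lambda>_. b" "norm b"]]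
    by simp
  then have "sym_class k S l W (\<lambda>i x. \<Sum>b\<in>Basis. (F i x \<bullet> b) *\<^sub>R b)"
    by (intro sym_class_sum assms)
  then show "sym_class k S l W F" by (simp add: euclidean_representation)
qed

lemma sym_class_ident:
  assumes "open S" "\<And>x. x \<in> S \<Longrightarrow> l x \<noteq> 0" "\<And>x. x \<in> S \<Longrightarrow> norm x \<le> C * \<bar>l x\<bar>"
  shows "sym_class k S l (\<lambda>i. l) (\<lambda>i x::'a::euclidean_space. x)"
  using sym_class_inner_const[OF assms] by (subst sym_class_components[OF assms(1)]) blast

text \<open>The derivative of 1/F is -F'/F^2, and its weight (1/W) (W/l) (1/W) is again 1/W divided
  by \<open>l\<close>, so the induction closes on itself. The lower bound with \<open>c\<close> is
  what turns \<open>W\<close> into a two-sided measure of \<open>F\<close>.\<close>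

lemma sym_class_inverse:
  fixes F :: "'i \<Rightarrow> 'a::euclidean_space \<Rightarrow> real"
  assumes "open S" "c > 0"
    and "sym_class k S l W F" "\<And>i x. x \<in> S \<Longrightarrow> W i x \<noteq> 0" "\<And>i x. x \<in> S \<Longrightarrow> c * \<bar>W i x\<bar> \<le> \<bar>F i x\<bar>"
  shows "sym_class k S l (\<lambda>i x. inverse (W i x)) (\<lambda>i x. inverse (F i x))"
proof -
  have nz: "F i x \<noteq> 0" if "x \<in> S" for i x
    using assms(2) assms(4,5)[OF that, of i] by (smt (verit) mult_pos_pos)
  have bd: "norm (inverse (F i x)) \<le> (1/c) * \<bar>inverse (W i x)\<bar>" if "x \<in> S" for i x
    using assms(2) assms(4)[OF that, of i] assms(5)[OF that, of i] nz[OF that, of i]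
    by (simp add: field_simps)
  show ?thesis
    using assms(3)
  proof (induction k)
    case 0
    then show ?case
      using bd nz by (intro sym_class_0I[where C="1/c"]) (auto intro!: continuous_on_inverse)
  next
    case (Suc k)
    have IH: "sym_class k S l (\<lambda>i x. inverse (W i x)) (\<lambda>i x. inverse (F i x))"
      using Suc sym_class_Suc_imp by blast
    show ?case
    proof (rule sym_class_SucI[OF assms(1) bd])
      fix i x assume "x \<in> S"
      then show "((\<lambda>x. inverse (F i x)) has_derivative
          (\<lambda>v. - (inverse (F i x) * frechet_derivative (F i) (at x) v * inverse (F i x)))) (at x)"
        using Suc.prems nz by (intro Deriv.has_derivative_inverse sym_class_derivative)
    next
      fix v
      have "sym_class k S l (\<lambda>i x. inverse (W i x) * (W i x / l x) * inverse (W i x))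
          (\<lambda>i x. (-1) * (inverse (F i x) * frechet_derivative (F i) (at x) v * inverse (F i x)))"
        using Suc.prems by (intro sym_class_mult_const sym_class_mult assms(1) IH) auto
      then have "sym_class k S l (\<lambda>i x. inverse (W i x) / l x)
          (\<lambda>i x. (-1) * (inverse (F i x) * frechet_derivative (F i) (at x) v * inverse (F i x)))"
      proof (rule sym_class_weaken[where c=1])
        fix i x assume "x \<in> S"
        then have "inverse (W i x) * (W i x / l x) * inverse (W i x) = inverse (W i x) / l x"
          using assms(4) by simp
        then show "\<bar>inverse (W i x) * (W i x / l x) * inverse (W i x)\<bar> \<le> 1 * \<bar>inverse (W i x) / l x\<bar>"
          by (simp only: mult_1 order_refl)
      qed
      then show "sym_class k S l (\<lambda>i x. inverse (W i x) / l x)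
          (\<lambda>i x. - (inverse (F i x) * frechet_derivative (F i) (at x) v * inverse (F i x)))"
        by simp
    qed
  qed
qed

text \<open>The derivative F' / (2 sqrt F) is a product of functions whose class is known one order
  lower. The lower bound \<open>c\<close> keeps \<open>F\<close> away from the singularity of the
  root.\<close>

lemma sym_class_sqrt:
  fixes F :: "'i \<Rightarrow> 'a::euclidean_space \<Rightarrow> real"
  assumes "open S" "c > 0"
    and "sym_class k S l (\<lambda>_ _. 1) F" "\<And>i x. x \<in> S \<Longrightarrow> c \<le> F i x"
  shows "sym_class k S l (\<lambda>_ _. 1) (\<lambda>i x. sqrt (F i x))"
proof -
  obtain C where C: "C > 0" "\<And>i x. x \<in> S \<Longrightarrow> norm (F i x) \<le> C * \<bar>1\<bar>"
    using sym_class_bound[OF assms(3)] by blast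
  have bd: "norm (sqrt (F i x)) \<le> sqrt C * \<bar>1\<bar>" if "x \<in> S" for i x
    using C(2)[OF that, of i] assms(2) assms(4)[OF that, of i] by auto
  have pos: "0 < F i x" "sqrt c \<le> sqrt (F i x)" if "x \<in> S" for i x
    using assms(2) assms(4)[OF that, of i] by auto
  show ?thesis
    using assms(3)
  proof (induction k)
    case 0
    then show ?case
      using bd by (intro sym_class_0I[where C="sqrt C"]) (auto intro!: continuous_on_real_sqrt)
  next
    case (Suc k)
    have IH: "sym_class k S l (\<lambda>_ _. 1) (\<lambda>i x. sqrt (F i x))"
      using Suc sym_class_Suc_imp by blast
    have inv: "sym_class k S l (\<lambda>_ _. inverse 1) (\<lambda>i x. inverse (sqrt (F i x)))"
      by (rule sym_class_inverse[OF assms(1) _ IH, where c="sqrt c"]) (use assms(2) pos in \<open>auto intro: order_trans[OF _ abs_ge_self]\<close>)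
    show ?case
    proof (rule sym_class_SucI[OF assms(1) bd])
      fix i x assume "x \<in> S"
      then show "((\<lambda>x. sqrt (F i x)) has_derivative
          (\<lambda>v. frechet_derivative (F i) (at x) v * (inverse (sqrt (F i x)) / 2))) (at x)"
        using Suc.prems pos(1) by (intro has_derivative_real_sqrt sym_class_derivative)
    next
      fix v
      have "sym_class k S l (\<lambda>i x. (1 / l x) * inverse 1)
          (\<lambda>i x. (1/2) * (frechet_derivative (F i) (at x) v * inverse (sqrt (F i x))))"
        using Suc.prems by (intro sym_class_mult_const sym_class_mult assms(1) inv) auto
      then show "sym_class k S l (\<lambda>i x. 1 / l x)
          (\<lambda>i x. frechet_derivative (F i) (at x) v * (inverse (sqrt (F i x)) / 2))"
        by (simp add: mult_ac)
    qed
  qed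
qed

text \<open>Chain rule. The class only differentiates in fixed directions, while the inner
  derivative supplies a direction that varies with \<open>x\<close>; expanding it over
  \<open>Basis\<close> separates the two.\<close>

lemma sym_class_compose:
  fixes F :: "'i \<Rightarrow> 'b::euclidean_space \<Rightarrow> 'c::euclidean_space" and G :: "'i \<Rightarrow> 'a::euclidean_space \<Rightarrow> 'b"
  assumes "open S" "unif_class k T F" "unif_class k S G"
    and "\<And>i x. x \<in> S \<Longrightarrow> G i x \<in> T"
  shows "unif_class k S (\<lambda>i x. F i (G i x))"
  using assms(2,3)
proof (induction k arbitrary: F)
  case (0 F)
  obtain C where "C > 0" and C: "\<And>i x. x \<in> T \<Longrightarrow> norm (F i x) \<le> C * \<bar>1\<bar>"
    using sym_class_bound[OF 0(1)] by blast
  show ?case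
  proof (rule sym_class_0I[where C=C])
    show "norm (F i (G i x)) \<le> C * \<bar>1\<bar>" if "x \<in> S" for i x using C assms(4) that by simp
    show "continuous_on S (\<lambda>x. F i (G i x))" for i
      by (rule continuous_on_compose2[OF sym_class_continuous[OF 0(1)] sym_class_continuous[OF 0(2)]])
         (use assms(4) in auto)
  qed
next
  case (Suc k F)
  obtain C where "C > 0" and C: "\<And>i x. x \<in> T \<Longrightarrow> norm (F i x) \<le> C * \<bar>1\<bar>"
    using sym_class_bound[OF Suc.prems(1)] by blast
  have G: "unif_class k S G"
    using Suc.prems sym_class_Suc_imp by blast
  have lin: "linear (frechet_derivative (F i) (at y))" if "y \<in> T" for i y
    using sym_class_derivative[OF Suc.prems(1) that] has_derivative_linear by blast
  show ?case
  proof (rule sym_class_SucI[where C=C, OF assms(1)])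
    show "norm (F i (G i x)) \<le> C * \<bar>1\<bar>" if "x \<in> S" for i x using C assms(4) that by simp
  next
    fix i x assume x: "x \<in> S"
    have D: "((\<lambda>x. F i (G i x)) has_derivative
      (\<lambda>v. frechet_derivative (F i) (at (G i x)) (frechet_derivative (G i) (at x) v))) (at x)"
      using has_derivative_compose[OF sym_class_derivative[OF Suc.prems(2) x] sym_class_derivative[OF Suc.prems(1) assms(4)[OF x]]] .
    have expand: "frechet_derivative (F i) (at (G i x)) w
       = (\<Sum>b\<in>Basis. (w \<bullet> b) *\<^sub>R frechet_derivative (F i) (at (G i x)) b)" for w
    proof -
      have "frechet_derivative (F i) (at (G i x)) w
        = frechet_derivative (F i) (at (G i x)) (\<Sum>b\<in>Basis. (w \<bullet> b) *\<^sub>R b)"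
        by (simp add: euclidean_representation)
      also have "\<dots> = (\<Sum>b\<in>Basis. (w \<bullet> b) *\<^sub>R frechet_derivative (F i) (at (G i x)) b)"
        using lin[OF assms(4)[OF x], of i] by (simp add: linear_sum linear_cmul)
      finally show ?thesis .
    qed
    show "((\<lambda>x. F i (G i x)) has_derivative
      (\<lambda>v. \<Sum>b\<in>Basis. (frechet_derivative (G i) (at x) v \<bullet> b) *\<^sub>R frechet_derivative (F i) (at (G i x)) b)) (at x)"
      by (rule has_derivative_eq_rhs[OF D]) (rule ext, rule expand)
  next
    fix v
    have "unif_class k S (\<lambda>i x. (frechet_derivative (G i) (at x) v \<bullet> b) *\<^sub>R frechet_derivative (F i) (at (G i x)) b)"
      if "b \<in> Basis" for b
    proof -
      have "unif_class k S (\<lambda>i x. frechet_derivative (G i) (at x) v)"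
        using Suc.prems by simp
      then have 1: "unif_class k S (\<lambda>i x. frechet_derivative (G i) (at x) v \<bullet> b)"
        by (rule sym_class_components[OF assms(1), THEN iffD1, rule_format]) (rule that)
      have "unif_class k T (\<lambda>i x. frechet_derivative (F i) (at x) b)"
        using Suc.prems by simp
      from sym_class_scaleR[OF assms(1) 1 Suc.IH[OF this G]]
      show ?thesis by simp
    qed
    then show "sym_class k S (\<lambda>_. 1) (\<lambda>i x. 1 / 1)
      (\<lambda>i x. \<Sum>b\<in>Basis. (frechet_derivative (G i) (at x) v \<bullet> b) *\<^sub>R frechet_derivative (F i) (at (G i x)) b)"
      unfolding div_by_1 by (intro sym_class_sum assms(1))
  qed
qed

lemma sym_class_imp_Ck_on: "sym_class k S l W F \<Longrightarrow> Ck_on k (F i) S"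
proof (induction k arbitrary: W F)
  case (Suc k)
  have "Ck_on k (\<lambda>x. frechet_derivative (F i) (at x) v) S" for v
    using Suc.IH[of "\<lambda>i x. W i x / l x" "\<lambda>i x. frechet_derivative (F i) (at x) v"] Suc.prems by simp
  with Suc.prems show ?case by simp
qed simp

subsection \<open>Symmetry of second derivatives\<close>

text \<open>Two applications of the mean value theorem: along \<open>v\<close> to the increment of
  \<open>f\<close> by \<open>h *\<^sub>R w\<close>, then along \<open>w\<close> to the derivative in
  direction \<open>v\<close>.\<close>

lemma mixed_second_difference:
  fixes f :: "'a::euclidean_space \<Rightarrow> real"
  assumes "h > 0" and S: "\<And>s t. 0 \<le> s \<Longrightarrow> s \<le> h \<Longrightarrow> 0 \<le> t \<Longrightarrow> t \<le> h \<Longrightarrow> x + s *\<^sub>R v + t *\<^sub>R w \<in> S"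
    and f: "\<And>y. y \<in> S \<Longrightarrow> f differentiable (at y)"
    and fv: "\<And>y. y \<in> S \<Longrightarrow> (\<lambda>z. frechet_derivative f (at z) v) differentiable (at y)"
  shows "\<exists>s\<in>{0..h}. \<exists>t\<in>{0..h}. f (x + h *\<^sub>R v + h *\<^sub>R w) - f (x + h *\<^sub>R v) - f (x + h *\<^sub>R w) + f x
    = h * h * frechet_derivative (\<lambda>z. frechet_derivative f (at z) v) (at (x + s *\<^sub>R v + t *\<^sub>R w)) w"
proof -
  let ?fv = "\<lambda>z. frechet_derivative f (at z) v"
  have f': "(f has_derivative frechet_derivative f (at y)) (at y)" if "y \<in> S" for y
    using f[OF that] by (simp add: frechet_derivative_works)
  have fv': "(?fv has_derivative frechet_derivative ?fv (at y)) (at y)" if "y \<in> S" for y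
    using fv[OF that] by (simp add: frechet_derivative_works)
  have lin: "frechet_derivative f (at y) (c *\<^sub>R u) = c * frechet_derivative f (at y) u" if "y \<in> S" for y c u
    using has_derivative_linear[OF f'[OF that]] by (simp add: linear_cmul)
  have linv: "frechet_derivative ?fv (at y) (c *\<^sub>R u) = c * frechet_derivative ?fv (at y) u" if "y \<in> S" for y c u
    using has_derivative_linear[OF fv'[OF that]] by (simp add: linear_cmul)
  define \<phi> where "\<phi> s = f (x + s *\<^sub>R v + h *\<^sub>R w) - f (x + s *\<^sub>R v)" for s
  have line: "((\<lambda>s. f (x + s *\<^sub>R v + t *\<^sub>R w)) has_derivative
      (\<lambda>c. c * ?fv (x + s *\<^sub>R v + t *\<^sub>R w))) (at s)"
    if "0 \<le> s" "s \<le> h" "0 \<le> t" "t \<le> h" for s t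
  proof -
    have "((\<lambda>s. x + s *\<^sub>R v + t *\<^sub>R w) has_derivative (\<lambda>c. c *\<^sub>R v)) (at s)"
      by (auto intro!: derivative_eq_intros)
    from has_derivative_compose[OF this f'[OF S[OF that]]] show ?thesis
      by (simp add: lin[OF S[OF that]])
  qed
  have "(\<phi> has_derivative (\<lambda>c. c * ?fv (x + s *\<^sub>R v + h *\<^sub>R w) - c * ?fv (x + s *\<^sub>R v))) (at s)"
    if "0 \<le> s" "s \<le> h" for s
    unfolding \<phi>_def using line[OF that, of h] line[OF that, of 0] \<open>h > 0\<close>
    by (auto intro!: has_derivative_diff)
  then obtain s where s: "0 < s" "s < h"
    "\<phi> h - \<phi> 0 = h * ?fv (x + s *\<^sub>R v + h *\<^sub>R w) - h * ?fv (x + s *\<^sub>R v)"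
    using mvt_simple[of 0 h \<phi> "\<lambda>s c. c * ?fv (x + s *\<^sub>R v + h *\<^sub>R w) - c * ?fv (x + s *\<^sub>R v)"]
      has_derivative_at_withinI \<open>h > 0\<close> by fastforce
  have "((\<lambda>t. ?fv (x + s *\<^sub>R v + t *\<^sub>R w)) has_derivative
      (\<lambda>c. c * frechet_derivative ?fv (at (x + s *\<^sub>R v + t *\<^sub>R w)) w)) (at t)"
    if "0 \<le> t" "t \<le> h" for t
  proof -
    have y: "x + s *\<^sub>R v + t *\<^sub>R w \<in> S" using s that by (intro S) auto
    have "((\<lambda>t. x + s *\<^sub>R v + t *\<^sub>R w) has_derivative (\<lambda>c. c *\<^sub>R w)) (at t)"
      by (auto intro!: derivative_eq_intros)
    from has_derivative_compose[OF this fv'[OF y]] show ?thesis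
      by (simp add: linv[OF y])
  qed
  then obtain t where t: "0 < t" "t < h"
    "?fv (x + s *\<^sub>R v + h *\<^sub>R w) - ?fv (x + s *\<^sub>R v + 0 *\<^sub>R w)
     = h * frechet_derivative ?fv (at (x + s *\<^sub>R v + t *\<^sub>R w)) w"
    using mvt_simple[of 0 h "\<lambda>t. ?fv (x + s *\<^sub>R v + t *\<^sub>R w)"
        "\<lambda>t c. c * frechet_derivative ?fv (at (x + s *\<^sub>R v + t *\<^sub>R w)) w"]
      has_derivative_at_withinI \<open>h > 0\<close> by fastforce
  have "f (x + h *\<^sub>R v + h *\<^sub>R w) - f (x + h *\<^sub>R v) - f (x + h *\<^sub>R w) + f x = \<phi> h - \<phi> 0"
    by (simp add: \<phi>_def)
  also have "\<dots> = h * (?fv (x + s *\<^sub>R v + h *\<^sub>R w) - ?fv (x + s *\<^sub>R v))"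
    using s(3) by (simp add: algebra_simps)
  also have "\<dots> = h * h * frechet_derivative ?fv (at (x + s *\<^sub>R v + t *\<^sub>R w)) w"
    using t(3) by simp
  finally show ?thesis using s t by (intro bexI[of _ s] bexI[of _ t]) auto
qed

text \<open>The second difference is symmetric in \<open>v\<close> and \<open>w\<close>; divided by
  the square of the step it converges to both mixed derivatives.\<close>

lemma frechet_derivative_commute:
  fixes f :: "'a::euclidean_space \<Rightarrow> real"
  assumes "open S" "x \<in> S" "Ck_on 2 f S"
  shows "frechet_derivative (\<lambda>z. frechet_derivative f (at z) v) (at x) w
       = frechet_derivative (\<lambda>z. frechet_derivative f (at z) w) (at x) v"
    (is "?g v w x = ?g w v x")
proof -
  have f: "f differentiable (at y)" if "y \<in> S" for y
    using assms(3) that by (simp add: numeral_2_eq_2)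
  have f': "(\<lambda>z. frechet_derivative f (at z) u) differentiable (at y)" if "y \<in> S" for y u
    using assms(3) that by (simp add: numeral_2_eq_2)
  have cont: "isCont (?g u u') x" for u u'
    using assms by (simp add: numeral_2_eq_2 continuous_on_eq_continuous_at)
  obtain e where e: "e > 0" "ball x e \<subseteq> S"
    using assms openE by blast
  \<comment> \<open>The first factor keeps all intermediate points within e/2 of \<open>x\<close>,
    hence inside \<open>S\<close>.\<close>
  define h where "h n = e / (2 * (norm v + norm w + 1)) * inverse (real (Suc n))" for n
  have h0: "h n > 0" for n
    using e(1) by (auto simp: h_def intro!: mult_pos_pos divide_pos_pos add_nonneg_pos)
  have h_lim: "h \<longlonglongrightarrow> 0"
    unfolding h_def by (rule tendsto_mult_right_zero[OF LIMSEQ_inverse_real_of_nat])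
  have near: "norm (s *\<^sub>R v' + t *\<^sub>R w') \<le> h n * (norm v + norm w)"
    if "0 \<le> s" "s \<le> h n" "0 \<le> t" "t \<le> h n" "(v', w') = (v, w) \<or> (v', w') = (w, v)" for s t n v' w'
  proof -
    have "norm (s *\<^sub>R v' + t *\<^sub>R w') \<le> s * norm v' + t * norm w'"
      using that by (intro norm_triangle_le) simp
    also have "\<dots> \<le> h n * norm v' + h n * norm w'"
      using that by (intro add_mono mult_right_mono) auto
    finally show ?thesis using that(5) by (auto simp: algebra_simps)
  qed
  have in_S: "x + s *\<^sub>R v' + t *\<^sub>R w' \<in> S"
    if "0 \<le> s" "s \<le> h n" "0 \<le> t" "t \<le> h n" "(v', w') = (v, w) \<or> (v', w') = (w, v)" for s t n v' w'
  proof -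
    have "h n \<le> e / (2 * (norm v + norm w + 1)) * 1"
      unfolding h_def using e(1) by (intro mult_left_mono) (auto simp: field_simps add_nonneg_pos)
    then have "h n * (norm v + norm w) \<le> e / (2 * (norm v + norm w + 1)) * (norm v + norm w + 1)"
      using h0[of n] by (intro mult_mono) auto
    also have "\<dots> = e / 2"
      by (simp add: add_nonneg_pos field_simps add_nonneg_eq_0_iff)
    finally have "norm (s *\<^sub>R v' + t *\<^sub>R w') < e"
      using near[OF that] e(1) by linarith
    then have "x + s *\<^sub>R v' + t *\<^sub>R w' \<in> ball x e"
      unfolding mem_ball dist_norm by (subst norm_minus_commute) (simp add: add.assoc)
    then show ?thesis using e(2) by blast
  qed
  define \<Delta> where "\<Delta> n = (f (x + h n *\<^sub>R v + h n *\<^sub>R w) - f (x + h n *\<^sub>R v) - f (x + h n *\<^sub>R w) + f x) / (h n * h n)" for n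
  have lim: "\<Delta> \<longlonglongrightarrow> ?g v' w' x" if vw: "(v', w') = (v, w) \<or> (v', w') = (w, v)" for v' w'
  proof -
    have "\<exists>s\<in>{0..h n}. \<exists>t\<in>{0..h n}. \<Delta> n = ?g v' w' (x + s *\<^sub>R v' + t *\<^sub>R w')" for n
    proof -
      have "\<exists>s\<in>{0..h n}. \<exists>t\<in>{0..h n}. f (x + h n *\<^sub>R v' + h n *\<^sub>R w') - f (x + h n *\<^sub>R v') - f (x + h n *\<^sub>R w') + f x
        = h n * h n * ?g v' w' (x + s *\<^sub>R v' + t *\<^sub>R w')"
        using in_S[OF _ _ _ _ vw] f f' by (intro mixed_second_difference[where S=S, OF h0]) auto
      then obtain s t where st: "s \<in> {0..h n}" "t \<in> {0..h n}"
        "f (x + h n *\<^sub>R v' + h n *\<^sub>R w') - f (x + h n *\<^sub>R v') - f (x + h n *\<^sub>R w') + f x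
          = h n * h n * ?g v' w' (x + s *\<^sub>R v' + t *\<^sub>R w')" by blast
      have "f (x + h n *\<^sub>R v' + h n *\<^sub>R w') - f (x + h n *\<^sub>R v') - f (x + h n *\<^sub>R w') + f x
          = f (x + h n *\<^sub>R v + h n *\<^sub>R w) - f (x + h n *\<^sub>R v) - f (x + h n *\<^sub>R w) + f x"
        using vw by (auto simp: add_ac)
      with st(3) have "f (x + h n *\<^sub>R v + h n *\<^sub>R w) - f (x + h n *\<^sub>R v) - f (x + h n *\<^sub>R w) + f x
          = h n * h n * ?g v' w' (x + s *\<^sub>R v' + t *\<^sub>R w')" by metis
      then have "\<Delta> n = ?g v' w' (x + s *\<^sub>R v' + t *\<^sub>R w')"
        using h0[of n] unfolding \<Delta>_def by simp
      with st(1,2) show ?thesis by blast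
    qed
    then obtain s t where st: "\<And>n. s n \<in> {0..h n}" "\<And>n. t n \<in> {0..h n}"
        "\<And>n. \<Delta> n = ?g v' w' (x + s n *\<^sub>R v' + t n *\<^sub>R w')"
      by metis
    have "(\<lambda>n. s n *\<^sub>R v' + t n *\<^sub>R w') \<longlonglongrightarrow> 0"
    proof (rule Lim_null_comparison)
      show "\<forall>\<^sub>F n in sequentially. norm (s n *\<^sub>R v' + t n *\<^sub>R w') \<le> h n * (norm v + norm w)"
        using near[OF _ _ _ _ vw] st by auto
      show "(\<lambda>n. h n * (norm v + norm w)) \<longlonglongrightarrow> 0"
        using tendsto_mult_left_zero[OF h_lim] .
    qed
    then have "(\<lambda>n. x + (s n *\<^sub>R v' + t n *\<^sub>R w')) \<longlonglongrightarrow> x + 0"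
      by (intro tendsto_intros)
    then have "(\<lambda>n. ?g v' w' (x + (s n *\<^sub>R v' + t n *\<^sub>R w'))) \<longlonglongrightarrow> ?g v' w' x"
      using isCont_tendsto_compose[OF cont, of "\<lambda>n. x + (s n *\<^sub>R v' + t n *\<^sub>R w')" sequentially] by simp
    moreover have "\<Delta> = (\<lambda>n. ?g v' w' (x + (s n *\<^sub>R v' + t n *\<^sub>R w')))"
      using st(3) by (auto simp: add.assoc)
    ultimately show ?thesis by simp
  qed
  show ?thesis
    by (rule LIMSEQ_unique[OF lim lim]) simp_all
qed

section \<open>Elementary calculus of \<open>Ck_on\<close>\<close>

lemma Ck_on_mono: "Ck_on k f S \<Longrightarrow> j \<le> k \<Longrightarrow> Ck_on j f S"
proof (induction k arbitrary: f j)
  case (Suc k)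
  have "continuous_on S f"
    using Suc.prems by (auto intro!: continuous_at_imp_continuous_on differentiable_imp_continuous_within)
  with Suc show ?case by (cases j) auto
qed simp

lemma Ck_on_cong:
  assumes "open S" "\<And>x. x \<in> S \<Longrightarrow> f x = g x" "Ck_on k f S"
  shows "Ck_on k g S"
  using assms(2,3)
proof (induction k arbitrary: f g)
  case 0
  then show ?case by (auto intro: continuous_on_eq)
next
  case (Suc k)
  have "Ck_on k (\<lambda>x. frechet_derivative g (at x) v) S" for v
  proof (rule Suc.IH)
    show "Ck_on k (\<lambda>x. frechet_derivative f (at x) v) S" using Suc.prems by simp
    show "frechet_derivative f (at x) v = frechet_derivative g (at x) v" if "x \<in> S" for x
      using frechet_derivative_cong_open[OF assms(1) that, of f g] Suc.prems(1) by simp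
  qed
  moreover have "g differentiable (at x)" if "x \<in> S" for x
  proof -
    have "f differentiable (at x)" using Suc.prems that by simp
    then show ?thesis
      unfolding differentiable_def
      using has_derivative_transform_within_open[of f _ x UNIV S g] that assms(1) Suc.prems(1)
      by blast
  qed
  ultimately show ?case by simp
qed

lemma Ck_on_has_derivative:
  assumes "Ck_on (Suc k) f S" "x \<in> S"
  shows "(f has_derivative frechet_derivative f (at x)) (at x)"
  using assms by (simp add: frechet_derivative_works)

lemma linear_basis_expansion:
  fixes L :: "'a::euclidean_space \<Rightarrow> 'b::real_vector"
  assumes "linear L"
  shows "L v = (\<Sum>b\<in>Basis. (v \<bullet> b) *\<^sub>R L b)"
proof -
  have "L v = L (\<Sum>b\<in>Basis. (v \<bullet> b) *\<^sub>R b)" by (simp add: euclidean_representation)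
  then show ?thesis using assms by (simp add: linear_sum linear_cmul)
qed

subsection \<open>Taylor expansion and removable singularities\<close>

text \<open>\<open>taylor_term j f x\<close> is \<open>D\<^sup>j f(0)(x, \<dots>, x)\<close>.\<close>
primrec taylor_term :: "nat \<Rightarrow> ('a::euclidean_space \<Rightarrow> real) \<Rightarrow> 'a \<Rightarrow> real" where
  "taylor_term 0 f x = f 0"
| "taylor_term (Suc j) f x = (\<Sum>b\<in>Basis. (x \<bullet> b) * taylor_term j (\<lambda>y. frechet_derivative f (at y) b) x)"

definition taylor_poly :: "nat \<Rightarrow> ('a::euclidean_space \<Rightarrow> real) \<Rightarrow> 'a \<Rightarrow> real" where
  "taylor_poly k f x = (\<Sum>j\<le>k. taylor_term j f x / fact j)"

lemma taylor_term_cong: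
  assumes "open S" "0 \<in> S" "\<And>x. x \<in> S \<Longrightarrow> f x = g x"
  shows "taylor_term j f x = taylor_term j g x"
  using assms(3)
proof (induction j arbitrary: f g)
  case 0
  then show ?case using assms by simp
next
  case (Suc j)
  have "taylor_term j (\<lambda>y. frechet_derivative f (at y) b) x = taylor_term j (\<lambda>y. frechet_derivative g (at y) b) x" for b
  proof (rule Suc.IH)
    show "frechet_derivative f (at y) b = frechet_derivative g (at y) b" if "y \<in> S" for y
      using frechet_derivative_cong_open[OF assms(1) that, of f g] Suc.prems by simp
  qed
  then show ?case by simp
qed

lemma taylor_term_sum:
  assumes "open S" "0 \<in> S" "finite B" "\<And>b. b \<in> B \<Longrightarrow> Ck_on j (f b) S"
  shows "taylor_term j (\<lambda>y. \<Sum>b\<in>B. c b * f b y) x = (\<Sum>b\<in>B. c b * taylor_term j (f b) x)"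
  using assms(4)
proof (induction j arbitrary: f)
  case 0
  then show ?case by simp
next
  case (Suc j)
  have "taylor_term j (\<lambda>y. frechet_derivative (\<lambda>y. \<Sum>b\<in>B. c b * f b y) (at y) d) x
      = (\<Sum>b\<in>B. c b * taylor_term j (\<lambda>y. frechet_derivative (f b) (at y) d) x)" for d
  proof -
    have "taylor_term j (\<lambda>y. frechet_derivative (\<lambda>y. \<Sum>b\<in>B. c b * f b y) (at y) d) x
       = taylor_term j (\<lambda>y. \<Sum>b\<in>B. c b * frechet_derivative (f b) (at y) d) x"
    proof (rule taylor_term_cong[OF assms(1,2)])
      fix y assume y: "y \<in> S"
      have "((\<lambda>y. \<Sum>b\<in>B. c b * f b y) has_derivative (\<lambda>d. \<Sum>b\<in>B. c b * frechet_derivative (f b) (at y) d)) (at y)"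
        using Suc.prems y by (intro has_derivative_sum has_derivative_mult_right Ck_on_has_derivative)
      from frechet_derivative_at[OF this]
      show "frechet_derivative (\<lambda>y. \<Sum>b\<in>B. c b * f b y) (at y) d = (\<Sum>b\<in>B. c b * frechet_derivative (f b) (at y) d)"
        by (rule fun_cong[symmetric])
    qed
    also have "\<dots> = (\<Sum>b\<in>B. c b * taylor_term j (\<lambda>y. frechet_derivative (f b) (at y) d) x)"
      using Suc.prems by (intro Suc.IH) auto
    finally show ?thesis .
  qed
  then have "taylor_term (Suc j) (\<lambda>y. \<Sum>b\<in>B. c b * f b y) x
      = (\<Sum>d\<in>Basis. \<Sum>b\<in>B. c b * ((x \<bullet> d) * taylor_term j (\<lambda>y. frechet_derivative (f b) (at y) d) x))"
    by (simp add: sum_distrib_left mult_ac)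
  also have "\<dots> = (\<Sum>b\<in>B. c b * taylor_term (Suc j) (f b) x)"
    by (subst sum.swap) (simp add: sum_distrib_left)
  finally show ?case .
qed

text \<open>\<open>taylor_term\<close> differentiates along \<open>Basis\<close> only; linearity of
  the derivative extends this to an arbitrary first direction.\<close>

lemma taylor_term_directional:
  assumes "open S" "0 \<in> S" "Ck_on (Suc j) f S"
  shows "taylor_term j (\<lambda>y. frechet_derivative f (at y) v) x
       = (\<Sum>b\<in>Basis. (v \<bullet> b) * taylor_term j (\<lambda>y. frechet_derivative f (at y) b) x)"
proof -
  have "taylor_term j (\<lambda>y. frechet_derivative f (at y) v) x
      = taylor_term j (\<lambda>y. \<Sum>b\<in>Basis. (v \<bullet> b) * frechet_derivative f (at y) b) x"
  proof (rule taylor_term_cong[OF assms(1,2)])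
    show "frechet_derivative f (at y) v = (\<Sum>b\<in>Basis. (v \<bullet> b) * frechet_derivative f (at y) b)" if "y \<in> S" for y
      using linear_basis_expansion[OF has_derivative_linear[OF Ck_on_has_derivative[OF assms(3) that]], of v] by simp
  qed
  also have "\<dots> = (\<Sum>b\<in>Basis. (v \<bullet> b) * taylor_term j (\<lambda>y. frechet_derivative f (at y) b) x)"
    using assms by (intro taylor_term_sum) auto
  finally show ?thesis .
qed

text \<open>Each of the j+1 equal arguments of the symmetric form D^(j+1) f(0) contributes the same
  term. In the induction, symmetry of second derivatives moves \<open>v\<close> to the derivative
  that is taken first.\<close>

lemma taylor_term_has_derivative:
  assumes "open S" "0 \<in> S" "Ck_on (Suc j) f S"
  shows "(taylor_term (Suc j) f has_derivative
      (\<lambda>v. Suc j * taylor_term j (\<lambda>y. frechet_derivative f (at y) v) x)) (at x)"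
  using assms(3)
proof (induction j arbitrary: f)
  case 0
  have "taylor_term (Suc 0) f = (\<lambda>x. \<Sum>b\<in>Basis. (x \<bullet> b) * frechet_derivative f (at 0) b)"
    by (simp add: fun_eq_iff)
  moreover have "((\<lambda>x. \<Sum>b\<in>Basis. (x \<bullet> b) * frechet_derivative f (at 0) b) has_derivative
     (\<lambda>v. \<Sum>b\<in>Basis. (v \<bullet> b) * frechet_derivative f (at 0) b)) (at x)"
    by (auto intro!: derivative_eq_intros)
  moreover have "(\<Sum>b\<in>Basis. (v \<bullet> b) * frechet_derivative f (at 0) b) = frechet_derivative f (at 0) v" for v
    using linear_basis_expansion[OF has_derivative_linear[OF Ck_on_has_derivative[OF 0 assms(2)]], of v] by simp
  ultimately show ?case by simp
next
  case (Suc j)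
  let ?d = "\<lambda>f b y. frechet_derivative f (at y) b"
  have "((\<lambda>x. \<Sum>b\<in>Basis. (x \<bullet> b) * taylor_term (Suc j) (?d f b) x) has_derivative
     (\<lambda>v. \<Sum>b\<in>Basis. (x \<bullet> b) * (Suc j * taylor_term j (?d (?d f b) v) x) + (v \<bullet> b) * taylor_term (Suc j) (?d f b) x)) (at x)"
    using Suc.prems
    by (intro has_derivative_sum has_derivative_mult Suc.IH) (auto intro!: derivative_eq_intros)
  moreover have "(\<Sum>b\<in>Basis. (x \<bullet> b) * (Suc j * taylor_term j (?d (?d f b) v) x) + (v \<bullet> b) * taylor_term (Suc j) (?d f b) x)
      = Suc (Suc j) * taylor_term (Suc j) (?d f v) x" for v
  proof -
    have "taylor_term j (?d (?d f b) v) x = taylor_term j (?d (?d f v) b) x" for b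
      using frechet_derivative_commute[OF assms(1) _ Ck_on_mono[OF Suc.prems], of _ b v]
      by (intro taylor_term_cong[OF assms(1,2)]) auto
    then have "(\<Sum>b\<in>Basis. (x \<bullet> b) * (Suc j * taylor_term j (?d (?d f b) v) x)) = Suc j * taylor_term (Suc j) (?d f v) x"
      by (simp add: sum_distrib_left mult_ac)
    moreover have "(\<Sum>b\<in>Basis. (v \<bullet> b) * taylor_term (Suc j) (?d f b) x) = taylor_term (Suc j) (?d f v) x"
      using taylor_term_directional[OF assms(1,2) Suc.prems, of v x] by simp
    ultimately show ?thesis by (simp add: sum.distrib algebra_simps)
  qed
  moreover have "taylor_term (Suc (Suc j)) f = (\<lambda>x. \<Sum>b\<in>Basis. (x \<bullet> b) * taylor_term (Suc j) (?d f b) x)"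
    by (simp add: fun_eq_iff)
  ultimately show ?case by simp
qed

text \<open>The factor \<open>Suc j\<close> of the previous lemma cancels against
  \<open>fact (Suc j)\<close>. The induction for the remainder rests on this: differentiation sends
  remainders to remainders of one order less.\<close>

lemma taylor_poly_has_derivative:
  assumes "open S" "0 \<in> S" "Ck_on (Suc k) f S"
  shows "(taylor_poly (Suc k) f has_derivative
      (\<lambda>v. taylor_poly k (\<lambda>y. frechet_derivative f (at y) v) x)) (at x)"
proof -
  have eq: "taylor_poly (Suc k) f = (\<lambda>x. f 0 + (\<Sum>j\<le>k. taylor_term (Suc j) f x / fact (Suc j)))"
    unfolding fun_eq_iff taylor_poly_def sum.atMost_Suc_shift by simp
  have "(taylor_poly (Suc k) f has_derivative
      (\<lambda>v. 0 + (\<Sum>j\<le>k. (Suc j * taylor_term j (\<lambda>y. frechet_derivative f (at y) v) x) / fact (Suc j)))) (at x)"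
    unfolding eq
  proof (intro has_derivative_add has_derivative_sum has_derivative_const)
    fix j assume "j \<in> {..k}"
    then have "Ck_on (Suc j) f S" by (intro Ck_on_mono[OF assms(3)]) simp
    from has_derivative_mult_right[OF taylor_term_has_derivative[OF assms(1,2) this], of "1 / fact (Suc j)" x]
    show "((\<lambda>x. taylor_term (Suc j) f x / fact (Suc j)) has_derivative
      (\<lambda>v. (Suc j * taylor_term j (\<lambda>y. frechet_derivative f (at y) v) x) / fact (Suc j))) (at x)"
      by simp
  qed
  then show ?thesis
    by (simp add: taylor_poly_def field_simps del: of_nat_Suc)
qed

text \<open>
  The bound \<open>C\<close> is uniform in \<open>i\<close>, the convergence to \<open>0\<close> is not: the top derivatives of the functions
  in a family need not be equicontinuous.
\<close>
definition modulus :: "real \<Rightarrow> ('i \<Rightarrow> real \<Rightarrow> real) \<Rightarrow> bool" where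
  "modulus \<rho> \<omega> \<longleftrightarrow> (\<forall>i r s. 0 \<le> r \<longrightarrow> r \<le> s \<longrightarrow> s < \<rho> \<longrightarrow> \<omega> i r \<le> \<omega> i s) \<and>
     (\<exists>C. \<forall>i r. 0 \<le> r \<longrightarrow> r < \<rho> \<longrightarrow> 0 \<le> \<omega> i r \<and> \<omega> i r \<le> C) \<and>
     (\<forall>i. (\<omega> i \<longlongrightarrow> 0) (at_right 0))"

lemma modulus_sum:
  assumes "finite B" "\<And>b. b \<in> B \<Longrightarrow> modulus \<rho> (\<omega> b)"
  shows "modulus \<rho> (\<lambda>i r. \<Sum>b\<in>B. \<omega> b i r)"
proof -
  have "\<forall>b\<in>B. \<exists>C. \<forall>i r. 0 \<le> r \<longrightarrow> r < \<rho> \<longrightarrow> 0 \<le> \<omega> b i r \<and> \<omega> b i r \<le> C"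
    using assms(2) by (simp add: modulus_def)
  then obtain C where C: "\<And>b i r. b \<in> B \<Longrightarrow> 0 \<le> r \<Longrightarrow> r < \<rho> \<Longrightarrow> 0 \<le> \<omega> b i r \<and> \<omega> b i r \<le> C b"
    by metis
  have "\<exists>D. \<forall>i r. 0 \<le> r \<longrightarrow> r < \<rho> \<longrightarrow> 0 \<le> (\<Sum>b\<in>B. \<omega> b i r) \<and> (\<Sum>b\<in>B. \<omega> b i r) \<le> D"
    using C by (intro exI[of _ "\<Sum>b\<in>B. C b"]) (auto intro!: sum_nonneg sum_mono)
  moreover have "(\<Sum>b\<in>B. \<omega> b i r) \<le> (\<Sum>b\<in>B. \<omega> b i s)" if "0 \<le> r" "r \<le> s" "s < \<rho>" for i r s
    using assms(2) that by (intro sum_mono) (auto simp: modulus_def)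
  moreover have "((\<lambda>r. \<Sum>b\<in>B. \<omega> b i r) \<longlongrightarrow> (\<Sum>b\<in>B. 0)) (at_right 0)" for i
    using assms(2) by (intro tendsto_sum) (auto simp: modulus_def)
  ultimately show ?thesis unfolding modulus_def by simp
qed

lemma modulus_add:
  assumes "modulus \<rho> \<omega>" "modulus \<rho> \<omega>'"
  shows "modulus \<rho> (\<lambda>i r. \<omega> i r + \<omega>' i r)"
proof -
  have "modulus \<rho> (\<lambda>i r. \<Sum>b\<in>{False, True}. (if b then \<omega>' else \<omega>) i r)"
    by (rule modulus_sum) (use assms in \<open>simp_all split: if_splits\<close>)
  then show ?thesis by simp
qed

lemma modulus_ident: "modulus \<rho> (\<lambda>(i::'a) r. r)"
proof -
  have "\<exists>C. \<forall>(i::'a) r. 0 \<le> r \<longrightarrow> r < \<rho> \<longrightarrow> 0 \<le> r \<and> r \<le> C"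
    by (rule exI[of _ \<rho>]) auto
  moreover have "((\<lambda>r. r) \<longlongrightarrow> 0) (at_right (0::real))"
    by (rule tendsto_ident_at)
  ultimately show ?thesis unfolding modulus_def by blast
qed

lemma modulus_of_continuity_at_0:
  fixes F :: "'i \<Rightarrow> 'a::euclidean_space \<Rightarrow> real"
  assumes "\<rho> > 0" "\<And>i. continuous_on (ball 0 \<rho>) (F i)" "\<And>i x. x \<in> ball 0 \<rho> \<Longrightarrow> \<bar>F i x\<bar> \<le> C"
  shows "\<exists>\<omega>. modulus \<rho> \<omega> \<and> (\<forall>i. \<forall>x\<in>ball 0 \<rho>. \<bar>F i x - F i 0\<bar> \<le> \<omega> i (norm x))"
proof -
  \<comment> \<open>A supremum over a whole ball is monotone in \<open>r\<close> by construction.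
    The bound \<open>2 * C\<close> is uniform in \<open>i\<close>; the limit at 0 comes from the
    continuity of each \<open>F i\<close> separately.\<close>
  define \<omega> where "\<omega> i r = (SUP x\<in>ball 0 \<rho> \<inter> cball 0 r. \<bar>F i x - F i 0\<bar>)" for i r
  have bd: "\<bar>F i x - F i 0\<bar> \<le> 2 * C" if "x \<in> ball 0 \<rho>" for i x
    using assms(3)[OF that, of i] assms(3)[of 0 i] assms(1) by auto
  have bdd: "bdd_above ((\<lambda>x. \<bar>F i x - F i 0\<bar>) ` (ball 0 \<rho> \<inter> cball 0 r))" for i r
    using bd by (intro bdd_aboveI2[of _ _ "2 * C"]) auto
  have ne: "0 \<in> ball 0 \<rho> \<inter> cball (0::'a) r" if "0 \<le> r" for r
    using assms(1) that by auto
  have ne': "ball 0 \<rho> \<inter> cball (0::'a) r \<noteq> {}" if "0 \<le> r" for r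
    using ne[OF that] by blast
  have upper: "\<bar>F i x - F i 0\<bar> \<le> \<omega> i r" if "x \<in> ball 0 \<rho> \<inter> cball 0 r" for i x r
    unfolding \<omega>_def by (rule cSUP_upper[OF that bdd])
  have nonneg: "0 \<le> \<omega> i r" if "0 \<le> r" for i r
    using upper[OF ne[OF that], of i] by simp
  have "modulus \<rho> \<omega>"
    unfolding modulus_def
  proof (intro conjI allI impI)
    show "\<omega> i r \<le> \<omega> i s" if "0 \<le> r" "r \<le> s" "s < \<rho>" for i r s
      unfolding \<omega>_def using that by (intro cSUP_subset_mono[OF ne' bdd]) auto
    have "0 \<le> \<omega> i r \<and> \<omega> i r \<le> 2 * C" if "0 \<le> r" for i r
      using bd nonneg[OF that] unfolding \<omega>_def by (auto intro!: cSUP_least[OF ne'[OF that]])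
    then show "\<exists>C. \<forall>i r. 0 \<le> r \<longrightarrow> r < \<rho> \<longrightarrow> 0 \<le> \<omega> i r \<and> \<omega> i r \<le> C"
      by blast
    show "(\<omega> i \<longlongrightarrow> 0) (at_right 0)" for i
    proof (rule tendstoI)
      fix e :: real assume e: "e > 0"
      have "isCont (F i) 0"
        using assms(1,2) by (simp add: continuous_on_eq_continuous_at)
      then obtain d where d: "d > 0" "\<And>x. dist x 0 < d \<Longrightarrow> dist (F i x) (F i 0) < e / 2"
        using e unfolding continuous_at_eps_delta by (meson half_gt_zero)
      have "dist (\<omega> i r) 0 < e" if "0 < r" "r < d" for r
      proof -
        have "\<omega> i r \<le> e / 2"
          unfolding \<omega>_def using that d(2)
          by (intro cSUP_least ne') (auto simp: dist_real_def intro: less_imp_le)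
        then show ?thesis using nonneg[of r i] that e by simp
      qed
      then show "\<forall>\<^sub>F r in at_right 0. dist (\<omega> i r) 0 < e"
        using d(1) by (auto simp: eventually_at_right_field)
    qed
  qed
  moreover have "\<bar>F i x - F i 0\<bar> \<le> \<omega> i (norm x)" if "x \<in> ball 0 \<rho>" for i x
    using that by (intro upper) auto
  ultimately show ?thesis by blast
qed

text \<open>Mean value inequality on the closed ball through \<open>x\<close>. As \<open>B\<close>
  may depend on \<open>norm x\<close>, this is the device by which an estimate gains one power of
  \<open>norm x\<close> over the estimate of its derivative.\<close>

lemma derivative_bound_from_0:
  fixes f :: "'a::euclidean_space \<Rightarrow> 'b::euclidean_space"
  assumes "\<And>y. y \<in> cball 0 (norm x) \<Longrightarrow> (f has_derivative f' y) (at y)"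
    and "\<And>y v. y \<in> cball 0 (norm x) \<Longrightarrow> norm (f' y v) \<le> B * norm v"
  shows "norm (f x - f 0) \<le> B * norm x"
proof -
  have "norm (f x - f 0) \<le> B * norm (x - 0)"
  proof (rule differentiable_bound[of "cball 0 (norm x)" f f'])
    show "(f has_derivative f' y) (at y within cball 0 (norm x))" if "y \<in> cball 0 (norm x)" for y
      using assms(1)[OF that] has_derivative_at_withinI by blast
    show "onorm (f' y) \<le> B" if "y \<in> cball 0 (norm x)" for y
      using assms(2)[OF that] by (rule onorm_bound[rotated])
        (use assms(2)[OF that] in \<open>metis mult_nonneg_nonneg norm_ge_zero norm_Basis SOME_Basis mult.right_neutral order_trans\<close>)
  qed auto
  then show ?thesis by simp
qed

text \<open>Induction on the order: the derivative of the remainder is the remainder of the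
  derivative, and integrating it from 0 gains one factor \<open>norm x\<close>. The punctured symbol
  class records the decay of all derivatives at once.\<close>

lemma taylor_remainder:
  fixes F :: "'i \<Rightarrow> 'a::euclidean_space \<Rightarrow> real"
  assumes "\<rho> > 0" "unif_class k (ball 0 \<rho>) F"
  shows "\<exists>\<omega>. modulus \<rho> \<omega> \<and> sym_class k (ball 0 \<rho> - {0}) norm
    (\<lambda>i x. \<omega> i (norm x) * norm x ^ k) (\<lambda>i x. F i x - taylor_poly k (F i) x)"
  using assms(2)
proof (induction k arbitrary: F)
  case (0 F)
  obtain C where "C > 0" and C: "\<And>i x. x \<in> ball 0 \<rho> \<Longrightarrow> norm (F i x) \<le> C * \<bar>1\<bar>"
    using sym_class_bound[OF 0] by blast
  obtain \<omega> where \<omega>: "modulus \<rho> \<omega>" "\<forall>i. \<forall>x\<in>ball 0 \<rho>. \<bar>F i x - F i 0\<bar> \<le> \<omega> i (norm x)"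
    using modulus_of_continuity_at_0[OF assms(1) sym_class_continuous[OF 0], where C=C] C by fastforce
  have "sym_class 0 (ball 0 \<rho> - {0}) norm (\<lambda>i x. \<omega> i (norm x) * norm x ^ 0) (\<lambda>i x. F i x - taylor_poly 0 (F i) x)"
    using \<omega>(2)
    by (intro sym_class_0I[where C=1])
       (auto simp: taylor_poly_def intro!: continuous_intros continuous_on_subset[OF sym_class_continuous[OF 0]]
         intro: order_trans[OF _ abs_ge_self])
  with \<omega>(1) show ?case by blast
next
  case (Suc k F)
  have open_S: "open (ball (0::'a) \<rho>)" "(0::'a) \<in> ball 0 \<rho>" "open (ball (0::'a) \<rho> - {0})"
    using assms(1) by auto
  let ?d = "\<lambda>b i x. frechet_derivative (F i) (at x) b"
  have "\<forall>b. \<exists>\<omega>. modulus \<rho> \<omega> \<and> sym_class k (ball 0 \<rho> - {0}) norm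
    (\<lambda>i x. \<omega> i (norm x) * norm x ^ k) (\<lambda>i x. ?d b i x - taylor_poly k (?d b i) x)"
    using Suc.prems by (intro allI Suc.IH) simp
  from choice[OF this]
  obtain \<omega> where \<omega>: "\<And>b. modulus \<rho> (\<omega> b)"
    "\<And>b. sym_class k (ball 0 \<rho> - {0}) norm
      (\<lambda>i x. \<omega> b i (norm x) * norm x ^ k) (\<lambda>i x. ?d b i x - taylor_poly k (?d b i) x)"
    by blast
  \<comment> \<open>One modulus has to serve all directions; the sum dominates each summand because
    all of them are nonnegative.\<close>
  define \<Omega> where "\<Omega> = (\<lambda>i r. \<Sum>b\<in>(Basis::'a set). \<omega> b i r)"
  have \<Omega>: "modulus \<rho> \<Omega>"
    unfolding \<Omega>_def using \<omega>(1) by (intro modulus_sum) auto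
  have \<omega>_nonneg: "0 \<le> \<omega> b i r" if "0 \<le> r" "r < \<rho>" for b i r
    using \<omega>(1)[of b] that unfolding modulus_def by blast
  have \<omega>_le: "\<omega> b i r \<le> \<Omega> i r" if "b \<in> Basis" "0 \<le> r" "r < \<rho>" for b i r
    unfolding \<Omega>_def using that \<omega>_nonneg by (intro member_le_sum) auto
  have Ck: "Ck_on (Suc k) (F i) (ball 0 \<rho>)" for i
    using sym_class_imp_Ck_on[OF Suc.prems] .
  let ?R = "\<lambda>i x. F i x - taylor_poly (Suc k) (F i) x"
  have deriv: "(?R i has_derivative (\<lambda>v. ?d v i x - taylor_poly k (?d v i) x)) (at x)"
    if "x \<in> ball 0 \<rho>" for i x
    using that by (intro has_derivative_diff Ck_on_has_derivative[OF Ck] taylor_poly_has_derivative[OF open_S(1,2) Ck])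
  have expand: "?d v i x - taylor_poly k (?d v i) x = (\<Sum>b\<in>Basis. (v \<bullet> b) * (?d b i x - taylor_poly k (?d b i) x))"
    if "x \<in> ball 0 \<rho>" for v i x
    using linear_basis_expansion[OF has_derivative_linear[OF deriv[OF that]], where v=v] by simp
  have "\<exists>C>0. \<forall>i. \<forall>x\<in>ball 0 \<rho> - {0}. \<bar>?d b i x - taylor_poly k (?d b i) x\<bar> \<le> C * \<bar>\<omega> b i (norm x) * norm x ^ k\<bar>" for b
    by (rule sym_class_bound[OF \<omega>(2)[of b]], unfold real_norm_def, rule exI, rule conjI, assumption) blast
  then obtain C where C: "\<And>b. C b > 0"
    "\<And>b i x. x \<in> ball 0 \<rho> - {0} \<Longrightarrow> \<bar>?d b i x - taylor_poly k (?d b i) x\<bar> \<le> C b * \<bar>\<omega> b i (norm x) * norm x ^ k\<bar>"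
    by metis
  define D where "D = (\<Sum>b\<in>(Basis::'a set). C b)"
  \<comment> \<open>The induction hypothesis is silent at 0, but the mean value inequality also
    visits that point.\<close>
  have zero: "?d b i 0 - taylor_poly k (?d b i) 0 = 0" for b i
  proof -
    have "taylor_poly k f 0 = f 0" for f :: "'a \<Rightarrow> real"
      by (cases k) (simp_all add: taylor_poly_def sum.atMost_Suc_shift del: sum.atMost_Suc)
    then show ?thesis by simp
  qed
  have bd: "\<bar>?d v i y - taylor_poly k (?d v i) y\<bar> \<le> (D * (\<Omega> i r * r ^ k)) * norm v"
    if "norm y \<le> r" "r < \<rho>" for v i y r
  proof -
    have yin: "y \<in> ball 0 \<rho>" using that by simp
    have r: "0 \<le> r" using that norm_ge_zero order_trans by blast
    have term_bd: "\<bar>?d b i y - taylor_poly k (?d b i) y\<bar> \<le> C b * (\<Omega> i r * r ^ k)" if b: "b \<in> Basis" for b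
    proof (cases "y = 0")
      case True
      have "0 \<le> \<Omega> i r"
        using \<omega>_nonneg[OF r \<open>r < \<rho>\<close>, of b i] \<omega>_le[OF b r \<open>r < \<rho>\<close>, of i] by linarith
      then have "0 \<le> C b * (\<Omega> i r * r ^ k)"
        using C(1)[of b] r by (intro mult_nonneg_nonneg) auto
      then show ?thesis unfolding True zero by simp
    next
      case False
      \<comment> \<open>Here monotonicity of the modulus is needed: the bound must hold on the whole
        ball of radius \<open>r\<close>.\<close>
      have "\<omega> b i (norm y) \<le> \<omega> b i r"
        using \<omega>(1)[of b, unfolded modulus_def, THEN conjunct1, rule_format, OF norm_ge_zero \<open>norm y \<le> r\<close> \<open>r < \<rho>\<close>] .
      also have "\<dots> \<le> \<Omega> i r" by (rule \<omega>_le[OF b r \<open>r < \<rho>\<close>])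
      finally have "\<omega> b i (norm y) * norm y ^ k \<le> \<Omega> i r * r ^ k"
        using \<open>norm y \<le> r\<close> \<open>r < \<rho>\<close> r \<omega>_nonneg[of "norm y" b i]
        by (intro mult_mono power_mono) auto
      moreover have "\<bar>\<omega> b i (norm y) * norm y ^ k\<bar> = \<omega> b i (norm y) * norm y ^ k"
        using \<omega>_nonneg[of "norm y" b i] yin by simp
      ultimately show ?thesis
        using order_trans[OF C(2)[of y i b] mult_left_mono[OF _ less_imp_le[OF C(1)[of b]]]] yin False by simp
    qed
    have "\<bar>?d v i y - taylor_poly k (?d v i) y\<bar> \<le> (\<Sum>b\<in>Basis. \<bar>(v \<bullet> b) * (?d b i y - taylor_poly k (?d b i) y)\<bar>)"
      by (subst expand[OF yin]) (rule sum_abs)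
    also have "\<dots> \<le> (\<Sum>b\<in>Basis. norm v * (C b * (\<Omega> i r * r ^ k)))"
      unfolding abs_mult by (intro sum_mono mult_mono term_bd Basis_le_norm) auto
    also have "\<dots> = (D * (\<Omega> i r * r ^ k)) * norm v"
      by (simp add: D_def sum_distrib_left sum_distrib_right mult_ac)
    finally show ?thesis .
  qed
  have "sym_class (Suc k) (ball 0 \<rho> - {0}) norm (\<lambda>i x. \<Omega> i (norm x) * norm x ^ Suc k) ?R"
  proof (rule sym_class_SucI[OF open_S(3), where C=D])
    fix i and x :: 'a assume x: "x \<in> ball 0 \<rho> - {0}"
    have "norm (?R i x - ?R i 0) \<le> (D * (\<Omega> i (norm x) * norm x ^ k)) * norm x"
    proof (rule derivative_bound_from_0)
      fix y :: 'a assume y: "y \<in> cball 0 (norm x)"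
      then show "(?R i has_derivative (\<lambda>v. ?d v i y - taylor_poly k (?d v i) y)) (at y)"
        using x by (intro deriv) auto
      show "norm (?d v i y - taylor_poly k (?d v i) y) \<le> (D * (\<Omega> i (norm x) * norm x ^ k)) * norm v" for v
        using x y bd[of y "norm x"] by simp
    qed
    moreover have "?R i 0 = 0"
      by (simp add: taylor_poly_def sum.atMost_Suc_shift del: sum.atMost_Suc)
    moreover have "D \<ge> 0" "\<Omega> i (norm x) \<ge> 0"
      using less_imp_le[OF C(1)] \<omega>_nonneg x by (auto simp: D_def \<Omega>_def intro!: sum_nonneg)
    ultimately show "norm (?R i x) \<le> D * \<bar>\<Omega> i (norm x) * norm x ^ Suc k\<bar>"
      by (simp add: abs_mult mult_ac)
  next
    show "(?R i has_derivative (\<lambda>v. ?d v i x - taylor_poly k (?d v i) x)) (at x)"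
      if "x \<in> ball 0 \<rho> - {0}" for i x using deriv that by simp
  next
    fix v
    have "sym_class k (ball 0 \<rho> - {0}) norm (\<lambda>i x. \<Omega> i (norm x) * norm x ^ Suc k / norm x)
        (\<lambda>i x. (v \<bullet> b) * (?d b i x - taylor_poly k (?d b i) x))" if b: "b \<in> Basis" for b
    proof (intro sym_class_mult_const open_S(3) sym_class_weaken[OF \<omega>(2), where c=1])
      fix i x assume "x \<in> ball (0::'a) \<rho> - {0}"
      then show "\<bar>\<omega> b i (norm x) * norm x ^ k\<bar> \<le> 1 * \<bar>\<Omega> i (norm x) * norm x ^ Suc k / norm x\<bar>"
        using \<omega>_le[OF b, of "norm x" i] \<omega>_nonneg[of "norm x" b i]
        by (simp add: abs_mult mult_right_mono)
    qed
    then have "sym_class k (ball 0 \<rho> - {0}) norm (\<lambda>i x. \<Omega> i (norm x) * norm x ^ Suc k / norm x)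
        (\<lambda>i x. \<Sum>b\<in>Basis. (v \<bullet> b) * (?d b i x - taylor_poly k (?d b i) x))"
      by (intro sym_class_sum open_S(3))
    then show "sym_class k (ball 0 \<rho> - {0}) norm (\<lambda>i x. \<Omega> i (norm x) * norm x ^ Suc k / norm x)
        (\<lambda>i x. ?d v i x - taylor_poly k (?d v i) x)"
    proof (rule sym_class_cong[OF open_S(3)])
      show "(\<Sum>b\<in>Basis. (v \<bullet> b) * (?d b i x - taylor_poly k (?d b i) x)) = ?d v i x - taylor_poly k (?d v i) x"
        if "x \<in> ball 0 \<rho> - {0}" for i x
        by (rule expand[symmetric]) (use that in simp)
    qed
  qed
  with \<Omega> show ?case by blast
qed

text \<open>The j-th derivative is o(|x|^(m-j)). Hence for j < m it is differentiable at 0 with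
  derivative 0, and for j = m it extends continuously by 0. The last point requires that the modulus
  tends to 0; mere boundedness would lose one derivative.\<close>

lemma sym_class_removable:
  fixes F :: "'i \<Rightarrow> 'a::euclidean_space \<Rightarrow> 'b::euclidean_space"
  assumes "\<rho> > 0" "modulus \<rho> \<omega>" "\<And>i. F i 0 = 0"
    and "sym_class m (ball 0 \<rho> - {0}) norm (\<lambda>i x. \<omega> i (norm x) * norm x ^ m) F"
  shows "unif_class m (ball 0 \<rho>) F"
    and "m > 0 \<Longrightarrow> (F i has_derivative (\<lambda>_. 0)) (at 0)"
proof -
  obtain A where A: "\<And>i r. 0 \<le> r \<Longrightarrow> r < \<rho> \<Longrightarrow> 0 \<le> \<omega> i r \<and> \<omega> i r \<le> A"
    using assms(2) unfolding modulus_def by blast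
  have A0: "A \<ge> 0" using A[of 0] assms(1) by fastforce
  have lim0: "((\<lambda>x. \<omega> i (norm x)) \<longlongrightarrow> 0) (at (0::'a))" for i
  proof -
    have "filterlim norm (at_right 0) (at (0::'a))"
      unfolding filterlim_at by (auto intro!: tendsto_norm_zero tendsto_ident_at simp: eventually_at_filter)
    then show ?thesis
      using assms(2) filterlim_compose[of "\<omega> i" "nhds 0" "at_right 0" norm] unfolding modulus_def by blast
  qed
  have bound: "\<exists>C. \<forall>i. \<forall>x\<in>ball 0 \<rho>. norm (F i x) \<le> C * \<bar>1\<bar>"
    if F0: "\<And>i. F i 0 = 0" and F: "sym_class m (ball 0 \<rho> - {0}) norm (\<lambda>i x. \<omega> i (norm x) * norm x ^ m) F"
    for m and F :: "'i \<Rightarrow> 'a \<Rightarrow> 'b"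
  proof -
    obtain C where C: "C > 0" "\<And>i x. x \<in> ball 0 \<rho> - {0} \<Longrightarrow> norm (F i x) \<le> C * \<bar>\<omega> i (norm x) * norm x ^ m\<bar>"
      using sym_class_bound[OF F] by blast
    have "norm (F i x) \<le> (C * (A * \<rho> ^ m)) * \<bar>1\<bar>" if x: "x \<in> ball 0 \<rho>" for i x
    proof (cases "x = 0")
      case True
      then show ?thesis using F0 C(1) A0 assms(1) by simp
    next
      case False
      have "\<omega> i (norm x) * norm x ^ m \<le> A * \<rho> ^ m"
        using A[of "norm x" i] x by (intro mult_mono power_mono) auto
      then have "C * \<bar>\<omega> i (norm x) * norm x ^ m\<bar> \<le> C * (A * \<rho> ^ m)"
        using C(1) A[of "norm x" i] x by (intro mult_left_mono) auto
      then show ?thesis using C(2)[of x i] x False by auto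
    qed
    then show ?thesis by blast
  qed
  have deriv0: "(F i has_derivative (\<lambda>_. 0)) (at 0)"
    if F0: "\<And>i. F i 0 = 0" and F: "sym_class (Suc m) (ball 0 \<rho> - {0}) norm (\<lambda>i x. \<omega> i (norm x) * norm x ^ Suc m) F"
    for m i and F :: "'i \<Rightarrow> 'a \<Rightarrow> 'b"
  proof -
    obtain C where C: "C > 0" "\<And>i x. x \<in> ball 0 \<rho> - {0} \<Longrightarrow> norm (F i x) \<le> C * \<bar>\<omega> i (norm x) * norm x ^ Suc m\<bar>"
      using sym_class_bound[OF F] by blast
    have "((\<lambda>x. norm (F i x) / norm x) \<longlongrightarrow> 0) (at 0)"
    proof (rule Lim_null_comparison)
      show "\<forall>\<^sub>F x in at 0. norm (norm (F i x) / norm x) \<le> C * \<rho> ^ m * \<omega> i (norm x)"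
        unfolding eventually_at
      proof (intro exI[of _ \<rho>] conjI ballI impI assms(1))
        fix x :: 'a assume "x \<noteq> 0 \<and> dist x 0 < \<rho>"
        then have x: "x \<in> ball 0 \<rho> - {0}" by auto
        have w: "0 \<le> \<omega> i (norm x)" using A x by simp
        have "norm (F i x) / norm x \<le> C * \<bar>\<omega> i (norm x) * norm x ^ Suc m\<bar> / norm x"
          using C(2)[OF x] by (intro divide_right_mono) auto
        also have "\<dots> = C * \<omega> i (norm x) * norm x ^ m"
          using x w by (simp add: abs_mult)
        also have "\<dots> \<le> C * \<omega> i (norm x) * \<rho> ^ m"
          using C(1) w x by (intro mult_left_mono power_mono) auto
        finally show "norm (norm (F i x) / norm x) \<le> C * \<rho> ^ m * \<omega> i (norm x)" by (simp add: mult_ac)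
      qed
      show "((\<lambda>x. C * \<rho> ^ m * \<omega> i (norm x)) \<longlongrightarrow> 0) (at (0::'a))"
        using tendsto_mult_right_zero[OF lim0] .
    qed
    then show ?thesis
      unfolding has_derivative_iff_norm using F0 by simp
  qed
  show "m > 0 \<Longrightarrow> (F i has_derivative (\<lambda>_. 0)) (at 0)"
    using deriv0[of F "m - 1" i] assms(3,4) by simp
  have open_S: "open (ball (0::'a) \<rho>)" "open (ball (0::'a) \<rho> - {0})" by auto
  show "unif_class m (ball 0 \<rho>) F"
    using assms(3,4)
  proof (induction m arbitrary: F)
    case (0 F)
    obtain C where C: "\<And>i x. x \<in> ball 0 \<rho> \<Longrightarrow> norm (F i x) \<le> C * \<bar>1\<bar>"
      using bound[OF "0.prems"] by meson
    obtain D where D: "D > 0" "\<And>i x. x \<in> ball 0 \<rho> - {0} \<Longrightarrow> norm (F i x) \<le> D * \<bar>\<omega> i (norm x) * norm x ^ 0\<bar>"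
      using sym_class_bound[OF "0.prems"(2)] by blast
    have "isCont (F i) x" if x: "x \<in> ball 0 \<rho>" for i x
    proof (cases "x = 0")
      case True
      have "(F i \<longlongrightarrow> 0) (at 0)"
      proof (rule Lim_null_comparison)
        show "\<forall>\<^sub>F x in at 0. norm (F i x) \<le> D * \<omega> i (norm x)"
          unfolding eventually_at
        proof (intro exI[of _ \<rho>] conjI ballI impI assms(1))
          fix x :: 'a assume "x \<noteq> 0 \<and> dist x 0 < \<rho>"
          then show "norm (F i x) \<le> D * \<omega> i (norm x)"
            using D(2)[of x i] A[of "norm x" i] by auto
        qed
        show "((\<lambda>x. D * \<omega> i (norm x)) \<longlongrightarrow> 0) (at (0::'a))"
          using tendsto_mult_right_zero[OF lim0] .
      qed
      then show ?thesis using True "0.prems"(1) by (simp add: isCont_def)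
    next
      case False
      then show ?thesis
        using sym_class_continuous[OF "0.prems"(2), of i] x by (simp add: continuous_on_eq_continuous_at[OF open_S(2)])
    qed
    then show ?case
      using C by (intro sym_class_0I[where C=C]) (auto intro!: continuous_at_imp_continuous_on)
  next
    case (Suc m F)
    obtain C where C: "\<And>i x. x \<in> ball 0 \<rho> \<Longrightarrow> norm (F i x) \<le> C * \<bar>1\<bar>"
      using bound[OF Suc.prems] by meson
    show ?case
    proof (rule sym_class_SucI[OF open_S(1) C])
      show "(F i has_derivative frechet_derivative (F i) (at x)) (at x)" if "x \<in> ball 0 \<rho>" for i x
      proof (cases "x = 0")
        case True
        then show ?thesis using deriv0[OF Suc.prems, of i] frechet_derivative_at by metis
      next
        case False
        then show ?thesis using sym_class_derivative[OF Suc.prems(2)] that by simp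
      qed
    next
      fix v
      have "sym_class m (ball 0 \<rho> - {0}) norm (\<lambda>i x. \<omega> i (norm x) * norm x ^ m)
        (\<lambda>i x. frechet_derivative (F i) (at x) v)"
      proof (rule sym_class_weaken[where c=1])
        show "sym_class m (ball 0 \<rho> - {0}) norm (\<lambda>i x. \<omega> i (norm x) * norm x ^ Suc m / norm x)
          (\<lambda>i x. frechet_derivative (F i) (at x) v)"
          using Suc.prems(2) by simp
      qed auto
      moreover have "frechet_derivative (F i) (at 0) v = 0" for i
        using frechet_derivative_at[OF deriv0[OF Suc.prems, of i]] by metis
      ultimately show "sym_class m (ball 0 \<rho>) (\<lambda>_. 1) (\<lambda>i x. 1 / 1) (\<lambda>i x. frechet_derivative (F i) (at x) v)"
        unfolding div_by_1 by (intro Suc.IH)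
    qed
  qed
qed

subsection \<open>Inverses of near-identity maps\<close>

text \<open>Product rule at a zero of \<open>f\<close>, where \<open>g\<close> need only be
  continuous. It differentiates an inverse operator through the resolvent identity before that
  operator is known to be differentiable.\<close>

lemma has_derivative_scaleR_vanishing:
  fixes f :: "'a::real_normed_vector \<Rightarrow> real" and g :: "'a \<Rightarrow> 'b::real_normed_vector"
  assumes f: "(f has_derivative f') (at x)" and "f x = 0" and g: "isCont g x"
  shows "((\<lambda>y. f y *\<^sub>R g y) has_derivative (\<lambda>h. f' h *\<^sub>R g x)) (at x)"
  unfolding has_derivative_iff_norm
proof
  interpret f': bounded_linear f' using f by (rule has_derivative_bounded_linear)
  show "bounded_linear (\<lambda>h. f' h *\<^sub>R g x)" by (rule bounded_linear_scaleR_const[OF f'.bounded_linear_axioms])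
  obtain K where K: "K > 0" "\<And>h. norm (f' h) \<le> norm h * K" using f'.pos_bounded by blast
  show "((\<lambda>y. norm (f y *\<^sub>R g y - f x *\<^sub>R g x - f' (y - x) *\<^sub>R g x) / norm (y - x)) \<longlongrightarrow> 0) (at x)"
  proof (rule Lim_null_comparison)
    have bd: "norm (f y *\<^sub>R g y - f x *\<^sub>R g x - f' (y - x) *\<^sub>R g x) / norm (y - x)
        \<le> norm (f y - f x - f' (y - x)) / norm (y - x) * norm (g y) + K * norm (g y - g x)"
      if "y \<noteq> x" for y
    proof -
      have "f y *\<^sub>R g y - f x *\<^sub>R g x - f' (y - x) *\<^sub>R g x
          = (f y - f x - f' (y - x)) *\<^sub>R g y + f' (y - x) *\<^sub>R (g y - g x)"
        using \<open>f x = 0\<close> by (simp add: algebra_simps)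
      then have "norm (f y *\<^sub>R g y - f x *\<^sub>R g x - f' (y - x) *\<^sub>R g x)
          \<le> norm (f y - f x - f' (y - x)) * norm (g y) + norm (f' (y - x)) * norm (g y - g x)"
        using norm_triangle_ineq[of "(f y - f x - f' (y - x)) *\<^sub>R g y" "f' (y - x) *\<^sub>R (g y - g x)"] by simp
      also have "\<dots> \<le> norm (f y - f x - f' (y - x)) * norm (g y) + (norm (y - x) * K) * norm (g y - g x)"
        by (intro add_left_mono mult_right_mono K) auto
      finally show ?thesis using that by (simp add: field_simps)
    qed
    then show "\<forall>\<^sub>F y in at x. norm (norm (f y *\<^sub>R g y - f x *\<^sub>R g x - f' (y - x) *\<^sub>R g x) / norm (y - x))
        \<le> norm (f y - f x - f' (y - x)) / norm (y - x) * norm (g y) + K * norm (g y - g x)"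
      by (auto simp: eventually_at_filter)
    have "((\<lambda>y. norm (f y - f x - f' (y - x)) / norm (y - x)) \<longlongrightarrow> 0) (at x)"
      using f unfolding has_derivative_iff_norm by blast
    moreover have "(g \<longlongrightarrow> g x) (at x)" using g unfolding isCont_def .
    ultimately have "((\<lambda>y. norm (f y - f x - f' (y - x)) / norm (y - x) * norm (g y) + K * norm (g y - g x))
        \<longlongrightarrow> 0 * norm (g x) + K * norm (g x - g x)) (at x)"
      by (intro tendsto_intros)
    then show "((\<lambda>y. norm (f y - f x - f' (y - x)) / norm (y - x) * norm (g y) + K * norm (g y - g x))
        \<longlongrightarrow> 0) (at x)" by simp
  qed
qed

text \<open>The resolvent identity N' = N - N' (P' - P) N first gives continuity of N and then its
  derivative -N (dP) N. This is built from dP and two copies of N, so each order of smoothness of N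
  follows from the previous one.\<close>

lemma sym_class_inverse_operator:
  fixes P N :: "'i \<Rightarrow> 'a::euclidean_space \<Rightarrow> 'b::euclidean_space \<Rightarrow> 'b"
  assumes "open S" and lin: "\<And>i y. y \<in> S \<Longrightarrow> linear (P i y)"
    and near: "\<And>i y v. y \<in> S \<Longrightarrow> norm (P i y v - v) \<le> norm v / 2"
    and PN: "\<And>i y v. y \<in> S \<Longrightarrow> P i y (N i y v) = v"
    and "\<And>v. unif_class j S (\<lambda>i y. P i y v)"
  shows "unif_class j S (\<lambda>i y. N i y v)"
proof -
  have P_ge: "norm v \<le> 2 * norm (P i y v)" if "y \<in> S" for i y v
    using near[OF that, of i v] norm_triangle_ineq2[of v "P i y v"] norm_minus_commute[of v "P i y v"] by simp
  have N_le: "norm (N i y v) \<le> 2 * norm v" if "y \<in> S" for i y v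
    using P_ge[OF that, of "N i y v" i] PN[OF that] by simp
  have N_eq: "N i y v = w" if "y \<in> S" "P i y w = v" for i y v w
    using P_ge[OF that(1), of "N i y v - w" i] PN[OF that(1), of i v] that(2)
    by (simp add: linear_diff[OF lin[OF that(1)]])
  have linN: "linear (N i y)" if "y \<in> S" for i y
    by (rule linearI; rule N_eq[OF that])
       (simp_all add: linear_add[OF lin[OF that]] linear_cmul[OF lin[OF that]] PN[OF that])
  have resolvent: "N i y' v = N i y v - N i y' (P i y' (N i y v) - P i y (N i y v))"
    if "y \<in> S" "y' \<in> S" for i y y' v
    by (rule N_eq[OF that(2)])
       (simp add: linear_diff[OF lin[OF that(2)]] PN[OF that(1)] PN[OF that(2)])
  have cont: "isCont (\<lambda>y. N i y v) y"
    if P: "\<And>v. continuous_on S (\<lambda>y. P i y v)" and y: "y \<in> S" for i y v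
  proof -
    let ?w = "N i y v"
    have lim: "((\<lambda>y'. P i y' ?w) \<longlongrightarrow> P i y ?w) (at y)"
      using P[of ?w] y by (simp add: continuous_on_eq_continuous_at[OF assms(1)] isCont_def)
    have "((\<lambda>y'. N i y' v - N i y v) \<longlongrightarrow> 0) (at y)"
    proof (rule Lim_null_comparison)
      show "\<forall>\<^sub>F y' in at y. norm (N i y' v - N i y v) \<le> 2 * norm (P i y' ?w - P i y ?w)"
        unfolding eventually_at_topological
      proof (intro exI[of _ S] conjI ballI impI assms(1) y)
        fix y' assume y': "y' \<in> S"
        have "norm (N i y' v - N i y v) = norm (N i y' (P i y' ?w - P i y ?w))"
          by (subst resolvent[OF y y']) simp
        also have "\<dots> \<le> 2 * norm (P i y' ?w - P i y ?w)" by (rule N_le[OF y'])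
        finally show "norm (N i y' v - N i y v) \<le> 2 * norm (P i y' ?w - P i y ?w)" .
      qed
      have "((\<lambda>y'. 2 * norm (P i y' ?w - P i y ?w)) \<longlongrightarrow> 2 * norm (P i y ?w - P i y ?w)) (at y)"
        by (intro tendsto_intros lim)
      then show "((\<lambda>y'. 2 * norm (P i y' ?w - P i y ?w)) \<longlongrightarrow> 0) (at y)" by simp
    qed
    then show ?thesis unfolding isCont_def by (rule LIM_zero_cancel)
  qed
  show ?thesis
    using assms(5)
  proof (induction j arbitrary: v)
    case 0
    have "continuous_on S (\<lambda>y. P i y v)" for i v
      by (rule sym_class_continuous[OF 0])
    then show ?case
      using N_le cont by (intro sym_class_0I[where C="2 * norm v"] continuous_at_imp_continuous_on) auto
  next
    case (Suc j)
    let ?dP = "\<lambda>i y c d. frechet_derivative (\<lambda>y. P i y c) (at y) d"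
    have P: "continuous_on S (\<lambda>y. P i y v)" for i v
      by (rule sym_class_continuous[OF Suc.prems])
    have IH: "unif_class j S (\<lambda>i y. N i y v)" for v
      using Suc.IH sym_class_Suc_imp[OF Suc.prems] by blast
    show ?case
    proof (rule sym_class_SucI[where C="2 * norm v", OF assms(1)])
      show "norm (N i y v) \<le> 2 * norm v * \<bar>1\<bar>" if "y \<in> S" for i y using N_le[OF that] by simp
    next
      fix i y assume y: "y \<in> S"
      let ?w = "N i y v"
      have P_expand: "P i y' u = (\<Sum>c\<in>Basis. (u \<bullet> c) *\<^sub>R P i y' c)" if "y' \<in> S" for y' u
        by (rule linear_basis_expansion[OF lin[OF that]])
      \<comment> \<open>The resolvent identity in coordinates: the scalar coefficients are
        differentiable and vanish at \<open>y' = y\<close>, while the vectors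
        \<open>N i y' b\<close> are only known to be continuous. This is the situation of the
        product rule at a zero.\<close>
      have "N i y' v = ?w - (\<Sum>b\<in>Basis. ((\<Sum>c\<in>Basis. (?w \<bullet> c) * ((P i y' c - P i y c) \<bullet> b))) *\<^sub>R N i y' b)"
        if y': "y' \<in> S" for y'
      proof -
        have "P i y' ?w - P i y ?w = (\<Sum>c\<in>Basis. (?w \<bullet> c) *\<^sub>R (P i y' c - P i y c))"
          by (subst P_expand[OF y], subst P_expand[OF y']) (simp add: sum_subtractf scaleR_diff_right)
        then have "(P i y' ?w - P i y ?w) \<bullet> b = (\<Sum>c\<in>Basis. (?w \<bullet> c) * ((P i y' c - P i y c) \<bullet> b))" for b
          by (simp add: inner_sum_left)
        then show ?thesis
          by (subst resolvent[OF y y'], subst linear_basis_expansion[OF linN[OF y'], where v="P i y' ?w - P i y ?w"]) simp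
      qed
      moreover have "((\<lambda>y'. ?w - (\<Sum>b\<in>Basis. ((\<Sum>c\<in>Basis. (?w \<bullet> c) * ((P i y' c - P i y c) \<bullet> b))) *\<^sub>R N i y' b))
        has_derivative (\<lambda>d. 0 - (\<Sum>b\<in>Basis. ((\<Sum>c\<in>Basis. (?w \<bullet> c) * ((?dP i y c d - 0) \<bullet> b))) *\<^sub>R N i y b))) (at y)"
      proof (intro has_derivative_diff has_derivative_sum has_derivative_const has_derivative_scaleR_vanishing
          has_derivative_mult_right has_derivative_inner_left)
        show "((\<lambda>y. P i y c) has_derivative ?dP i y c) (at y)" for c
          using sym_class_derivative[OF Suc.prems y] .
        show "isCont (\<lambda>y. N i y b) y" for b by (rule cont[OF P y])
      qed simp_all
      ultimately have "((\<lambda>y. N i y v) has_derivative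
          (\<lambda>d. 0 - (\<Sum>b\<in>Basis. ((\<Sum>c\<in>Basis. (?w \<bullet> c) * ((?dP i y c d - 0) \<bullet> b))) *\<^sub>R N i y b))) (at y)"
        using has_derivative_transform_within_open[OF _ assms(1) y] by (metis (no_types, lifting))
      then show "((\<lambda>y. N i y v) has_derivative
          (\<lambda>d. (-1) *\<^sub>R (\<Sum>b\<in>Basis. ((\<Sum>c\<in>Basis. (N i y v \<bullet> c) * (?dP i y c d \<bullet> b))) *\<^sub>R N i y b))) (at y)"
        by simp
    next
      fix d
      have "unif_class j S (\<lambda>i y. (N i y v \<bullet> c) * (?dP i y c d \<bullet> b))"
        if "b \<in> Basis" "c \<in> Basis" for b c
      proof -
        have "unif_class j S (\<lambda>i y. ?dP i y c d)"
          using Suc.prems[of c] by simp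
        then have 1: "unif_class j S (\<lambda>i y. ?dP i y c d \<bullet> b)"
          by (rule sym_class_components[OF assms(1), THEN iffD1, rule_format]) (rule that)
        have 2: "unif_class j S (\<lambda>i y. N i y v \<bullet> c)"
          by (rule sym_class_components[OF assms(1), THEN iffD1, rule_format, OF IH]) (rule that)
        from sym_class_mult[OF assms(1) 2 1] show ?thesis by simp
      qed
      then have sum: "unif_class j S
          (\<lambda>i y. \<Sum>c\<in>Basis. (N i y v \<bullet> c) * (?dP i y c d \<bullet> b))" if "b \<in> Basis" for b
        using that by (intro sym_class_sum assms(1))
      have "unif_class j S
          (\<lambda>i y. ((\<Sum>c\<in>Basis. (N i y v \<bullet> c) * (?dP i y c d \<bullet> b))) *\<^sub>R N i y b)" if "b \<in> Basis" for b
        using sym_class_scaleR[OF assms(1) sum[OF that] IH[of b]] by simp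
      then show "sym_class j S (\<lambda>_. 1) (\<lambda>i x. 1 / 1)
          (\<lambda>i y. (-1) *\<^sub>R (\<Sum>b\<in>Basis. ((\<Sum>c\<in>Basis. (N i y v \<bullet> c) * (?dP i y c d \<bullet> b))) *\<^sub>R N i y b))"
        unfolding div_by_1 by (intro sym_class_scaleR_const sym_class_sum assms(1))
    qed
  qed
qed

text \<open>The difference of \<open>\<Xi> i\<close> and the identity is a contraction with constant
  1/2, so the inverse is 2-Lipschitz and the image covers the ball of half the radius. Smoothness is
  bootstrapped: if \<Phi> is of class j, so is the derivative of \<Xi> taken at
  \<open>\<Phi> i y\<close>, hence so is its inverse operator, which is the derivative of
  \<Phi>.\<close>

lemma near_identity_inverse:
  fixes \<Xi> :: "'i \<Rightarrow> 'a::euclidean_space \<Rightarrow> 'a"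
  assumes \<rho>: "\<rho> > 0" and \<Xi>: "unif_class (Suc m) (ball 0 \<rho>) \<Xi>" and \<Xi>0: "\<And>i. \<Xi> i 0 = 0"
    and near: "\<And>i x v. x \<in> ball 0 \<rho> \<Longrightarrow> norm (frechet_derivative (\<Xi> i) (at x) v - v) \<le> norm v / 2"
  shows "\<exists>\<Phi>. unif_class (Suc m) (ball 0 (\<rho>/2)) \<Phi> \<and>
    (\<forall>i. (\<forall>y\<in>ball 0 (\<rho>/2). \<Phi> i y \<in> ball 0 \<rho> \<and> \<Xi> i (\<Phi> i y) = y \<and>
        (\<forall>v. norm (frechet_derivative (\<Phi> i) (at y) v) \<le> 2 * norm v)) \<and>
      (\<forall>x\<in>ball 0 \<rho>. \<Xi> i x \<in> ball 0 (\<rho>/2) \<longrightarrow> \<Phi> i (\<Xi> i x) = x))"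
proof -
  let ?S = "ball (0::'a) \<rho>" and ?T = "ball (0::'a) (\<rho>/2)"
  note D\<Xi> = sym_class_derivative[OF \<Xi>]
  have pert: "norm ((\<Xi> i x - x) - (\<Xi> i y - y)) \<le> 1/2 * norm (x - y)" if "x \<in> ?S" "y \<in> ?S" for i x y
  proof (rule differentiable_bound[OF convex_ball _ _ that])
    show "((\<lambda>x. \<Xi> i x - x) has_derivative (\<lambda>v. frechet_derivative (\<Xi> i) (at x) v - v)) (at x within ?S)"
      if "x \<in> ?S" for x
      by (rule has_derivative_at_withinI[OF has_derivative_diff[OF D\<Xi>[OF that] has_derivative_ident]])
    show "onorm (\<lambda>v. frechet_derivative (\<Xi> i) (at x) v - v) \<le> 1/2" if "x \<in> ?S" for x
      using near[OF that, of i] by (intro onorm_bound) auto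
  qed
  have expand: "norm (x - y) \<le> 2 * norm (\<Xi> i x - \<Xi> i y)" if "x \<in> ?S" "y \<in> ?S" for i x y
    using pert[OF that, of i] norm_triangle_ineq2[of "x - y" "\<Xi> i x - \<Xi> i y"]
      norm_minus_commute[of "x - y" "\<Xi> i x - \<Xi> i y"] by (simp add: algebra_simps)
  have surj: "\<exists>x\<in>?S. \<Xi> i x = y" if y: "y \<in> ?T" for i y
  proof -
    \<comment> \<open>The map sending x to y - (\<Xi> x - x) has norm at most |y| + |x|/2, so it
      preserves this ball, which lies in the domain because |y| < \<rho>/2.\<close>
    let ?B = "cball (0::'a) (2 * norm y)"
    have B: "x \<in> ?S" if "x \<in> ?B" for x using that y by simp
    have "\<exists>!x\<in>?B. y - (\<Xi> i x - x) = x"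
    proof (rule Banach_fix[where c="1/2"])
      show "complete ?B" by (simp add: compact_imp_complete)
      show "?B \<noteq> {}" by (metis centre_in_cball empty_iff mult_nonneg_nonneg norm_ge_zero zero_le_numeral)
      show "(\<lambda>x. y - (\<Xi> i x - x)) ` ?B \<subseteq> ?B"
      proof
        fix z assume "z \<in> (\<lambda>x. y - (\<Xi> i x - x)) ` ?B"
        then obtain x where x: "x \<in> ?B" "z = y - (\<Xi> i x - x)" by blast
        have "norm (\<Xi> i x - x) \<le> 1/2 * norm x"
          using pert[OF B[OF x(1)], of 0 i] \<rho> \<Xi>0 by simp
        then show "z \<in> ?B" using x norm_triangle_ineq4[of y "\<Xi> i x - x"] by simp
      qed
      show "dist (y - (\<Xi> i x - x)) (y - (\<Xi> i x' - x')) \<le> 1/2 * dist x x'" if "x \<in> ?B" "x' \<in> ?B" for x x'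
        using pert[OF B[OF that(1)] B[OF that(2)], of i]
        by (simp add: dist_norm norm_minus_commute algebra_simps)
    qed auto
    then obtain x where "x \<in> ?B" "y - (\<Xi> i x - x) = x" by blast
    then show ?thesis using B by (intro bexI[of _ x]) (auto simp: algebra_simps)
  qed
  define \<Phi> where "\<Phi> i y = (SOME x. x \<in> ?S \<and> \<Xi> i x = y)" for i y
  have \<Phi>: "\<Phi> i y \<in> ?S" "\<Xi> i (\<Phi> i y) = y" if "y \<in> ?T" for i y
    unfolding \<Phi>_def using someI_ex[of "\<lambda>x. x \<in> ?S \<and> \<Xi> i x = y"] surj[OF that, of i] by blast+
  have left_inv: "\<Phi> i (\<Xi> i x) = x" if "x \<in> ?S" "\<Xi> i x \<in> ?T" for i x
    using expand[OF \<Phi>(1)[OF that(2)] that(1), of i i] \<Phi>(2)[OF that(2), of i] by simp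
  have cont: "continuous_on ?T (\<Phi> i)" for i
  proof (rule lipschitz_on_continuous_on)
    show "2-lipschitz_on ?T (\<Phi> i)"
    proof (rule lipschitz_onI)
      fix y z assume "y \<in> ?T" "z \<in> ?T"
      then show "dist (\<Phi> i y) (\<Phi> i z) \<le> 2 * dist y z"
        using expand[OF \<Phi>(1) \<Phi>(1), of y z i i i] \<Phi>(2) by (simp add: dist_norm)
    qed simp
  qed
  define P where "P i y v = frechet_derivative (\<Xi> i) (at (\<Phi> i y)) v" for i y v
  have linP: "linear (P i y)" if "y \<in> ?T" for i y
    unfolding P_def[abs_def] using has_derivative_linear[OF D\<Xi>[OF \<Phi>(1)[OF that]]] .
  have nearP: "norm (P i y v - v) \<le> norm v / 2" if "y \<in> ?T" for i y v
    unfolding P_def by (rule near[OF \<Phi>(1)[OF that]])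
  have P_ge: "norm v \<le> 2 * norm (P i y v)" if "y \<in> ?T" for i y v
    using nearP[OF that, of i v] norm_triangle_ineq2[of v "P i y v"] norm_minus_commute[of v "P i y v"] by simp
  have injP: "inj (P i y)" if "y \<in> ?T" for i y
    unfolding linear_injective_0[OF linP[OF that]] using P_ge[OF that, of _ i] by (metis mult_zero_right norm_le_zero_iff norm_zero)
  define N where "N i y = inv (P i y)" for i y
  have PN: "P i y (N i y v) = v" if "y \<in> ?T" for i y v
    unfolding N_def using linear_injective_imp_surjective[OF linP[OF that] injP[OF that]]
    by (simp add: surj_f_inv_f)
  have NP: "N i y (P i y v) = v" if "y \<in> ?T" for i y v
    unfolding N_def using injP[OF that] by simp
  have N_eq: "N i y v = w" if "y \<in> ?T" "P i y w = v" for i y v w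
    using NP[OF that(1), of i w] that(2) by simp
  have D\<Phi>: "(\<Phi> i has_derivative N i y) (at y)" if y: "y \<in> ?T" for i y
  proof (rule has_derivative_inverse_basic[where f="\<Xi> i" and g="\<Phi> i" and T="?T"])
    show "(\<Xi> i has_derivative frechet_derivative (\<Xi> i) (at (\<Phi> i y))) (at (\<Phi> i y))"
      by (rule D\<Xi>[OF \<Phi>(1)[OF y]])
    have "linear (N i y)"
      by (rule linearI; rule N_eq[OF y])
         (simp_all add: linear_add[OF linP[OF y]] linear_cmul[OF linP[OF y]] PN[OF y])
    then show "bounded_linear (N i y)" by (simp add: linear_conv_bounded_linear)
    show "N i y \<circ> frechet_derivative (\<Xi> i) (at (\<Phi> i y)) = id"
      using NP[OF y, of i] by (simp add: fun_eq_iff P_def)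
    show "continuous (at y) (\<Phi> i)" using cont[of i] y by (simp add: continuous_on_eq_continuous_at)
  qed (use y \<Phi>(2) in auto)
  have N_le: "norm (N i y v) \<le> 2 * norm v" if "y \<in> ?T" for i y v
    using P_ge[OF that, of "N i y v" i] PN[OF that] by simp
  have "unif_class j ?T \<Phi>" if "j \<le> Suc m" for j
    using that
  proof (induction j)
    case 0
    show ?case
      using \<Phi>(1) cont by (intro sym_class_0I[where C=\<rho>]) (auto intro: less_imp_le)
  next
    case (Suc j)
    have Pj: "unif_class j ?T (\<lambda>i y. P i y v)" for v
    proof -
      have "unif_class m ?S (\<lambda>i x. frechet_derivative (\<Xi> i) (at x) v)"
        using \<Xi> by simp
      then have D: "unif_class j ?S (\<lambda>i x. frechet_derivative (\<Xi> i) (at x) v)"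
        by (rule sym_class_antimono) (use Suc.prems in simp)
      show ?thesis
        unfolding P_def
      proof (rule sym_class_compose[OF open_ball D])
        show "unif_class j ?T \<Phi>" using Suc by simp
      qed (rule \<Phi>(1))
    qed
    have N: "unif_class j ?T (\<lambda>i y. N i y v)" for v
      by (rule sym_class_inverse_operator[OF open_ball linP nearP PN Pj])
    show ?case
    proof (rule sym_class_SucI[where C=\<rho>, OF open_ball _ D\<Phi>])
      show "norm (\<Phi> i y) \<le> \<rho> * \<bar>1\<bar>" if "y \<in> ?T" for i y using \<Phi>(1)[OF that, of i] by simp
      show "sym_class j ?T (\<lambda>_. 1) (\<lambda>i x. 1 / 1) (\<lambda>i y. N i y v)" for v using N by simp
    qed
  qed
  from this[OF order_refl] have "unif_class (Suc m) ?T \<Phi>" .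
  moreover have "norm (frechet_derivative (\<Phi> i) (at y) v) \<le> 2 * norm v" if "y \<in> ?T" for i y v
    using N_le[OF that, of i v] frechet_derivative_at[OF D\<Phi>[OF that, of i]] by metis
  ultimately show ?thesis using \<Phi> left_inv by (intro exI[of _ \<Phi>]) blast
qed

subsection \<open>Diagonalization of self-adjoint operators\<close>

lemma real_quadratic_nonneg_imp_linear_zero:
  fixes a c :: real
  assumes "\<And>t. 0 \<le> a * t + c * t\<^sup>2"
  shows "a = 0"
proof (rule ccontr)
  assume "a \<noteq> 0"
  \<comment> \<open>Chosen so that a + t |c| = -t, which turns the majorant a t + |c| t^2 into
    -t^2.\<close>
  define t where "t = - a / (\<bar>c\<bar> + 1)"
  have "\<bar>c\<bar> + 1 > 0" by simp
  then have t: "t * (\<bar>c\<bar> + 1) = - a" by (simp add: t_def)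
  have "t \<noteq> 0" using t \<open>a \<noteq> 0\<close> by auto
  have "a * t + c * t\<^sup>2 \<le> a * t + \<bar>c\<bar> * t\<^sup>2" by (intro add_left_mono mult_right_mono) auto
  also have "\<dots> = - (t\<^sup>2)"
  proof -
    have "a + t * \<bar>c\<bar> = - t" using t by (simp add: algebra_simps)
    then have "t * (a + t * \<bar>c\<bar>) = t * (- t)" by simp
    then show ?thesis by (simp add: power2_eq_square algebra_simps)
  qed
  also have "\<dots> < 0" using \<open>t \<noteq> 0\<close> by simp
  finally show False using assms[of t] by simp
qed

text \<open>A maximizer of the Rayleigh quotient on the unit sphere of \<open>S\<close> is an
  eigenvector. Instead of Lagrange multipliers, maximality is tested along a single line.\<close>

lemma self_adjoint_eigenvector:
  fixes T :: "'a::euclidean_space \<Rightarrow> 'a"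
  assumes T: "linear T" and adj: "\<And>x y. T x \<bullet> y = x \<bullet> T y"
    and S: "subspace S" "T ` S \<subseteq> S" "S \<noteq> {0}"
  shows "\<exists>v\<in>S. norm v = 1 \<and> (\<exists>\<mu>. T v = \<mu> *\<^sub>R v)"
proof -
  let ?C = "S \<inter> sphere 0 1"
  obtain s where s: "s \<in> S" "s \<noteq> 0" using S(1,3) subspace_0 by blast
  then have "(1 / norm s) *\<^sub>R s \<in> ?C" using S(1) by (simp add: subspace_scale)
  then have "?C \<noteq> {}" by blast
  moreover have "compact ?C" by (intro closed_Int_compact closed_subspace S compact_sphere)
  moreover have "continuous_on ?C (\<lambda>x. x \<bullet> T x)"
    by (intro continuous_intros linear_continuous_on T[unfolded linear_conv_bounded_linear])
  ultimately obtain v where v: "v \<in> ?C" "\<And>x. x \<in> ?C \<Longrightarrow> x \<bullet> T x \<le> v \<bullet> T v"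
    using continuous_attains_sup[of ?C "\<lambda>x. x \<bullet> T x"] by blast
  define \<mu> where "\<mu> = v \<bullet> T v"
  have vS: "v \<in> S" and nv: "v \<bullet> v = 1" using v(1) by (auto simp: dot_square_norm)
  have le: "x \<bullet> T x \<le> \<mu> * (x \<bullet> x)" if "x \<in> S" for x
  proof (cases "x = 0")
    case True
    then show ?thesis using linear_0[OF T] by simp
  next
    case False
    let ?y = "(1 / norm x) *\<^sub>R x"
    have "?y \<in> ?C" using that S(1) False by (simp add: subspace_scale)
    from v(2)[OF this] have "(x \<bullet> T x) / (norm x)\<^sup>2 \<le> \<mu>"
      by (simp add: linear_cmul[OF T] \<mu>_def power2_eq_square)
    then show ?thesis using False by (simp add: dot_square_norm field_simps)
  qed
  \<comment> \<open>Along v + t u, with u the residual of the eigenvalue equation, the slack in the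
    Rayleigh inequality is nonnegative and has linear coefficient 2 |u|^2, which therefore
    vanishes.\<close>
  define u where "u = \<mu> *\<^sub>R v - T v"
  have uS: "u \<in> S" unfolding u_def using S vS by (intro subspace_diff subspace_scale) auto
  have "0 \<le> (2 * (u \<bullet> u)) * t + (\<mu> * (u \<bullet> u) - u \<bullet> T u) * t\<^sup>2" for t
  proof -
    have "v + t *\<^sub>R u \<in> S" using S(1) vS uS by (intro subspace_add subspace_scale)
    from le[OF this] have "0 \<le> \<mu> * ((v + t *\<^sub>R u) \<bullet> (v + t *\<^sub>R u)) - (v + t *\<^sub>R u) \<bullet> T (v + t *\<^sub>R u)" by simp
    also have "\<dots> = 2 * t * (\<mu> * (v \<bullet> u) - u \<bullet> T v) + (\<mu> * (u \<bullet> u) - u \<bullet> T u) * t\<^sup>2 + (\<mu> * (v \<bullet> v) - v \<bullet> T v)"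
    proof -
      have "v \<bullet> T u = u \<bullet> T v" using adj[of v u] by (simp add: inner_commute)
      moreover have "u \<bullet> v = v \<bullet> u" by (rule inner_commute)
      ultimately show ?thesis
        by (simp add: linear_add[OF T] linear_cmul[OF T] inner_add_left inner_add_right power2_eq_square algebra_simps)
    qed
    also have "\<mu> * (v \<bullet> v) - v \<bullet> T v = 0" using nv by (simp add: \<mu>_def)
    also have "\<mu> * (v \<bullet> u) - u \<bullet> T v = u \<bullet> u"
      by (subst (4) u_def) (simp add: inner_diff_right inner_commute)
    finally show ?thesis by (simp add: mult_ac)
  qed
  then have "2 * (u \<bullet> u) = 0" by (rule real_quadratic_nonneg_imp_linear_zero)
  then have "T v = \<mu> *\<^sub>R v" by (simp add: u_def)
  then show ?thesis using v(1) by auto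
qed

text \<open>Split off one eigenvector and recurse on its orthogonal complement within
  \<open>S\<close>. Self-adjointness makes the complement invariant, and its dimension is
  smaller.\<close>

lemma self_adjoint_eigenbasis:
  fixes T :: "'a::euclidean_space \<Rightarrow> 'a"
  assumes T: "linear T" and adj: "\<And>x y. T x \<bullet> y = x \<bullet> T y"
    and "subspace S" "T ` S \<subseteq> S"
  shows "\<exists>B. B \<subseteq> S \<and> pairwise orthogonal B \<and> (\<forall>b\<in>B. norm b = 1 \<and> (\<exists>\<mu>. T b = \<mu> *\<^sub>R b)) \<and> S \<subseteq> span B"
  using assms(3,4)
proof (induction "dim S" arbitrary: S rule: less_induct)
  case less
  show ?case
  proof (cases "S = {0}")
    case True
    then show ?thesis by (intro exI[of _ "{}"]) auto
  next
    case False
    obtain v \<mu> where v: "v \<in> S" "norm v = 1" "T v = \<mu> *\<^sub>R v"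
      using self_adjoint_eigenvector[OF T adj less.prems False] by blast
    define S' where "S' = S \<inter> {x. v \<bullet> x = 0}"
    have S': "subspace S'"
      unfolding S'_def by (intro subspace_inter less.prems subspace_hyperplane)
    have inv: "T ` S' \<subseteq> S'"
    proof
      fix y assume "y \<in> T ` S'"
      then obtain x where x: "x \<in> S" "v \<bullet> x = 0" "y = T x" by (auto simp: S'_def)
      have "v \<bullet> T x = T v \<bullet> x" by (simp add: adj)
      then show "y \<in> S'" using x less.prems(2) by (auto simp: S'_def v(3))
    qed
    have "v \<notin> S'" using v(2) by (auto simp: S'_def dot_square_norm)
    moreover have "S' \<subseteq> S" by (auto simp: S'_def)
    ultimately have "S' \<subset> S" using v(1) by blast
    then have "dim S' < dim S"
      using S' less.prems(1) by (intro dim_psubset) (simp add: span_eq_iff[THEN iffD2])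
    from less.hyps[OF this S' inv] obtain B where
      B: "B \<subseteq> S'" "pairwise orthogonal B" "\<forall>b\<in>B. norm b = 1 \<and> (\<exists>\<mu>. T b = \<mu> *\<^sub>R b)" "S' \<subseteq> span B"
      by blast
    have "pairwise orthogonal (insert v B)"
      using B(1,2) by (auto simp: pairwise_insert orthogonal_def S'_def inner_commute)
    moreover have "S \<subseteq> span (insert v B)"
    proof
      fix x assume x: "x \<in> S"
      let ?y = "x - (v \<bullet> x) *\<^sub>R v"
      have "?y \<in> S" using less.prems(1) x v(1) by (intro subspace_diff subspace_scale)
      then have "?y \<in> S'" using v(2) by (simp add: S'_def inner_diff_right dot_square_norm)
      then have "?y \<in> span B" using B(4) by blast
      then have "?y \<in> span (insert v B)" by (meson span_mono subsetD subset_insertI)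
      moreover have "(v \<bullet> x) *\<^sub>R v \<in> span (insert v B)" by (simp add: span_base span_scale)
      ultimately have "?y + (v \<bullet> x) *\<^sub>R v \<in> span (insert v B)" by (rule span_add)
      then show "x \<in> span (insert v B)" by simp
    qed
    ultimately show ?thesis
      using B v by (intro exI[of _ "insert v B"]) (auto simp: S'_def)
  qed
qed

lemma self_adjoint_indexed_eigenbasis:
  fixes T :: "real^'n \<Rightarrow> real^'n"
  assumes "linear T" "\<And>x y. T x \<bullet> y = x \<bullet> T y"
  obtains \<beta> :: "'n \<Rightarrow> real^'n" and \<mu> :: "'n \<Rightarrow> real"
  where "\<And>i j. \<beta> i \<bullet> \<beta> j = (if i = j then 1 else 0)" "\<And>i. T (\<beta> i) = \<mu> i *\<^sub>R \<beta> i"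
proof -
  obtain B where B: "pairwise orthogonal B" "\<And>b. b \<in> B \<Longrightarrow> norm b = 1" "\<And>b. b \<in> B \<Longrightarrow> \<exists>\<mu>. T b = \<mu> *\<^sub>R b" "UNIV \<subseteq> span B"
    using self_adjoint_eigenbasis[OF assms, of UNIV] by auto
  have "0 \<notin> B" using B(2) by force
  then have ind: "independent B" using B(1) pairwise_orthogonal_independent by blast
  have "card B = dim (UNIV :: (real^'n) set)"
    using basis_card_eq_dim[OF subset_UNIV B(4) ind] .
  then have "card (UNIV :: 'n set) = card B" by simp
  moreover have "finite B" using ind by (rule independent_imp_finite)
  ultimately obtain \<beta> where \<beta>: "bij_betw \<beta> (UNIV :: 'n set) B"
    using finite_same_card_bij[of "UNIV :: 'n set" B] by auto
  have in_B: "\<beta> i \<in> B" for i using \<beta> by (auto simp: bij_betw_def)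
  have "\<beta> i \<bullet> \<beta> j = (if i = j then 1 else 0)" for i j
  proof (cases "i = j")
    case True
    then show ?thesis using B(2)[OF in_B[of j]] by (simp add: dot_square_norm)
  next
    case False
    then have "\<beta> i \<noteq> \<beta> j" using \<beta> by (auto simp: bij_betw_def inj_eq)
    then show ?thesis using False B(1) in_B by (auto simp: pairwise_def orthogonal_def)
  qed
  moreover obtain \<mu> where "\<And>i. T (\<beta> i) = \<mu> i *\<^sub>R \<beta> i"
    using B(3)[OF in_B] by metis
  ultimately show thesis by (rule that)
qed

text \<open>Scaling the i-th eigenvector by sqrt (2 / |\<mu> i|) leaves only the sign of its
  eigenvalue. The factor 2 is that of the Hessian of the sum of
  \<open>\<epsilon> i * (y $ i)^2\<close>, and s \<le> |\<mu> i| bounds the scaling.\<close>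

lemma signature_coordinates:
  fixes T :: "real^'n \<Rightarrow> real^'n"
  assumes "linear T" "\<And>x y. T x \<bullet> y = x \<bullet> T y" "s > 0" "\<And>x. s * norm x \<le> norm (T x)"
  shows "\<exists>(A :: real^'n \<Rightarrow> real^'n) \<epsilon>. linear A \<and> bij A \<and> (\<forall>y. norm (A y) \<le> sqrt (2 / s) * norm y) \<and>
    (\<forall>i. \<epsilon> i = 1 \<or> \<epsilon> i = -1) \<and> (\<forall>y z. A y \<bullet> T (A z) = 2 * (\<Sum>i\<in>UNIV. \<epsilon> i * (y $ i * z $ i)))"
proof -
  obtain \<beta> :: "'n \<Rightarrow> real^'n" and \<mu> where
    \<beta>: "\<And>i j. \<beta> i \<bullet> \<beta> j = (if i = j then 1 else 0)" and \<mu>: "\<And>i. T (\<beta> i) = \<mu> i *\<^sub>R \<beta> i"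
    using self_adjoint_indexed_eigenbasis[OF assms(1,2)] by blast
  have s_le: "s \<le> \<bar>\<mu> i\<bar>" for i
  proof -
    have "norm (\<beta> i) = 1" using \<beta>[of i i] by (simp add: norm_eq_1)
    then show ?thesis using assms(4)[of "\<beta> i"] by (simp add: \<mu>)
  qed
  define a where "a i = sqrt (2 / \<bar>\<mu> i\<bar>)" for i
  have a2: "a i * a i * \<mu> i = 2 * sgn (\<mu> i)" for i
  proof -
    have "a i * a i = 2 / \<bar>\<mu> i\<bar>" unfolding a_def by simp
    then show ?thesis using s_le[of i] assms(3) by (simp add: sgn_if)
  qed
  define A where "A y = (\<Sum>i\<in>UNIV. (y $ i * a i) *\<^sub>R \<beta> i)" for y :: "real^'n"
  have lin: "linear A"
    by (rule linearI) (simp_all add: A_def sum.distrib scaleR_sum_right algebra_simps)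
  have inner: "(\<Sum>i\<in>UNIV. c i *\<^sub>R \<beta> i) \<bullet> (\<Sum>i\<in>UNIV. d i *\<^sub>R \<beta> i) = (\<Sum>i\<in>UNIV. c i * d i)" for c d
    by (simp add: inner_sum_left inner_sum_right \<beta> if_distrib[of "\<lambda>x. _ * x"] mult.commute cong: if_cong)
  have TA: "T (A z) = (\<Sum>i\<in>UNIV. (z $ i * a i * \<mu> i) *\<^sub>R \<beta> i)" for z
    unfolding A_def by (simp add: linear_sum[OF assms(1)] linear_cmul[OF assms(1)] \<mu>)
  have form: "A y \<bullet> T (A z) = 2 * (\<Sum>i\<in>UNIV. sgn (\<mu> i) * (y $ i * z $ i))" for y z
  proof -
    have "A y \<bullet> T (A z) = (\<Sum>i\<in>UNIV. (a i * a i * \<mu> i) * (y $ i * z $ i))"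
      unfolding TA unfolding A_def inner by (simp add: mult_ac)
    then show ?thesis unfolding a2 by (simp add: sum_distrib_left mult.assoc)
  qed
  have norm: "norm (A y) \<le> sqrt (2 / s) * norm y" for y
  proof -
    have "(norm (A y))\<^sup>2 = (\<Sum>i\<in>UNIV. (a i * a i) * (y $ i * y $ i))"
      unfolding dot_square_norm[symmetric] A_def inner by (simp add: mult_ac)
    also have "\<dots> \<le> (\<Sum>i\<in>UNIV. (2 / s) * (y $ i * y $ i))"
    proof (intro sum_mono mult_right_mono)
      show "a i * a i \<le> 2 / s" for i
        using s_le[of i] assms(3) by (simp add: a_def frac_le)
    qed simp
    also have "\<dots> = (sqrt (2 / s) * norm y)\<^sup>2"
      using assms(3) by (simp add: power_mult_distrib dot_square_norm[symmetric] inner_vec_def sum_distrib_left)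
    finally show ?thesis
      using assms(3) by (intro power2_le_imp_le[of "norm (A y)"]) auto
  qed
  have sgn: "sgn (\<mu> i) = 1 \<or> sgn (\<mu> i) = -1" for i
    using s_le[of i] assms(3) by (auto simp: sgn_if)
  have "inj A"
    unfolding linear_injective_0[OF lin]
  proof (intro allI impI)
    fix y assume "A y = 0"
    then have "(\<Sum>i\<in>UNIV. sgn (\<mu> i) * (y $ i * z $ i)) = 0" for z
      using form[of y z] by simp
    \<comment> \<open>Tested against the sign-flipped vector, the form gives |y|^2, so the kernel of
      \<open>A\<close> is trivial.\<close>
    from this[of "\<chi> i. sgn (\<mu> i) * y $ i"] have "(\<Sum>i\<in>UNIV. (sgn (\<mu> i) * sgn (\<mu> i)) * (y $ i * y $ i)) = 0"
      by (simp add: mult_ac)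
    moreover have "sgn (\<mu> i) * sgn (\<mu> i) = 1" for i using sgn[of i] by auto
    ultimately have "y \<bullet> y = 0" by (simp add: inner_vec_def)
    then show "y = 0" by simp
  qed
  then have "bij A" using lin linear_injective_imp_surjective by (auto simp: bij_def)
  then show ?thesis
    using lin norm sgn form by (intro exI[of _ A] exI[of _ "\<lambda>i. sgn (\<mu> i)"]) auto
qed

subsection \<open>Iterated directional derivatives\<close>

lemma multi_deriv_cong:
  assumes "open U" "\<And>x. x \<in> U \<Longrightarrow> f x = g x" "x \<in> U"
  shows "multi_deriv f vs x = multi_deriv g vs x"
  using assms(2)
proof (induction vs arbitrary: f g)
  case Nil
  then show ?case using assms(3) by simp
next
  case (Cons v vs)
  have "multi_deriv (\<lambda>x. frechet_derivative f (at x) v) vs x = multi_deriv (\<lambda>x. frechet_derivative g (at x) v) vs x"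
  proof (rule Cons.IH)
    show "frechet_derivative f (at y) v = frechet_derivative g (at y) v" if "y \<in> U" for y
      using frechet_derivative_cong_open[OF assms(1) that Cons.prems] by simp
  qed
  then show ?case by simp
qed

lemma multi_deriv_sum:
  assumes "open U" "x \<in> U" "finite B" "\<And>b. b \<in> B \<Longrightarrow> Ck_on (length vs) (F b) U"
  shows "multi_deriv (\<lambda>x. \<Sum>b\<in>B. c b *\<^sub>R F b x) vs x = (\<Sum>b\<in>B. c b *\<^sub>R multi_deriv (F b) vs x)"
  using assms(4)
proof (induction vs arbitrary: F)
  case Nil
  then show ?case by simp
next
  case (Cons v vs)
  have "multi_deriv (\<lambda>y. frechet_derivative (\<lambda>x. \<Sum>b\<in>B. c b *\<^sub>R F b x) (at y) v) vs x
      = multi_deriv (\<lambda>y. \<Sum>b\<in>B. c b *\<^sub>R frechet_derivative (F b) (at y) v) vs x"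
  proof (rule multi_deriv_cong[OF assms(1) _ assms(2)])
    fix y assume y: "y \<in> U"
    have "((\<lambda>x. \<Sum>b\<in>B. c b *\<^sub>R F b x) has_derivative (\<lambda>v. \<Sum>b\<in>B. c b *\<^sub>R frechet_derivative (F b) (at y) v)) (at y)"
      using Cons.prems y by (intro has_derivative_sum has_derivative_scaleR_right Ck_on_has_derivative) auto
    from fun_cong[OF frechet_derivative_at[OF this], of v]
    show "frechet_derivative (\<lambda>x. \<Sum>b\<in>B. c b *\<^sub>R F b x) (at y) v = (\<Sum>b\<in>B. c b *\<^sub>R frechet_derivative (F b) (at y) v)"
      by (rule sym)
  qed
  also have "\<dots> = (\<Sum>b\<in>B. c b *\<^sub>R multi_deriv (\<lambda>y. frechet_derivative (F b) (at y) v) vs x)"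
    using Cons.prems by (intro Cons.IH) auto
  finally show ?case by simp
qed

lemma multi_deriv_scaleR:
  assumes "open U" "x \<in> U" "Ck_on (length vs) F U"
  shows "multi_deriv (\<lambda>x. c *\<^sub>R F x) vs x = c *\<^sub>R multi_deriv F vs x"
  using multi_deriv_sum[OF assms(1,2), of "{()}" vs "\<lambda>_. F" "\<lambda>_. c"] assms(3) by simp

lemma multi_deriv_linear_image:
  fixes A :: "'b::euclidean_space \<Rightarrow> 'c::euclidean_space" and F :: "'a::euclidean_space \<Rightarrow> 'b"
  assumes "open U" "x \<in> U" "linear A" "Ck_on (length vs) F U"
  shows "multi_deriv (\<lambda>x. A (F x)) vs x = A (multi_deriv F vs x)"
  using assms(4)
proof (induction vs arbitrary: F)
  case Nil
  then show ?case by simp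
next
  case (Cons v vs)
  have "multi_deriv (\<lambda>y. frechet_derivative (\<lambda>x. A (F x)) (at y) v) vs x
      = multi_deriv (\<lambda>y. A (frechet_derivative F (at y) v)) vs x"
  proof (rule multi_deriv_cong[OF assms(1) _ assms(2)])
    fix y assume y: "y \<in> U"
    have "((\<lambda>x. A (F x)) has_derivative (\<lambda>v. A (frechet_derivative F (at y) v))) (at y)"
      using Cons.prems y assms(3)
      by (intro bounded_linear.has_derivative[of A] Ck_on_has_derivative) (auto simp: linear_conv_bounded_linear)
    from fun_cong[OF frechet_derivative_at[OF this], of v]
    show "frechet_derivative (\<lambda>x. A (F x)) (at y) v = A (frechet_derivative F (at y) v)" by (rule sym)
  qed
  also have "\<dots> = A (multi_deriv (\<lambda>y. frechet_derivative F (at y) v) vs x)"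
    using Cons.prems by (intro Cons.IH) auto
  finally show ?case by simp
qed

lemma Ck_on_linear_image:
  fixes A :: "'b::euclidean_space \<Rightarrow> 'c::euclidean_space" and F :: "'a::euclidean_space \<Rightarrow> 'b"
  assumes "open U" "linear A" "Ck_on k F U"
  shows "Ck_on k (\<lambda>x. A (F x)) U"
  using assms(3)
proof (induction k arbitrary: F)
  case 0
  then show ?case
    using continuous_on_compose2[OF linear_continuous_on[OF assms(2)[unfolded linear_conv_bounded_linear], of UNIV], of U F]
    by simp
next
  case (Suc k)
  have deriv: "((\<lambda>x. A (F x)) has_derivative (\<lambda>v. A (frechet_derivative F (at y) v))) (at y)" if "y \<in> U" for y
    by (rule bounded_linear.has_derivative[OF assms(2)[unfolded linear_conv_bounded_linear] Ck_on_has_derivative[OF Suc.prems that]])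
  have "Ck_on k (\<lambda>y. frechet_derivative (\<lambda>x. A (F x)) (at y) v) U" for v
  proof (rule Ck_on_cong[OF assms(1)])
    show "Ck_on k (\<lambda>y. A (frechet_derivative F (at y) v)) U"
      using Suc.prems by (intro Suc.IH) simp
    show "A (frechet_derivative F (at y) v) = frechet_derivative (\<lambda>x. A (F x)) (at y) v" if "y \<in> U" for y
      by (rule fun_cong[OF frechet_derivative_at[OF deriv[OF that]]])
  qed
  moreover have "(\<lambda>x. A (F x)) differentiable (at y)" if "y \<in> U" for y
    using deriv[OF that] unfolding differentiable_def by blast
  ultimately show ?case by simp
qed

lemma affine_composition_derivative:
  fixes A :: "'a::euclidean_space \<Rightarrow> 'b::euclidean_space"
  assumes "linear A" "(f has_derivative f') (at (c + A y))"
  shows "((\<lambda>y. f (c + A y)) has_derivative (\<lambda>v. f' (A v))) (at y)"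
proof -
  have "((\<lambda>y. c + A y) has_derivative (\<lambda>v. 0 + A v)) (at y)"
    by (intro has_derivative_add has_derivative_const bounded_linear_imp_has_derivative
        assms(1)[unfolded linear_conv_bounded_linear])
  then have "((\<lambda>y. c + A y) has_derivative A) (at y)" by simp
  from has_derivative_compose[OF this assms(2)] show ?thesis .
qed

lemma Ck_on_affine_composition:
  fixes A :: "'a::euclidean_space \<Rightarrow> 'b::euclidean_space"
  assumes "open V" "linear A" "\<And>y. y \<in> V \<Longrightarrow> c + A y \<in> U" "Ck_on k f U"
  shows "Ck_on k (\<lambda>y. f (c + A y)) V"
  using assms(4)
proof (induction k arbitrary: f)
  case 0
  have "continuous_on V (\<lambda>y. c + A y)"
    by (intro continuous_intros linear_continuous_on assms(2)[unfolded linear_conv_bounded_linear])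
  with 0 show ?case using assms(3) by (auto intro: continuous_on_compose2[of U f])
next
  case (Suc k)
  note deriv = affine_composition_derivative[OF assms(2) Ck_on_has_derivative[OF Suc.prems assms(3)]]
  have "Ck_on k (\<lambda>y. frechet_derivative (\<lambda>y. f (c + A y)) (at y) v) V" for v
  proof (rule Ck_on_cong[OF assms(1)])
    show "Ck_on k (\<lambda>y. frechet_derivative f (at (c + A y)) (A v)) V"
      using Suc.prems by (intro Suc.IH[of "\<lambda>x. frechet_derivative f (at x) (A v)"]) simp
    show "frechet_derivative f (at (c + A y)) (A v) = frechet_derivative (\<lambda>y. f (c + A y)) (at y) v" if "y \<in> V" for y
      by (rule fun_cong[OF frechet_derivative_at[OF deriv[OF that]]])
  qed
  moreover have "(\<lambda>y. f (c + A y)) differentiable (at y)" if "y \<in> V" for y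
    using deriv[OF that] unfolding differentiable_def by blast
  ultimately show ?case by simp
qed

lemma multi_deriv_affine_composition:
  fixes A :: "'a::euclidean_space \<Rightarrow> 'b::euclidean_space"
  assumes "open V" "linear A" "\<And>y. y \<in> V \<Longrightarrow> c + A y \<in> U" "y \<in> V" "Ck_on (length vs) f U"
  shows "multi_deriv (\<lambda>y. f (c + A y)) vs y = multi_deriv f (map A vs) (c + A y)"
  using assms(5)
proof (induction vs arbitrary: f)
  case Nil
  then show ?case by simp
next
  case (Cons v vs)
  have C: "Ck_on (Suc (length vs)) f U" using Cons.prems by (simp only: list.size add_0_right add_Suc_right)
  note deriv = affine_composition_derivative[OF assms(2) Ck_on_has_derivative[OF C assms(3)]]
  have "multi_deriv (\<lambda>y. frechet_derivative (\<lambda>y. f (c + A y)) (at y) v) vs y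
      = multi_deriv (\<lambda>y. frechet_derivative f (at (c + A y)) (A v)) vs y"
    by (rule multi_deriv_cong[OF assms(1) _ assms(4)])
       (rule fun_cong[OF frechet_derivative_at[OF deriv], symmetric])
  also have "\<dots> = multi_deriv (\<lambda>x. frechet_derivative f (at x) (A v)) (map A vs) (c + A y)"
    using Cons.prems by (intro Cons.IH) auto
  finally show ?case by simp
qed

lemma frechet_derivative_add_const:
  "frechet_derivative (\<lambda>x. c + f x) (at x) = frechet_derivative f (at x)"
proof -
  have "((\<lambda>x. c + f x) has_derivative f') (at x) \<longleftrightarrow> (f has_derivative f') (at x)" for f'
  proof
    assume "((\<lambda>x. c + f x) has_derivative f') (at x)"
    from has_derivative_add[OF this has_derivative_const[of "- c"]] show "(f has_derivative f') (at x)" by simp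
  next
    assume "(f has_derivative f') (at x)"
    from has_derivative_add[OF has_derivative_const[of c] this] show "((\<lambda>x. c + f x) has_derivative f') (at x)" by simp
  qed
  then show ?thesis by (simp add: frechet_derivative_def)
qed

lemma multi_deriv_add_const: "vs \<noteq> [] \<Longrightarrow> multi_deriv (\<lambda>x. c + f x) vs = multi_deriv f vs"
  by (cases vs) (simp_all add: frechet_derivative_add_const)

lemma Ck_on_add_const: "Ck_on k f U \<Longrightarrow> Ck_on k (\<lambda>x. c + f x) U"
  by (cases k) (auto simp: frechet_derivative_add_const intro!: continuous_intros)

text \<open>\<open>multi_deriv_norm\<close> only looks at unit vectors; multilinearity carries its
  bound over to arbitrary vectors.\<close>

lemma multi_deriv_homogeneous:
  fixes f :: "'a::euclidean_space \<Rightarrow> 'b::euclidean_space"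
  assumes "open U" "x \<in> U" "Ck_on (length vs) f U"
  shows "\<exists>us. length us = length vs \<and> (\<forall>u\<in>set us. norm u = 1) \<and>
    multi_deriv f vs x = prod_list (map norm vs) *\<^sub>R multi_deriv f us x"
  using assms(3)
proof (induction vs arbitrary: f)
  case Nil
  then show ?case by simp
next
  case (Cons v vs)
  obtain u where u: "norm u = 1" "v = norm v *\<^sub>R u"
  proof (cases "v = 0")
    case True
    \<comment> \<open>The zero vector is 0 times any unit vector.\<close>
    then show thesis using that[of "SOME i. i \<in> Basis"] by (simp add: norm_Basis SOME_Basis)
  next
    case False
    then show thesis using that[of "(1 / norm v) *\<^sub>R v"] by simp
  qed
  have C: "Ck_on (Suc (length vs)) f U" using Cons.prems by (simp only: list.size add_0_right add_Suc_right)
  have Cu: "Ck_on (length vs) (\<lambda>y. frechet_derivative f (at y) u) U" using C by simp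
  obtain us where us: "length us = length vs" "\<forall>u\<in>set us. norm u = 1"
    "multi_deriv (\<lambda>y. frechet_derivative f (at y) u) vs x
      = prod_list (map norm vs) *\<^sub>R multi_deriv (\<lambda>y. frechet_derivative f (at y) u) us x"
    using Cons.IH[OF Cu] by blast
  have "multi_deriv (\<lambda>y. frechet_derivative f (at y) v) vs x
      = multi_deriv (\<lambda>y. norm v *\<^sub>R frechet_derivative f (at y) u) vs x"
  proof (rule multi_deriv_cong[OF assms(1) _ assms(2)])
    fix y assume "y \<in> U"
    from linear_cmul[OF has_derivative_linear[OF Ck_on_has_derivative[OF C this]], of "norm v" u]
    show "frechet_derivative f (at y) v = norm v *\<^sub>R frechet_derivative f (at y) u" using u(2) by simp
  qed
  also have "\<dots> = norm v *\<^sub>R multi_deriv (\<lambda>y. frechet_derivative f (at y) u) vs x"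
    by (rule multi_deriv_scaleR[OF assms(1,2) Cu])
  finally have "multi_deriv f (v # vs) x = prod_list (map norm (v # vs)) *\<^sub>R multi_deriv f (u # us) x"
    by (simp add: us(3))
  then show ?case using us(1,2) u(1) by (intro exI[of _ "u # us"]) simp
qed

text \<open>Expanding one slot after the other over the finite set \<open>Basis\<close> turns bounds
  that depend on the list into one bound for all lists of unit vectors. The set \<open>X\<close> of
  pairs covers a single point as well as a whole family.\<close>

lemma multi_deriv_bound_from_Basis:
  fixes f :: "'i \<Rightarrow> 'a::euclidean_space \<Rightarrow> 'b::euclidean_space"
  assumes "open U" "\<And>i x. (i, x) \<in> X \<Longrightarrow> x \<in> U" "\<And>i. Ck_on p (f i) U"
    and "\<And>bs. length bs = p \<Longrightarrow> \<exists>C. \<forall>(i, x)\<in>X. norm (multi_deriv (f i) bs x) \<le> C"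
  shows "\<exists>C. \<forall>(i, x)\<in>X. \<forall>vs. length vs = p \<and> (\<forall>v\<in>set vs. norm v = 1) \<longrightarrow> norm (multi_deriv (f i) vs x) \<le> C"
  using assms(3,4)
proof (induction p arbitrary: f)
  case 0
  then show ?case by fastforce
next
  case (Suc p)
  let ?d = "\<lambda>b i x. frechet_derivative (f i) (at x) b"
  have "\<forall>b. \<exists>C. \<forall>(i, x)\<in>X. \<forall>vs. length vs = p \<and> (\<forall>v\<in>set vs. norm v = 1) \<longrightarrow> norm (multi_deriv (?d b i) vs x) \<le> C"
  proof (intro allI Suc.IH)
    show "Ck_on p (?d b i) U" for b i using Suc.prems(1)[of i] by simp
    show "\<exists>C. \<forall>(i, x)\<in>X. norm (multi_deriv (?d b i) bs x) \<le> C" if "length bs = p" for b bs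
      using Suc.prems(2)[of "b # bs"] that by simp
  qed
  from choice[OF this] obtain C where C: "\<And>b i x vs. (i, x) \<in> X \<Longrightarrow> length vs = p \<Longrightarrow> (\<forall>v\<in>set vs. norm v = 1)
      \<Longrightarrow> norm (multi_deriv (?d b i) vs x) \<le> C b" by fast
  have "norm (multi_deriv (f i) vs x) \<le> (\<Sum>b\<in>Basis. C b)"
    if X: "(i, x) \<in> X" and vs: "length vs = Suc p" "\<forall>v\<in>set vs. norm v = 1" for i x vs
  proof -
    obtain v ws where ws: "vs = v # ws" "length ws = p" "norm v = 1" "\<forall>v\<in>set ws. norm v = 1"
      using vs by (cases vs) auto
    have "multi_deriv (f i) vs x = multi_deriv (\<lambda>y. \<Sum>b\<in>Basis. (v \<bullet> b) *\<^sub>R ?d b i y) ws x"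
      unfolding ws(1) multi_deriv.simps
    proof (rule multi_deriv_cong[OF assms(1) _ assms(2)[OF X]])
      show "?d v i y = (\<Sum>b\<in>Basis. (v \<bullet> b) *\<^sub>R ?d b i y)" if "y \<in> U" for y
        by (rule linear_basis_expansion[OF has_derivative_linear[OF Ck_on_has_derivative[OF Suc.prems(1) that]]])
    qed
    also have "\<dots> = (\<Sum>b\<in>Basis. (v \<bullet> b) *\<^sub>R multi_deriv (?d b i) ws x)"
      using Suc.prems(1) ws(2) by (intro multi_deriv_sum[OF assms(1) assms(2)[OF X]]) auto
    also have "norm \<dots> \<le> (\<Sum>b\<in>Basis. C b)"
    proof (rule sum_norm_le)
      fix b :: 'a assume b: "b \<in> Basis"
      have "\<bar>v \<bullet> b\<bar> * norm (multi_deriv (?d b i) ws x) \<le> 1 * C b"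
        using Basis_le_norm[OF b, of v] ws(3) C[OF X ws(2,4), of b] by (intro mult_mono) auto
      then show "norm ((v \<bullet> b) *\<^sub>R multi_deriv (?d b i) ws x) \<le> C b" by simp
    qed
    finally show ?thesis .
  qed
  then show ?case by (intro exI[of _ "\<Sum>b\<in>Basis. C b"]) auto
qed

text \<open>A real-valued \<open>SUP\<close> is informative only for a set that is bounded above;
  this supplies the bound for \<open>multi_deriv_norm\<close>.\<close>

lemma multi_deriv_bounded_at:
  fixes f :: "'a::euclidean_space \<Rightarrow> 'b::euclidean_space"
  assumes "open U" "x \<in> U" "Ck_on p f U"
  shows "bdd_above ((\<lambda>vs. norm (multi_deriv f vs x)) ` {vs. length vs = p \<and> (\<forall>v\<in>set vs. norm v = 1)})"
proof -
  have "\<exists>C. \<forall>(i, y)\<in>{((), x)}. \<forall>vs. length vs = p \<and> (\<forall>v\<in>set vs. norm v = 1) \<longrightarrow> norm (multi_deriv f vs y) \<le> C"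
    by (rule multi_deriv_bound_from_Basis[OF assms(1)]) (use assms in auto)
  then obtain C where "\<And>vs. length vs = p \<Longrightarrow> \<forall>v\<in>set vs. norm v = 1 \<Longrightarrow> norm (multi_deriv f vs x) \<le> C"
    by auto
  then show ?thesis by (intro bdd_aboveI2[of _ _ C]) simp
qed

lemma multi_deriv_le_Ck_norm:
  fixes f :: "'a::euclidean_space \<Rightarrow> 'b::euclidean_space"
  assumes "open U" "x \<in> U" "Ck_on k f U" "Ck_norm k f U \<le> ereal K" "vs \<noteq> []" "length vs \<le> k"
  shows "norm (multi_deriv f vs x) \<le> K * prod_list (map norm vs)"
proof -
  have C: "Ck_on (length vs) f U" using Ck_on_mono[OF assms(3,6)] .
  obtain us where us: "length us = length vs" "\<forall>u\<in>set us. norm u = 1"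
    "multi_deriv f vs x = prod_list (map norm vs) *\<^sub>R multi_deriv f us x"
    using multi_deriv_homogeneous[OF assms(1,2) C] by blast
  have "norm (multi_deriv f us x) \<le> multi_deriv_norm (length vs) f x"
    unfolding multi_deriv_norm_def
    by (rule cSUP_upper[OF _ multi_deriv_bounded_at[OF assms(1,2) C]]) (use us in simp)
  moreover have "ereal (multi_deriv_norm (length vs) f x) \<le> ereal K"
  proof -
    have "ereal (multi_deriv_norm (length vs) f x) \<le> (SUP x\<in>U. ereal (multi_deriv_norm (length vs) f x))"
      by (rule SUP_upper[OF assms(2)])
    also have "\<dots> \<le> Ck_norm k f U"
      unfolding Ck_norm_def using assms(5,6) by (intro Max_ge) (auto simp: Suc_le_eq)
    finally show ?thesis using assms(4) by (rule order_trans)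
  qed
  ultimately have "norm (multi_deriv f us x) \<le> K" by simp
  moreover have "0 \<le> prod_list (map norm vs)" by (induction vs) auto
  ultimately show ?thesis
    unfolding us(3) norm_scaleR mult.commute[of K] by (simp add: mult_left_mono)
qed

lemma Ck_norm_leI:
  fixes f :: "'a::euclidean_space \<Rightarrow> 'b::euclidean_space"
  assumes "k \<ge> 1" "\<And>x vs. x \<in> U \<Longrightarrow> 1 \<le> length vs \<Longrightarrow> length vs \<le> k \<Longrightarrow> \<forall>v\<in>set vs. norm v = 1
    \<Longrightarrow> norm (multi_deriv f vs x) \<le> M"
  shows "Ck_norm k f U \<le> ereal M"
proof -
  have "multi_deriv_norm p f x \<le> M" if "x \<in> U" "p \<in> {1..k}" for x p
    unfolding multi_deriv_norm_def
  proof (rule cSUP_least)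
    have "replicate p (SOME i::'a. i \<in> Basis) \<in> {vs. length vs = p \<and> (\<forall>v\<in>set vs. norm v = 1)}"
      by (simp add: norm_Basis SOME_Basis)
    then show "{vs::'a list. length vs = p \<and> (\<forall>v\<in>set vs. norm v = 1)} \<noteq> {}" by blast
  qed (use assms(2) that in auto)
  then show ?thesis
    unfolding Ck_norm_def using assms(1) by (subst Max_le_iff) (auto intro!: SUP_least)
qed

lemma sym_class_multi_deriv_bound:
  assumes "unif_class (length vs) S F"
  shows "\<exists>C. \<forall>i. \<forall>x\<in>S. norm (multi_deriv (F i) vs x) \<le> C"
  using assms
proof (induction vs arbitrary: F)
  case Nil
  then show ?case by simp
next
  case (Cons v vs)
  have "unif_class (length vs) S (\<lambda>i x. frechet_derivative (F i) (at x) v)"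
    using Cons.prems by simp
  from Cons.IH[OF this] show ?case by simp
qed

lemma sym_class_of_multi_deriv_bound:
  assumes "\<And>i. Ck_on k (F i) S" "\<And>vs. length vs \<le> k \<Longrightarrow> \<exists>C. \<forall>i. \<forall>x\<in>S. norm (multi_deriv (F i) vs x) \<le> C"
  shows "unif_class k S F"
  using assms
proof (induction k arbitrary: F)
  case 0
  then show ?case using "0.prems"(2)[of "[]"] by simp
next
  case (Suc k)
  have "unif_class k S (\<lambda>i x. frechet_derivative (F i) (at x) v)" for v
  proof (rule Suc.IH)
    show "Ck_on k (\<lambda>x. frechet_derivative (F i) (at x) v) S" for i using Suc.prems(1)[of i] by simp
    show "\<exists>C. \<forall>i. \<forall>x\<in>S. norm (multi_deriv (\<lambda>x. frechet_derivative (F i) (at x) v) vs x) \<le> C"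
      if "length vs \<le> k" for vs
      using Suc.prems(2)[of "v # vs"] that by simp
  qed
  then show ?case using Suc.prems(1) Suc.prems(2)[of "[]"] by simp
qed

lemma sym_class_uniform_multi_deriv_bound:
  fixes F :: "'i \<Rightarrow> 'a::euclidean_space \<Rightarrow> 'b::euclidean_space"
  assumes "open S" "unif_class k S F"
  shows "\<exists>M>0. \<forall>i. \<forall>x\<in>S. \<forall>vs. length vs \<le> k \<and> (\<forall>v\<in>set vs. norm v = 1) \<longrightarrow> norm (multi_deriv (F i) vs x) \<le> M"
proof -
  have "\<exists>C. \<forall>(i, x)\<in>UNIV \<times> S. \<forall>vs. length vs = p \<and> (\<forall>v\<in>set vs. norm v = 1) \<longrightarrow> norm (multi_deriv (F i) vs x) \<le> C"
    if "p \<le> k" for p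
  proof (rule multi_deriv_bound_from_Basis[OF assms(1)])
    have p: "unif_class p S F" by (rule sym_class_antimono[OF assms(2) that])
    show "Ck_on p (F i) S" for i by (rule sym_class_imp_Ck_on[OF p])
    show "\<exists>C. \<forall>(i, x)\<in>UNIV \<times> S. norm (multi_deriv (F i) bs x) \<le> C" if "length bs = p" for bs
      using sym_class_multi_deriv_bound[of bs S F] p that by auto
  qed auto
  then have "\<forall>p. \<exists>C. p \<le> k \<longrightarrow> (\<forall>i. \<forall>x\<in>S. \<forall>vs. length vs = p \<and> (\<forall>v\<in>set vs. norm v = 1) \<longrightarrow> norm (multi_deriv (F i) vs x) \<le> C)"
    by fastforce
  from choice[OF this] obtain C where C: "\<And>p i x vs. p \<le> k \<Longrightarrow> x \<in> S \<Longrightarrow> length vs = p \<Longrightarrow> (\<forall>v\<in>set vs. norm v = 1)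
      \<Longrightarrow> norm (multi_deriv (F i) vs x) \<le> C p" by fast
  \<comment> \<open>The sum majorizes the constants of all orders, and the 1 makes the bound
    strictly positive.\<close>
  have "norm (multi_deriv (F i) vs x) \<le> 1 + (\<Sum>p\<le>k. \<bar>C p\<bar>)"
    if "x \<in> S" "length vs \<le> k" "\<forall>v\<in>set vs. norm v = 1" for i x vs
  proof -
    have "norm (multi_deriv (F i) vs x) \<le> \<bar>C (length vs)\<bar>"
      using C[OF that(2,1) refl that(3), of i] by linarith
    also have "\<dots> \<le> (\<Sum>p\<le>k. \<bar>C p\<bar>)" using that(2) by (intro member_le_sum) auto
    finally show ?thesis by simp
  qed
  moreover have "0 < 1 + (\<Sum>p\<le>k. \<bar>C p\<bar>)" by (simp add: add_pos_nonneg sum_nonneg)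
  ultimately show ?thesis by blast
qed

subsection \<open>Polynomial Newton iteration\<close>

text \<open>
  Families of polynomials with uniformly bounded coefficients and without terms of degree below \<open>m\<close>;
  no homogeneous decomposition is needed because only division by the coordinates is used.
\<close>
inductive poly_order :: "nat \<Rightarrow> ('i \<Rightarrow> 'a::euclidean_space \<Rightarrow> real) \<Rightarrow> bool" where
  const: "(\<And>i. \<bar>c i\<bar> \<le> C) \<Longrightarrow> poly_order 0 (\<lambda>i x. c i)"
| add: "poly_order m F \<Longrightarrow> poly_order m G \<Longrightarrow> poly_order m (\<lambda>i x. F i x + G i x)"
| coord: "b \<in> Basis \<Longrightarrow> poly_order m F \<Longrightarrow> poly_order (Suc m) (\<lambda>i x. (x \<bullet> b) * F i x)"
| weaken: "poly_order (Suc m) F \<Longrightarrow> poly_order m F"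

lemma poly_order_antimono: 
  assumes "poly_order m F" "n \<le> m" shows "poly_order n F"
  using assms(2,1)
proof (induction rule: inc_induct)
  case (step j)
  then show ?case by (intro poly_order.weaken[of j])
qed simp

lemma poly_order_zero: "poly_order m (\<lambda>i (x::'a::euclidean_space). 0)"
proof (induction m)
  case 0
  show ?case using poly_order.const[of "\<lambda>_. 0" 0] by simp
next
  case (Suc m)
  show ?case using poly_order.coord[OF SOME_Basis Suc] by simp
qed

lemma poly_order_sum:
  assumes "\<And>b. b \<in> B \<Longrightarrow> poly_order m (F b)"
  shows "poly_order m (\<lambda>i x. \<Sum>b\<in>B. F b i x)"
proof (cases "finite B")
  case True
  then show ?thesis using assms
    by (induction B rule: finite_induct) (auto intro: poly_order_zero poly_order.add)
qed (simp add: poly_order_zero)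

lemma poly_order_const_mult:
  assumes "poly_order m F" "\<And>i. \<bar>c i\<bar> \<le> C"
  shows "poly_order m (\<lambda>i x. c i * F i x)"
  using assms(1)
proof induction
  case (const d D)
  have "\<bar>c i * d i\<bar> \<le> C * D" for i
    using const[of i] assms(2)[of i] unfolding abs_mult by (intro mult_mono) auto
  then show ?case by (rule poly_order.const)
next
  case (add m F G)
  then show ?case using poly_order.add[OF add.IH] by (simp add: algebra_simps)
next
  case (coord b m F)
  then show ?case using poly_order.coord[OF coord.hyps(1) coord.IH] by (simp add: mult_ac)
next
  case (weaken m F)
  show ?case by (rule poly_order.weaken) (rule weaken.IH)
qed

lemma poly_order_mult:
  assumes "poly_order m F" "poly_order n G"
  shows "poly_order (m + n) (\<lambda>i x. F i x * G i x)"
  using assms(1)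
proof induction
  case (const d D)
  then show ?case using poly_order_const_mult[OF assms(2) const] by simp
next
  case (add m F H)
  then show ?case using poly_order.add[OF add.IH] by (simp add: algebra_simps)
next
  case (coord b m F)
  then show ?case using poly_order.coord[OF coord.hyps(1) coord.IH] by (simp add: mult_ac)
next
  case (weaken m F)
  have "poly_order (Suc (m + n)) (\<lambda>i x. F i x * G i x)" using weaken.IH by simp
  then show ?case by (rule poly_order.weaken)
qed

text \<open>Induction over the construction: a \<open>coord\<close> step displays its factor, and a
  \<open>weaken\<close> step divides at the higher order first. The equation
  \<open>m' = Suc m\<close> rules out the \<open>const\<close> case.\<close>

lemma poly_order_divide:
  fixes F :: "'i \<Rightarrow> 'a::euclidean_space \<Rightarrow> real"
  assumes "poly_order (Suc m) F"
  shows "\<exists>s. (\<forall>b\<in>Basis. poly_order m (s b)) \<and> F = (\<lambda>i x. \<Sum>b\<in>Basis. (x \<bullet> b) * s b i x)"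
proof -
  have "\<exists>s. (\<forall>b\<in>Basis. poly_order m (s b)) \<and> F = (\<lambda>i x. \<Sum>b\<in>Basis. (x \<bullet> b) * s b i x)"
    if "poly_order m' F" "m' = Suc m" for m' m and F :: "'i \<Rightarrow> 'a \<Rightarrow> real"
    using that
  proof (induction arbitrary: m)
    case (const d D)
    then show ?case by simp
  next
    case (add m' F G)
    obtain s where s: "\<forall>b\<in>Basis. poly_order m (s b)" "F = (\<lambda>i x. \<Sum>b\<in>Basis. (x \<bullet> b) * s b i x)"
      using add.IH(1)[OF add.prems] by blast
    obtain t where t: "\<forall>b\<in>Basis. poly_order m (t b)" "G = (\<lambda>i x. \<Sum>b\<in>Basis. (x \<bullet> b) * t b i x)"
      using add.IH(2)[OF add.prems] by blast
    from s t show ?case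
      by (intro exI[of _ "\<lambda>b i x. s b i x + t b i x"])
         (auto simp: sum.distrib distrib_left intro: poly_order.add)
  next
    case (coord b m' F)
    have "(\<lambda>i x. (x \<bullet> b) * F i x) = (\<lambda>i x. \<Sum>c\<in>Basis. (x \<bullet> c) * (if c = b then F i x else 0))"
      using coord.hyps(1) by (simp add: if_distrib[of "\<lambda>t. _ * t"] cong: if_cong)
    moreover have "\<forall>c\<in>Basis. poly_order m (\<lambda>i x. if c = b then F i x else 0)"
    proof
      fix c :: 'a
      show "poly_order m (\<lambda>i x. if c = b then F i x else 0)"
        using coord by (cases "c = b") (simp_all add: poly_order_zero)
    qed
    ultimately show ?case by (intro exI[of _ "\<lambda>c i x. if c = b then F i x else 0"] conjI)
  next
    case (weaken m' F)
    obtain s where "\<forall>b\<in>Basis. poly_order (Suc m) (s b)" "F = (\<lambda>i x. \<Sum>b\<in>Basis. (x \<bullet> b) * s b i x)"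
      using weaken.IH[of "Suc m"] weaken.prems by auto
    moreover from this have "\<forall>b\<in>Basis. poly_order m (s b)"
      using poly_order.weaken by blast
    ultimately show ?case by blast
  qed
  from this[OF assms refl] show ?thesis .
qed

text \<open>The coefficients are derivatives at 0, so the uniform C^j bound of the family bounds
  them uniformly.\<close>

lemma poly_order_taylor_term:
  fixes F :: "'i \<Rightarrow> 'a::euclidean_space \<Rightarrow> real"
  assumes "unif_class j S F" "0 \<in> S"
  shows "poly_order j (\<lambda>i x. taylor_term j (F i) x)"
  using assms(1)
proof (induction j arbitrary: F)
  case (0 F)
  obtain C where "C > 0" and C: "\<And>i x. x \<in> S \<Longrightarrow> norm (F i x) \<le> C * \<bar>1\<bar>"
    using sym_class_bound[OF 0] by blast
  then show ?case using C[OF assms(2)] poly_order.const[of "\<lambda>i. F i 0" C] by simp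
next
  case (Suc j F)
  have "poly_order (Suc j) (\<lambda>i x. (x \<bullet> b) * taylor_term j (\<lambda>y. frechet_derivative (F i) (at y) b) x)" if "b \<in> Basis" for b
    using Suc.prems by (intro poly_order.coord[OF that] Suc.IH) simp
  then show ?case by (simp add: poly_order_sum)
qed

lemma poly_order_sym_class:
  fixes F :: "'i \<Rightarrow> 'a::euclidean_space \<Rightarrow> real"
  assumes "poly_order m F"
  shows "sym_class k (ball 0 \<rho> - {0}) norm (\<lambda>i x. norm x ^ m) F"
    and "unif_class k (ball 0 \<rho>) F"
proof -
  have open_S: "open (ball (0::'a) \<rho>)" "open (ball (0::'a) \<rho> - {0})" by auto
  show "sym_class k (ball 0 \<rho> - {0}) norm (\<lambda>i x. norm x ^ m) F"
    using assms
  proof induction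
    case (const c C)
    then show ?case using sym_class_const[of c C] by simp
  next
    case (add m F G)
    then show ?case by (intro sym_class_add open_S)
  next
    case (coord b m F)
    have "sym_class k (ball 0 \<rho> - {0}) norm (\<lambda>(i::'i). norm) (\<lambda>i x. x \<bullet> b)"
      by (rule sym_class_inner_const[OF open_S(2), where C=1]) auto
    from sym_class_mult[OF open_S(2) this coord.IH] show ?case by simp
  next
    case (weaken m F)
    show ?case
      \<comment> \<open>Lowering the order by one costs a factor |x|, which is below \<rho>.\<close>
      by (rule sym_class_weaken[OF weaken.IH, where c=\<rho>]) (auto simp: abs_mult intro!: mult_right_mono)
  qed
  show "unif_class k (ball 0 \<rho>) F"
    using assms
  proof induction
    case (const c C)
    then show ?case using sym_class_const[of c C] by simp
  next
    case (add m F G)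
    then show ?case by (intro sym_class_add open_S)
  next
    case (coord b m F)
    have "sym_class k (ball 0 \<rho>) (\<lambda>_. 1) (\<lambda>(i::'i) _. 1) (\<lambda>i x. x \<bullet> b)"
      by (rule sym_class_inner_const[OF open_S(1), where C=\<rho>]) auto
    from sym_class_mult[OF open_S(1) this coord.IH] show ?case by simp
  qed
qed

lemma inner_Basis_sum: "(u::'a::euclidean_space) \<bullet> (\<Sum>b\<in>Basis. c b *\<^sub>R b) = (\<Sum>b\<in>Basis. (u \<bullet> b) * c b)"
  by (simp add: inner_sum_right mult.commute)

lemma poly_order_inner:
  assumes "\<And>b. b \<in> Basis \<Longrightarrow> poly_order m (\<lambda>i x. U i x \<bullet> b)"
    and "\<And>b. b \<in> Basis \<Longrightarrow> poly_order n (\<lambda>i x. V i x \<bullet> b)"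
  shows "poly_order (m + n) (\<lambda>i x. U i x \<bullet> (V i x :: 'a::euclidean_space))"
proof -
  have "poly_order (m + n) (\<lambda>i x. \<Sum>b\<in>Basis. (U i x \<bullet> b) * (V i x \<bullet> b))"
    by (intro poly_order_sum poly_order_mult assms)
  then show ?thesis by (subst euclidean_inner)
qed

text \<open>Self-adjoint involutions stand for the diagonal sign matrices; the signs themselves only
  appear with \<open>sign_flip\<close>. The index lets the signature vary within a family.\<close>

locale reflection_family =
  fixes D :: "'i \<Rightarrow> 'a::euclidean_space \<Rightarrow> 'a"
  assumes linear_D: "linear (D i)"
    and D_D [simp]: "D i (D i x) = x"
    and D_adjoint: "D i x \<bullet> y = x \<bullet> D i y"
begin

lemma D_inner_D [simp]: "D i x \<bullet> D i y = x \<bullet> y"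
  by (simp add: D_adjoint)

lemma norm_D [simp]: "norm (D i x) = norm x"
  unfolding norm_eq_sqrt_inner by (simp only: D_inner_D)

lemma D_simps: "D i (x + y) = D i x + D i y" "D i (x - y) = D i x - D i y" "D i (c *\<^sub>R x) = c *\<^sub>R D i x"
  using linear_D[of i] by (simp_all add: linear_add linear_diff linear_cmul)

lemma D_expand: "D i x = (\<Sum>b\<in>Basis. (x \<bullet> b) *\<^sub>R D i b)"
  by (rule linear_basis_expansion[OF linear_D])

lemma bounded_linear_D: "bounded_linear (D i)"
  using linear_D linear_conv_bounded_linear by blast

lemma abs_D_inner_Basis: "b \<in> Basis \<Longrightarrow> c \<in> Basis \<Longrightarrow> \<bar>D i b \<bullet> c\<bar> \<le> 1"
  using Cauchy_Schwarz_ineq2[of "D i b" c] by simp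

lemma poly_order_D:
  assumes "\<And>b. b \<in> Basis \<Longrightarrow> poly_order m (\<lambda>i x. U i x \<bullet> b)" "c \<in> Basis"
  shows "poly_order m (\<lambda>i x. D i (U i x) \<bullet> c)"
proof -
  have "poly_order m (\<lambda>i x. \<Sum>b\<in>Basis. (D i b \<bullet> c) * (U i x \<bullet> b))"
    using abs_D_inner_Basis assms by (intro poly_order_sum poly_order_const_mult[where C=1]) auto
  moreover have "D i (U i x) \<bullet> c = (\<Sum>b\<in>Basis. (D i b \<bullet> c) * (U i x \<bullet> b))" for i x
    by (subst D_expand) (simp add: inner_sum_left mult.commute)
  ultimately show ?thesis by simp
qed

lemma sym_class_D:
  assumes "open S" "sym_class k S l W F"
  shows "sym_class k S l W (\<lambda>i x. D i (F i x))"
proof -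
  have "sym_class k S l W (\<lambda>i x. (F i x \<bullet> b) *\<^sub>R D i b)" if b: "b \<in> Basis" for b
  proof -
    have 1: "sym_class k S l W (\<lambda>i x. F i x \<bullet> b)"
      by (rule sym_class_components[OF assms(1), THEN iffD1, OF assms(2), rule_format, OF b])
    have 2: "sym_class k S l (\<lambda>_ _. 1) (\<lambda>i x. D i b)"
      by (rule sym_class_const[where C=1]) (use b in simp)
    show ?thesis using sym_class_scaleR[OF assms(1) 1 2] by simp
  qed
  then have "sym_class k S l W (\<lambda>i x. \<Sum>b\<in>Basis. (F i x \<bullet> b) *\<^sub>R D i b)"
    by (intro sym_class_sum assms(1))
  moreover have "(\<lambda>i x. D i (F i x)) = (\<lambda>i x. \<Sum>b\<in>Basis. (F i x \<bullet> b) *\<^sub>R D i b)"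
    by (rule ext, rule ext, rule D_expand)
  ultimately show ?thesis by simp
qed

text \<open>If the residual is divided as x \<bullet> \<sigma>, the corrected residual is -(e
  \<bullet> \<sigma>) - (\<sigma> \<bullet> D \<sigma>)/4. As \<open>e\<close> has order 2 and
  \<sigma> has order m + 2, both terms have order at least m + 4, so each step gains one
  order.\<close>

lemma quadratic_newton:
  assumes "poly_order 3 (\<lambda>i x. T i x - D i x \<bullet> x)"
  shows "\<exists>e. (\<forall>b\<in>Basis. poly_order 2 (\<lambda>i x. e i x \<bullet> b)) \<and>
    poly_order (m + 3) (\<lambda>i x. T i x - D i (x + e i x) \<bullet> (x + e i x))"
proof (induction m)
  case 0
  show ?case using assms by (intro exI[of _ "\<lambda>i x. 0"]) (simp add: poly_order_zero)
next
  case (Suc m)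
  then obtain e where e: "\<And>b. b \<in> Basis \<Longrightarrow> poly_order 2 (\<lambda>i x. e i x \<bullet> b)"
    "poly_order (Suc (m + 2)) (\<lambda>i x. T i x - D i (x + e i x) \<bullet> (x + e i x))"
    by (auto simp: numeral_eq_Suc)
  obtain s where s: "\<forall>b\<in>Basis. poly_order (m + 2) (s b)"
    "(\<lambda>i x. T i x - D i (x + e i x) \<bullet> (x + e i x)) = (\<lambda>i x. \<Sum>b\<in>Basis. (x \<bullet> b) * s b i x)"
    using poly_order_divide[OF e(2)] by blast
  define \<sigma> where "\<sigma> i x = (\<Sum>b\<in>Basis. s b i x *\<^sub>R b)" for i x
  have \<sigma>_comp: "\<sigma> i x \<bullet> b = s b i x" if "b \<in> Basis" for i x b
    unfolding \<sigma>_def using that by simp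
  have \<sigma>: "poly_order (m + 2) (\<lambda>i x. \<sigma> i x \<bullet> b)" if "b \<in> Basis" for b
    using s(1) that by (simp add: \<sigma>_comp)
  have res: "T i x = D i (x + e i x) \<bullet> (x + e i x) + x \<bullet> \<sigma> i x" for i x
    using fun_cong[OF fun_cong[OF s(2)], of i x] unfolding \<sigma>_def inner_Basis_sum by simp
  \<comment> \<open>As \<open>D\<close> is an involution, the correction solves the linearized equation \<open>2 * (D x \<bullet> d) = x \<bullet> \<sigma>\<close>.\<close>
  define e' where "e' i x = e i x + (1/2) *\<^sub>R D i (\<sigma> i x)" for i x
  have "T i x - D i (x + e' i x) \<bullet> (x + e' i x)
      = (-1) * (e i x \<bullet> \<sigma> i x) + (-1/4) * (\<sigma> i x \<bullet> D i (\<sigma> i x))" for i x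
    unfolding res e'_def
    by (simp add: D_simps inner_add_left inner_add_right inner_commute D_adjoint algebra_simps)
  moreover have "poly_order (m + 4) (\<lambda>i x. (-1) * (e i x \<bullet> \<sigma> i x) + (-1/4) * (\<sigma> i x \<bullet> D i (\<sigma> i x)))"
  proof (intro poly_order.add poly_order_const_mult[where C=1])
    show "poly_order (m + 4) (\<lambda>i x. e i x \<bullet> \<sigma> i x)"
      by (rule poly_order_antimono[OF poly_order_inner[OF e(1) \<sigma>]]) auto
    show "poly_order (m + 4) (\<lambda>i x. \<sigma> i x \<bullet> D i (\<sigma> i x))"
      by (rule poly_order_antimono[OF poly_order_inner[OF \<sigma> poly_order_D[OF \<sigma>]]]) auto
  qed auto
  ultimately have "poly_order (Suc m + 3) (\<lambda>i x. T i x - D i (x + e' i x) \<bullet> (x + e' i x))"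
    by (simp add: numeral_eq_Suc)
  moreover have "poly_order 2 (\<lambda>i x. e' i x \<bullet> b)" if "b \<in> Basis" for b
  proof -
    have "poly_order 2 (\<lambda>i x. D i (\<sigma> i x) \<bullet> b)"
      by (rule poly_order_antimono[OF poly_order_D[OF \<sigma> that]]) auto
    then have "poly_order 2 (\<lambda>i x. e i x \<bullet> b + (1/2) * (D i (\<sigma> i x) \<bullet> b))"
      using that by (intro poly_order.add poly_order_const_mult[where C=1] e(1)) auto
    then show ?thesis by (simp add: e'_def inner_add_left)
  qed
  ultimately show ?case by blast
qed

text \<open>The terms of degree 0 and 1 vanish, and the term of degree 2, divided by 2!, is exactly
  the quadratic form.\<close>

lemma poly_order_taylor_poly:
  fixes h :: "'i \<Rightarrow> 'a \<Rightarrow> real"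
  assumes "0 \<in> S" "unif_class k S h" "k \<ge> 2"
    and "\<And>i. h i 0 = 0" "\<And>i v. frechet_derivative (h i) (at 0) v = 0"
    and "\<And>i v w. frechet_derivative (\<lambda>y. frechet_derivative (h i) (at y) v) (at 0) w = 2 * (D i v \<bullet> w)"
  shows "poly_order 3 (\<lambda>i x. taylor_poly k (h i) x - D i x \<bullet> x)"
proof -
  have "taylor_poly k (h i) x - D i x \<bullet> x = (\<Sum>j\<in>{3..k}. (1 / fact j) * taylor_term j (h i) x)" for i x
  proof -
    have "taylor_term 1 (h i) x = 0"
      by (simp add: assms(5))
    moreover have "taylor_term 2 (h i) x = (\<Sum>b\<in>Basis. \<Sum>c\<in>Basis. 2 * ((x \<bullet> b) * ((x \<bullet> c) * (D i b \<bullet> c))))"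
      by (simp add: numeral_2_eq_2 assms(6) sum_distrib_left mult_ac)
    moreover have "D i x \<bullet> x = (\<Sum>b\<in>Basis. \<Sum>c\<in>Basis. (x \<bullet> b) * ((x \<bullet> c) * (D i b \<bullet> c)))"
    proof -
      have "D i x \<bullet> x = (\<Sum>b\<in>Basis. (x \<bullet> b) * (D i b \<bullet> x))"
        by (subst D_expand) (simp add: inner_sum_left)
      also have "\<dots> = (\<Sum>b\<in>Basis. (x \<bullet> b) * (\<Sum>c\<in>Basis. (x \<bullet> c) * (D i b \<bullet> c)))"
        by (subst euclidean_inner[of "D i _" x]) (simp add: mult.commute)
      finally show ?thesis by (simp add: sum_distrib_left)
    qed
    moreover have "{..k} = {0, 1, 2} \<union> {3..k}" using assms(3) by auto
    ultimately show ?thesis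
      unfolding taylor_poly_def
      by (simp add: sum.union_disjoint assms(4) sum_distrib_left[symmetric] fact_numeral numeral_2_eq_2)
  qed
  moreover have "poly_order 3 (\<lambda>i x. \<Sum>j\<in>{3..k}. (1 / fact j) * taylor_term j (h i) x)"
  proof (intro poly_order_sum poly_order_const_mult[where C=1])
    show "poly_order 3 (\<lambda>i x. taylor_term j (h i) x)" if "j \<in> {3..k}" for j
      using that assms(1) sym_class_antimono[OF assms(2)]
      by (intro poly_order_antimono[OF poly_order_taylor_term[of j S]]) auto
  qed auto
  ultimately show ?thesis by simp
qed

end

subsection \<open>Damping\<close>

text \<open>The definition gives one constant per direction; linearity and finiteness of
  \<open>Basis\<close> give one for all directions.\<close>

lemma sym_class_derivative_bound:
  assumes "sym_class (Suc k) S l W F"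
  obtains C where "C > 0"
    "\<And>i x v. x \<in> S \<Longrightarrow> norm (frechet_derivative (F i) (at x) v) \<le> C * \<bar>W i x / l x\<bar> * norm v"
proof -
  have "\<exists>C. C > 0 \<and> (\<forall>i. \<forall>x\<in>S. norm (frechet_derivative (F i) (at x) b) \<le> C * \<bar>W i x / l x\<bar>)" for b
  proof -
    have sym: "sym_class k S l (\<lambda>i x. W i x / l x) (\<lambda>i x. frechet_derivative (F i) (at x) b)"
      using assms by simp
    show ?thesis
      by (rule sym_class_bound[OF sym]) blast
  qed
  then have "\<forall>b. \<exists>C. C > 0 \<and> (\<forall>i. \<forall>x\<in>S. norm (frechet_derivative (F i) (at x) b) \<le> C * \<bar>W i x / l x\<bar>)"
    by blast
  from choice[OF this] obtain C where C: "\<And>b. C b > 0"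
    "\<And>b i x. x \<in> S \<Longrightarrow> norm (frechet_derivative (F i) (at x) b) \<le> C b * \<bar>W i x / l x\<bar>"
    by blast
  show thesis
  proof (rule that)
    show "0 < (\<Sum>b\<in>Basis. C b)" using C(1) by (intro sum_pos) auto
    fix i x v assume x: "x \<in> S"
    have "frechet_derivative (F i) (at x) v = (\<Sum>b\<in>Basis. (v \<bullet> b) *\<^sub>R frechet_derivative (F i) (at x) b)"
      by (rule linear_basis_expansion[OF has_derivative_linear[OF sym_class_derivative[OF assms x]]])
    also have "norm \<dots> \<le> (\<Sum>b\<in>Basis. \<bar>v \<bullet> b\<bar> * norm (frechet_derivative (F i) (at x) b))"
      by (rule order_trans[OF norm_sum]) simp
    also have "\<dots> \<le> (\<Sum>b\<in>Basis. norm v * (C b * \<bar>W i x / l x\<bar>))"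
      by (intro sum_mono mult_mono C(2)[OF x] Basis_le_norm) auto
    also have "\<dots> = (\<Sum>b\<in>Basis. C b) * \<bar>W i x / l x\<bar> * norm v"
      by (simp add: sum_distrib_left sum_distrib_right sum_divide_distrib mult_ac)
    finally show "norm (frechet_derivative (F i) (at x) v) \<le> (\<Sum>b\<in>Basis. C b) * \<bar>W i x / l x\<bar> * norm v" .
  qed
qed

text \<open>
  A rational replacement for a cutoff function: it equals \<open>1\<close> up to order \<open>2 * N\<close> at \<open>0\<close>, and for large \<open>\<Lambda>\<close> it
  is small away from \<open>0\<close>.
\<close>
definition damping :: "real \<Rightarrow> nat \<Rightarrow> 'a::real_inner \<Rightarrow> real" where
  "damping \<Lambda> N x = inverse (1 + \<Lambda> * (x \<bullet> x) ^ N)"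

context
  fixes \<Lambda> :: real and N :: nat
  assumes \<Lambda>: "\<Lambda> > 0" and N: "N > 0"
begin

lemma damping_pos: "0 < damping \<Lambda> N x" and damping_le_1: "damping \<Lambda> N x \<le> 1"
  and one_minus_damping: "1 - damping \<Lambda> N x = \<Lambda> * (x \<bullet> x) ^ N * damping \<Lambda> N x"
proof -
  have *: "0 \<le> \<Lambda> * (x \<bullet> x) ^ N" using \<Lambda> by simp
  then show "0 < damping \<Lambda> N x" "damping \<Lambda> N x \<le> 1"
    by (auto simp: damping_def intro: add_pos_nonneg inverse_le_1_iff[THEN iffD2])
  have "1 + \<Lambda> * (x \<bullet> x) ^ N \<noteq> 0" using * by linarith
  then show "1 - damping \<Lambda> N x = \<Lambda> * (x \<bullet> x) ^ N * damping \<Lambda> N x"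
    by (simp add: damping_def field_simps)
qed

lemma damping_has_derivative:
  "(damping \<Lambda> N has_derivative
     (\<lambda>v. - (damping \<Lambda> N x * (\<Lambda> * (real N * (2 * (x \<bullet> v)) * (x \<bullet> x) ^ (N - 1))) * damping \<Lambda> N x))) (at x)"
proof -
  have "1 + \<Lambda> * (x \<bullet> x) ^ N \<noteq> 0"
    using \<Lambda> by (smt (verit) inner_ge_zero mult_nonneg_nonneg zero_le_power)
  moreover have "((\<lambda>x. 1 + \<Lambda> * (x \<bullet> x) ^ N) has_derivative
     (\<lambda>v. \<Lambda> * (real N * (2 * (x \<bullet> v)) * (x \<bullet> x) ^ (N - 1)))) (at x)"
    by (auto intro!: derivative_eq_intros simp: inner_commute)
  ultimately show ?thesis
    unfolding damping_def[abs_def] by (intro Deriv.has_derivative_inverse)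
qed

text \<open>The right-hand side is free of \<Lambda> except through the damping factor c itself:
  \<Lambda> |x|^(2N) c equals 1 - c and is at most 1. This keeps the product rule under control
  however large \<Lambda> is.\<close>

lemma damping_derivative_bound:
  "\<bar>damping \<Lambda> N x * (\<Lambda> * (real N * (2 * (x \<bullet> v)) * (x \<bullet> x) ^ (N - 1))) * damping \<Lambda> N x\<bar> * norm x
    \<le> 2 * N * damping \<Lambda> N x * norm v"
proof -
  let ?c = "damping \<Lambda> N x"
  have "\<bar>?c * (\<Lambda> * (real N * (2 * (x \<bullet> v)) * (x \<bullet> x) ^ (N - 1))) * ?c\<bar> * norm x
      = ?c * ?c * \<Lambda> * real N * 2 * (x \<bullet> x) ^ (N - 1) * (\<bar>x \<bullet> v\<bar> * norm x)"
    using \<Lambda> damping_pos[of x] by (simp add: abs_mult mult_ac)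
  also have "\<dots> \<le> ?c * ?c * \<Lambda> * real N * 2 * (x \<bullet> x) ^ (N - 1) * (norm x * norm v * norm x)"
    using \<Lambda> damping_pos[of x] Cauchy_Schwarz_ineq2[of x v]
    by (intro mult_left_mono mult_right_mono mult_nonneg_nonneg) auto
  also have "\<dots> = ?c * ?c * \<Lambda> * real N * 2 * ((x \<bullet> x) ^ (N - 1) * (x \<bullet> x)) * norm v"
    by (simp add: dot_square_norm power2_eq_square mult_ac)
  also have "(x \<bullet> x) ^ (N - 1) * (x \<bullet> x) = (x \<bullet> x) ^ N"
    using N by (simp add: power_eq_if mult.commute)
  also have "?c * ?c * \<Lambda> * real N * 2 * (x \<bullet> x) ^ N * norm v
      = (\<Lambda> * (x \<bullet> x) ^ N * ?c) * (2 * N * ?c * norm v)"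
    by (simp add: mult_ac)
  also have "\<dots> \<le> 1 * (2 * N * ?c * norm v)"
    using damping_pos[of x] one_minus_damping[of x] by (intro mult_right_mono) auto
  finally show ?thesis by simp
qed

text \<open>In contrast to the previous estimate, the constants here may depend on \<Lambda>. The
  third part says that damping changes a function only to order 2 N at 0.\<close>

lemma sym_class_damping:
  fixes \<rho> :: real
  shows "sym_class k (ball 0 \<rho> - {0}) norm (\<lambda>_ _. 1) (\<lambda>(i::'i) (x::'a::euclidean_space). damping \<Lambda> N x)"
    and "unif_class k (ball 0 \<rho>) (\<lambda>(i::'i) (x::'a). damping \<Lambda> N x)"
    and "sym_class k (ball 0 \<rho> - {0}) norm (\<lambda>i x. norm x ^ (2 * N)) (\<lambda>(i::'i) (x::'a). 1 - damping \<Lambda> N x)"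
proof -
  have open_S: "open (ball (0::'a) \<rho>)" "open (ball (0::'a) \<rho> - {0})" by auto
  have ge1: "1 \<le> 1 + \<Lambda> * (x \<bullet> x) ^ N" for x :: 'a using \<Lambda> by simp
  have "sym_class k (ball 0 \<rho> - {0}) norm (\<lambda>i::'i. norm) (\<lambda>i x::'a. x)"
    by (rule sym_class_ident[OF open_S(2), where C=1]) auto
  from sym_class_mult_const[OF open_S(2) sym_class_power[OF open_S(2) sym_class_inner[OF open_S(2) this this], where m=N], where c=\<Lambda>]
  have pow: "sym_class k (ball 0 \<rho> - {0}) norm (\<lambda>i x. norm x ^ (2 * N)) (\<lambda>(i::'i) (x::'a). \<Lambda> * (x \<bullet> x) ^ N)"
    by (simp add: power_mult power2_eq_square)
  have one: "sym_class k S l (\<lambda>_ _. 1) (\<lambda>(i::'i) (x::'a). 1::real)" for S and l :: "'a \<Rightarrow> real"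
    by (rule sym_class_const[where C=1]) simp
  have "sym_class k (ball 0 \<rho> - {0}) norm (\<lambda>_ _. 1) (\<lambda>(i::'i) (x::'a). \<Lambda> * (x \<bullet> x) ^ N)"
    by (rule sym_class_weaken[OF pow, where c="\<rho> ^ (2 * N)"]) (auto intro!: power_mono)
  from sym_class_add[OF open_S(2) one this]
  have "sym_class k (ball 0 \<rho> - {0}) norm (\<lambda>_ _. 1) (\<lambda>(i::'i) (x::'a). 1 + \<Lambda> * (x \<bullet> x) ^ N)" .
  from sym_class_inverse[OF open_S(2) zero_less_one this]
  show punct: "sym_class k (ball 0 \<rho> - {0}) norm (\<lambda>_ _. 1) (\<lambda>(i::'i) (x::'a). damping \<Lambda> N x)"
    using order_trans[OF ge1 abs_ge_self] by (simp add: damping_def)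
  have "sym_class k (ball 0 \<rho>) (\<lambda>_. 1) (\<lambda>(i::'i) _. 1) (\<lambda>i x::'a. x)"
    by (rule sym_class_ident[OF open_S(1), where C=\<rho>]) auto
  from sym_class_mult_const[OF open_S(1) sym_class_power[OF open_S(1) sym_class_inner[OF open_S(1) this this], where m=N], where c=\<Lambda>]
  have "unif_class k (ball 0 \<rho>) (\<lambda>(i::'i) (x::'a). \<Lambda> * (x \<bullet> x) ^ N)"
    by simp
  from sym_class_add[OF open_S(1) one this]
  have "unif_class k (ball 0 \<rho>) (\<lambda>(i::'i) (x::'a). 1 + \<Lambda> * (x \<bullet> x) ^ N)" .
  from sym_class_inverse[OF open_S(1) zero_less_one this]
  show "unif_class k (ball 0 \<rho>) (\<lambda>(i::'i) (x::'a). damping \<Lambda> N x)"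
    using order_trans[OF ge1 abs_ge_self] by (simp add: damping_def)
  from sym_class_mult[OF open_S(2) pow punct]
  show "sym_class k (ball 0 \<rho> - {0}) norm (\<lambda>i x. norm x ^ (2 * N)) (\<lambda>(i::'i) (x::'a). 1 - damping \<Lambda> N x)"
    by (simp add: one_minus_damping)
qed

end

lemma damping_small:
  assumes "\<kappa> > 0" "\<rho> > 0" "N > 0"
  shows "\<exists>\<Lambda>>0. \<forall>x\<in>ball (0::'a::euclidean_space) \<rho>. damping \<Lambda> N x * norm x \<le> \<kappa>"
proof -
  \<comment> \<open>Outside radius \<kappa> this makes \<Lambda> |x|^(2N) at least \<rho>/\<kappa>,
    so the damping factor is at most \<kappa>/\<rho>; inside, the trivial bound 1 is enough.\<close>
  define \<Lambda> where "\<Lambda> = \<rho> / (\<kappa> * \<kappa> ^ (2 * N))"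
  have \<Lambda>: "\<Lambda> > 0" using assms by (simp add: \<Lambda>_def)
  have "damping \<Lambda> N x * norm x \<le> \<kappa>" if x: "x \<in> ball (0::'a) \<rho>" for x
  proof (cases "norm x \<le> \<kappa>")
    case True
    then show ?thesis
      using mult_mono[OF damping_le_1[OF \<Lambda> assms(3)] True] by simp
  next
    case False
    then have "\<kappa> ^ (2 * N) \<le> norm x ^ (2 * N)"
      using assms(1) by (intro power_mono) auto
    then have "\<Lambda> * \<kappa> ^ (2 * N) \<le> \<Lambda> * (x \<bullet> x) ^ N"
      using \<Lambda> by (simp add: dot_square_norm power_mult)
    moreover have "\<Lambda> * \<kappa> ^ (2 * N) = \<rho> / \<kappa>"
      using assms by (simp add: \<Lambda>_def)
    ultimately have "\<rho> / \<kappa> \<le> 1 + \<Lambda> * (x \<bullet> x) ^ N" by linarith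
    then have "damping \<Lambda> N x \<le> inverse (\<rho> / \<kappa>)"
      unfolding damping_def using assms by (intro le_imp_inverse_le) auto
    then have "damping \<Lambda> N x * norm x \<le> inverse (\<rho> / \<kappa>) * \<rho>"
      using x assms by (intro mult_mono) auto
    then show ?thesis using assms by simp
  qed
  with \<Lambda> show ?thesis by blast
qed

text \<open>As \<open>e\<close> is O(|x|^2) and its derivative O(|x|), the damped map and its
  derivative are controlled by the damping factor times |x|. That product is uniformly small for
  large \<Lambda>, although \<open>e\<close> itself need not be small on the ball.\<close>

lemma damped_correction:
  fixes e :: "'i \<Rightarrow> 'a::euclidean_space \<Rightarrow> 'a"
  assumes "\<rho> > 0" "\<eta> > 0" "N > 0" "\<And>b. b \<in> Basis \<Longrightarrow> poly_order 2 (\<lambda>i x. e i x \<bullet> b)"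
  shows "\<exists>\<Lambda>>0. \<forall>i. \<forall>x\<in>ball 0 \<rho>. norm (damping \<Lambda> N x *\<^sub>R e i x) \<le> \<eta> * norm x \<and>
    (\<forall>v. norm (frechet_derivative (\<lambda>x. damping \<Lambda> N x *\<^sub>R e i x) (at x) v) \<le> \<eta> * norm v)"
proof -
  have open_S: "open (ball (0::'a) \<rho>)" "open (ball (0::'a) \<rho> - {0})" by auto
  have e: "sym_class k (ball 0 \<rho> - {0}) norm (\<lambda>i x. norm x ^ 2) e" for k
    by (subst sym_class_components[OF open_S(2)]) (use assms(4) poly_order_sym_class in blast)
  have e_ball: "unif_class k (ball 0 \<rho>) e" for k
    by (subst sym_class_components[OF open_S(1)]) (use assms(4) poly_order_sym_class in blast)
  obtain A where A: "A > 0" "\<And>i x. x \<in> ball 0 \<rho> - {0} \<Longrightarrow> norm (e i x) \<le> A * \<bar>norm x ^ 2\<bar>"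
    using sym_class_bound[OF e[of 0]] by blast
  obtain B where B: "B > 0" "\<And>i x v. x \<in> ball 0 \<rho> - {0} \<Longrightarrow>
      norm (frechet_derivative (e i) (at x) v) \<le> B * \<bar>norm x ^ 2 / norm x\<bar> * norm v"
    using sym_class_derivative_bound[OF e[of 1, unfolded One_nat_def]] by blast
  \<comment> \<open>\<open>A\<close> bounds the map, \<open>B\<close> its derivative, and
    \<open>2 * N * A\<close> the term in which the damping factor is differentiated; their sum
    serves both estimates.\<close>
  define \<kappa> where "\<kappa> = \<eta> / (A + 2 * N * A + B)"
  have "A + 2 * N * A + B > 0" using A(1) B(1) by (simp add: add_pos_nonneg)
  then have \<kappa>: "\<kappa> > 0" "(A + 2 * N * A + B) * \<kappa> = \<eta>" using assms(2) by (auto simp: \<kappa>_def)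
  obtain \<Lambda> where \<Lambda>: "\<Lambda> > 0" "\<And>x. x \<in> ball (0::'a) \<rho> \<Longrightarrow> damping \<Lambda> N x * norm x \<le> \<kappa>"
    using damping_small[OF \<kappa>(1) assms(1,3)] by blast
  let ?c = "damping \<Lambda> N :: 'a \<Rightarrow> real"
  let ?e = "\<lambda>i x. ?c x *\<^sub>R e i x"
  have punct: "sym_class k (ball 0 \<rho> - {0}) norm (\<lambda>i x. norm x * norm x) ?e" for k
    using sym_class_scaleR[OF open_S(2) sym_class_damping(1)[OF \<Lambda>(1) assms(3)] e] by (simp add: power2_eq_square)
  have "isCont (e i) 0" for i
    using sym_class_continuous[OF e_ball[of 0], of i] assms(1) by (simp add: continuous_on_eq_continuous_at)
  \<comment> \<open>The estimates hold on the punctured ball; the value at 0 follows by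
    continuity.\<close>
  have e0: "e i 0 = 0" for i
  proof -
    have "(e i \<longlongrightarrow> 0) (at 0)"
    proof (rule Lim_null_comparison)
      show "\<forall>\<^sub>F x in at 0. norm (e i x) \<le> A * norm x ^ 2"
        unfolding eventually_at using A(2)[of _ i] assms(1) by (intro exI[of _ \<rho>]) auto
      show "((\<lambda>x. A * norm x ^ 2) \<longlongrightarrow> 0) (at (0::'a))"
        by (auto intro!: tendsto_eq_intros)
    qed
    then show ?thesis
      using \<open>isCont (e i) 0\<close> LIM_unique unfolding isCont_def by blast
  qed
  have "(?e i has_derivative (\<lambda>_. 0)) (at 0)" for i
    by (rule sym_class_removable(2)[OF assms(1) modulus_ident, of ?e "Suc 0" i]) (use e0 punct in auto)
  then have d0: "frechet_derivative (?e i) (at 0) v = 0" for i v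
    using frechet_derivative_at by metis
  have "norm (?e i x) \<le> \<eta> * norm x \<and> (\<forall>v. norm (frechet_derivative (?e i) (at x) v) \<le> \<eta> * norm v)"
    if x: "x \<in> ball 0 \<rho>" for i x
  proof (cases "x = 0")
    case True
    then show ?thesis using e0 d0 assms(2) by simp
  next
    case False
    then have x': "x \<in> ball 0 \<rho> - {0}" using x by simp
    have c: "0 < ?c x" using damping_pos[OF \<Lambda>(1) assms(3)] .
    have "norm (?e i x) \<le> ?c x * (A * (norm x * norm x))"
      using A(2)[OF x', of i] c by (simp add: power2_eq_square)
    also have "\<dots> = A * (?c x * norm x) * norm x" by simp
    also have "\<dots> \<le> A * \<kappa> * norm x"
      using A(1) \<Lambda>(2)[OF x] by (intro mult_right_mono mult_left_mono) auto
    also have "\<dots> \<le> \<eta> * norm x"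
      using \<kappa> A(1) B(1) by (intro mult_right_mono) (auto simp flip: \<kappa>(2) intro!: mult_right_mono)
    finally have 1: "norm (?e i x) \<le> \<eta> * norm x" .
    have "norm (frechet_derivative (?e i) (at x) v) \<le> \<eta> * norm v" for v
    proof -
      define c' where "c' = - (?c x * (\<Lambda> * (real N * (2 * (x \<bullet> v)) * (x \<bullet> x) ^ (N - 1))) * ?c x)"
      have "(?e i has_derivative (\<lambda>v. ?c x *\<^sub>R frechet_derivative (e i) (at x) v
          + (- (?c x * (\<Lambda> * (real N * (2 * (x \<bullet> v)) * (x \<bullet> x) ^ (N - 1))) * ?c x)) *\<^sub>R e i x)) (at x)"
        by (rule has_derivative_scaleR[OF damping_has_derivative[OF \<Lambda>(1) assms(3)]
            sym_class_derivative[OF e_ball[of 1, unfolded One_nat_def] x]])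
      from fun_cong[OF frechet_derivative_at[OF this], of v]
      have "frechet_derivative (?e i) (at x) v = ?c x *\<^sub>R frechet_derivative (e i) (at x) v + c' *\<^sub>R e i x"
        unfolding c'_def by (rule sym)
      then have "norm (frechet_derivative (?e i) (at x) v)
          \<le> norm (?c x *\<^sub>R frechet_derivative (e i) (at x) v) + norm (c' *\<^sub>R e i x)"
        by (simp only: norm_triangle_ineq)
      also have "\<dots> \<le> ?c x * (B * norm x * norm v) + (\<bar>c'\<bar> * norm x) * (A * norm x)"
      proof (rule add_mono)
        show "norm (?c x *\<^sub>R frechet_derivative (e i) (at x) v) \<le> ?c x * (B * norm x * norm v)"
          using B(2)[OF x', of i v] c False by (simp add: power2_eq_square)
        have "\<bar>c'\<bar> * norm (e i x) \<le> \<bar>c'\<bar> * (A * (norm x * norm x))"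
          using A(2)[OF x', of i] by (intro mult_left_mono) (auto simp: power2_eq_square)
        then show "norm (c' *\<^sub>R e i x) \<le> (\<bar>c'\<bar> * norm x) * (A * norm x)" by (simp add: mult_ac)
      qed
      also have "\<bar>c'\<bar> * norm x \<le> 2 * N * ?c x * norm v"
        using damping_derivative_bound[OF \<Lambda>(1) assms(3), of x v] by (simp add: c'_def)
      then have "?c x * (B * norm x * norm v) + (\<bar>c'\<bar> * norm x) * (A * norm x)
          \<le> ?c x * (B * norm x * norm v) + (2 * N * ?c x * norm v) * (A * norm x)"
        using A(1) by (intro add_left_mono mult_right_mono) auto
      also have "\<dots> = (2 * N * A + B) * (?c x * norm x) * norm v" by (simp add: algebra_simps)
      also have "\<dots> \<le> (2 * N * A + B) * \<kappa> * norm v"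
        using A(1) B(1) \<Lambda>(2)[OF x] by (intro mult_right_mono mult_left_mono) auto
      also have "\<dots> \<le> \<eta> * norm v"
        using \<kappa> A(1) B(1) by (intro mult_right_mono) (auto simp flip: \<kappa>(2) intro!: mult_right_mono)
      finally show ?thesis .
    qed
    with 1 show ?thesis by blast
  qed
  with \<Lambda>(1) show ?thesis by blast
qed

subsection \<open>The flat remainder\<close>

declare sym_class.simps [simp del]

text \<open>With r the square root, \<gamma> \<tau> = (r - \<beta>) (r + \<beta>), so v \<tau> = r -
  \<beta>, which gives the equation. For the numbers, \<beta>^2 - 1/10 \<ge> 0.88 yields r \<ge>
  0.9, and 0.1 / 1.89 < 0.06.\<close>

lemma quadratic_root_estimate:
  fixes \<beta> \<gamma> \<tau> :: real
  assumes "99/100 \<le> \<beta>" "\<bar>\<tau>\<bar> \<le> 1" "\<bar>\<gamma>\<bar> \<le> 1/10"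
  defines "v \<equiv> \<gamma> * inverse (\<beta> + sqrt (\<beta>\<^sup>2 + \<gamma> * \<tau>))"
  shows "4/5 \<le> \<beta>\<^sup>2 + \<gamma> * \<tau>" "\<bar>v\<bar> \<le> 3/50" "v\<^sup>2 * \<tau> + 2 * \<beta> * v = \<gamma>"
proof -
  define r where "r = sqrt (\<beta>\<^sup>2 + \<gamma> * \<tau>)"
  have "\<bar>\<gamma> * \<tau>\<bar> \<le> 1/10 * 1"
    unfolding abs_mult using assms(2,3) by (intro mult_mono) auto
  moreover have "99/100 * (99/100) \<le> \<beta>\<^sup>2"
    unfolding power2_eq_square using assms(1) by (intro mult_mono) auto
  ultimately have ge: "88/100 \<le> \<beta>\<^sup>2 + \<gamma> * \<tau>"
    by linarith
  then show "4/5 \<le> \<beta>\<^sup>2 + \<gamma> * \<tau>" by simp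
  have "9/10 \<le> r"
  proof -
    have "(9/10)\<^sup>2 \<le> \<beta>\<^sup>2 + \<gamma> * \<tau>" using ge by (simp add: power_divide)
    then show ?thesis unfolding r_def by (rule real_le_rsqrt)
  qed
  then have d: "189/100 \<le> \<beta> + r" using assms(1) by simp
  have v: "v = \<gamma> / (\<beta> + r)" unfolding v_def r_def divide_inverse ..
  have "\<bar>v\<bar> = \<bar>\<gamma>\<bar> / (\<beta> + r)"
    using d by (simp add: v abs_divide)
  also have "\<dots> \<le> (1/10) / (189/100)"
    using assms(3) d by (intro frac_le) auto
  finally show "\<bar>v\<bar> \<le> 3/50" by simp
  have "r\<^sup>2 = \<beta>\<^sup>2 + \<gamma> * \<tau>" unfolding r_def using ge by simp
  then have "\<gamma> * \<tau> = (r - \<beta>) * (\<beta> + r)"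
    by (simp add: algebra_simps power2_eq_square)
  moreover have vg: "v * (\<beta> + r) = \<gamma>" using d by (simp add: v)
  ultimately have "(v * \<tau>) * (\<beta> + r) = (r - \<beta>) * (\<beta> + r)" by (simp add: mult_ac)
  then have "v * \<tau> = r - \<beta>" using d by simp
  then have "v * (v * \<tau>) + 2 * \<beta> * v = v * (r - \<beta>) + 2 * \<beta> * v" by simp
  also have "\<dots> = v * (\<beta> + r)" by (simp add: algebra_simps)
  finally have "v * (v * \<tau>) + 2 * \<beta> * v = v * (\<beta> + r)" .
  then show "v\<^sup>2 * \<tau> + 2 * \<beta> * v = \<gamma>" using vg by (simp add: power2_eq_square)
qed

context reflection_family
begin

lemma quadratic_form_has_derivative:
  assumes "(f has_derivative f') (at x)"
  shows "((\<lambda>x. D i (f x) \<bullet> f x) has_derivative (\<lambda>v. 2 * (D i (f x) \<bullet> f' v))) (at x)"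
proof -
  have "((\<lambda>x. D i (f x) \<bullet> f x) has_derivative (\<lambda>v. D i (f x) \<bullet> f' v + D i (f' v) \<bullet> f x)) (at x)"
    by (intro has_derivative_inner bounded_linear.has_derivative[OF bounded_linear_D] assms)
  moreover have "D i (f' v) \<bullet> f x = D i (f x) \<bullet> f' v" for v
    by (metis D_adjoint inner_commute)
  ultimately show ?thesis by simp
qed

text \<open>The defect splits into \<open>h\<close> minus its Taylor polynomial, the residual of the
  Newton iteration, and the effect of damping. With damping exponent N = n + 2 the last part
  vanishes to order 2 (n + 2), more than is needed.\<close>

lemma flat_remainder:
  fixes h :: "'i \<Rightarrow> 'a \<Rightarrow> real"
  assumes \<rho>: "\<rho> > 0" and h: "unif_class (n + 2) (ball 0 \<rho>) h"
    and h0: "\<And>i. h i 0 = 0" and dh0: "\<And>i v. frechet_derivative (h i) (at 0) v = 0"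
    and d2h: "\<And>i v w. frechet_derivative (\<lambda>y. frechet_derivative (h i) (at y) v) (at 0) w = 2 * (D i v \<bullet> w)"
    and "\<eta> > 0"
  shows "\<exists>\<epsilon> \<omega>. modulus \<rho> \<omega> \<and>
    unif_class (n + 2) (ball 0 \<rho>) \<epsilon> \<and>
    sym_class (n + 2) (ball 0 \<rho> - {0}) norm (\<lambda>i x. (norm x)\<^sup>2) \<epsilon> \<and>
    sym_class (n + 2) (ball 0 \<rho> - {0}) norm (\<lambda>i x. \<omega> i (norm x) * norm x ^ (n + 2))
      (\<lambda>i x. h i x - D i (x + \<epsilon> i x) \<bullet> (x + \<epsilon> i x)) \<and>
    (\<forall>i. \<forall>x\<in>ball 0 \<rho>. norm (\<epsilon> i x) \<le> \<eta> * norm x \<and>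
      (\<forall>v. norm (frechet_derivative (\<epsilon> i) (at x) v) \<le> \<eta> * norm v))"
proof -
  let ?S = "ball (0::'a) \<rho> - {0}" and ?k = "n + 2"
  have open_S: "open (ball (0::'a) \<rho>)" "open ?S" by auto
  have zero_in: "0 \<in> ball (0::'a) \<rho>" using \<rho> by simp
  obtain \<omega> where \<omega>: "modulus \<rho> \<omega>" and
    R: "sym_class ?k ?S norm (\<lambda>i x. \<omega> i (norm x) * norm x ^ ?k) (\<lambda>i x. h i x - taylor_poly ?k (h i) x)"
    using taylor_remainder[OF \<rho> h] by blast
  have "poly_order 3 (\<lambda>i x. taylor_poly ?k (h i) x - D i x \<bullet> x)"
    using poly_order_taylor_poly[OF zero_in h _ h0 dh0 d2h] by simp
  from quadratic_newton[OF this, of n] obtain e where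
    e: "\<And>b. b \<in> Basis \<Longrightarrow> poly_order 2 (\<lambda>i x. e i x \<bullet> b)" and
    e_res: "poly_order (n + 3) (\<lambda>i x. taylor_poly ?k (h i) x - D i (x + e i x) \<bullet> (x + e i x))"
    by blast
  have Npos: "?k > 0" by simp
  obtain \<Lambda> where \<Lambda>: "\<Lambda> > 0" and small: "\<And>i x. x \<in> ball 0 \<rho> \<Longrightarrow>
      norm (damping \<Lambda> ?k x *\<^sub>R e i x) \<le> \<eta> * norm x \<and>
    (\<forall>v. norm (frechet_derivative (\<lambda>x. damping \<Lambda> ?k x *\<^sub>R e i x) (at x) v) \<le> \<eta> * norm v)"
    using damped_correction[OF \<rho> \<open>\<eta> > 0\<close> Npos e] by blast
  let ?c = "damping \<Lambda> ?k :: 'a \<Rightarrow> real"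
  define \<epsilon> where "\<epsilon> i x = ?c x *\<^sub>R e i x" for i x
  note damp = sym_class_damping[OF \<Lambda> Npos, where ?'i='i and ?'a='a, of _ \<rho>]
  have e_sym: "sym_class j ?S norm (\<lambda>i x. (norm x)\<^sup>2) e" for j
    by (subst sym_class_components[OF open_S(2)]) (use e poly_order_sym_class in blast)
  have e_ball: "unif_class j (ball 0 \<rho>) e" for j
    by (subst sym_class_components[OF open_S(1)]) (use e poly_order_sym_class in blast)
  have \<epsilon>_ball: "unif_class ?k (ball 0 \<rho>) \<epsilon>"
    using sym_class_scaleR[OF open_S(1) damp(2) e_ball] by (simp add: \<epsilon>_def[abs_def])
  have \<epsilon>_sym: "sym_class ?k ?S norm (\<lambda>i x. (norm x)\<^sup>2) \<epsilon>"
    using sym_class_scaleR[OF open_S(2) damp(1) e_sym] by (simp add: \<epsilon>_def[abs_def])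
  \<comment> \<open>The summand \<open>r\<close> absorbs the errors of order n + 3, because
    |x|^(n+3) = |x| |x|^(n+2).\<close>
  define \<Omega> where "\<Omega> i r = \<omega> i r + r" for i r
  have \<Omega>: "modulus \<rho> \<Omega>"
    unfolding \<Omega>_def[abs_def] by (rule modulus_add[OF \<omega> modulus_ident])
  have \<omega>0: "0 \<le> \<omega> i (norm x)" if "x \<in> ?S" for i x
    using \<omega> that unfolding modulus_def by auto
  let ?W = "\<lambda>i (x::'a). \<Omega> i (norm x) * norm x ^ ?k"
  have W1: "\<bar>\<omega> i (norm x) * norm x ^ ?k\<bar> \<le> 1 * \<bar>?W i x\<bar>" if "x \<in> ?S" for i x
    using \<omega>0[OF that, of i] by (simp add: \<Omega>_def abs_mult mult_right_mono del: power_Suc)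
  have W2: "\<bar>norm x ^ (n + 3)\<bar> \<le> 1 * \<bar>?W i x\<bar>" if "x \<in> ?S" for i x
  proof -
    have "norm x ^ (n + 3) = norm x * norm x ^ ?k" by (simp add: numeral_eq_Suc)
    also have "\<dots> \<le> ?W i x" using \<omega>0[OF that, of i] by (intro mult_right_mono) (auto simp: \<Omega>_def)
    finally show ?thesis by simp
  qed
  have id_sym: "sym_class ?k ?S norm (\<lambda>i::'i. norm) (\<lambda>i x. x)"
    by (rule sym_class_ident[OF open_S(2), where C=1]) auto
  \<comment> \<open>With q x = D x \<bullet> x and c the damping factor, the function estimated here
    is q (x + e) - q (x + c e).\<close>
  have "sym_class ?k ?S norm (\<lambda>i x. norm x ^ (2 * ?k) * norm x)
      (\<lambda>i x. (1 - ?c x) * (2 * (D i x \<bullet> e i x) + (1 + ?c x) * (D i (e i x) \<bullet> e i x)))"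
  proof (intro sym_class_mult open_S damp(3) sym_class_add sym_class_mult_const)
    show "sym_class ?k ?S norm (\<lambda>i. norm) (\<lambda>i x. D i x \<bullet> e i x)"
      by (rule sym_class_weaken[OF sym_class_inner[OF open_S(2) sym_class_D[OF open_S(2) id_sym] e_sym], where c="\<rho>\<^sup>2"])
         (auto simp: abs_mult mult.commute[of "norm _"] intro!: mult_right_mono power_mono)
    have "sym_class ?k ?S norm (\<lambda>_ _. 1) (\<lambda>(i::'i) (x::'a). 1::real)"
      by (rule sym_class_const[where C=1]) simp
    from sym_class_add[OF open_S(2) this damp(1)]
    have "sym_class ?k ?S norm (\<lambda>i x. 1 * ((norm x)\<^sup>2 * (norm x)\<^sup>2)) (\<lambda>i x. (1 + ?c x) * (D i (e i x) \<bullet> e i x))"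
      by (intro sym_class_mult sym_class_inner sym_class_D open_S e_sym)
    then show "sym_class ?k ?S norm (\<lambda>i. norm) (\<lambda>i x. (1 + ?c x) * (D i (e i x) \<bullet> e i x))"
    proof (rule sym_class_weaken[where c="\<rho> ^ 3"])
      fix i :: 'i and x assume "x \<in> ?S"
      then have "norm x ^ 3 * norm x \<le> \<rho> ^ 3 * norm x"
        by (intro mult_right_mono power_mono) auto
      then show "\<bar>1 * ((norm x)\<^sup>2 * (norm x)\<^sup>2)\<bar> \<le> \<rho> ^ 3 * \<bar>norm x\<bar>"
        by (simp add: power2_eq_square power3_eq_cube mult_ac)
    qed
  qed
  then have "sym_class ?k ?S norm (\<lambda>i x. norm x ^ (n + 3))
      (\<lambda>i x. (1 - ?c x) * (2 * (D i x \<bullet> e i x) + (1 + ?c x) * (D i (e i x) \<bullet> e i x)))"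
  proof (rule sym_class_weaken[where c="\<rho> ^ (n + 2)"])
    fix i :: 'i and x assume "x \<in> ?S"
    then have "norm x ^ (n + 2) * norm x ^ (n + 3) \<le> \<rho> ^ (n + 2) * norm x ^ (n + 3)"
      by (intro mult_right_mono power_mono) auto
    moreover have "norm x ^ (2 * ?k) * norm x = norm x ^ (n + 2) * norm x ^ (n + 3)"
    proof -
      have "norm x ^ (2 * ?k) * norm x = norm x ^ (2 * ?k + 1)" by simp
      also have "2 * ?k + 1 = (n + 2) + (n + 3)" by simp
      finally show ?thesis unfolding power_add .
    qed
    ultimately have "norm x ^ (2 * ?k) * norm x \<le> \<rho> ^ (n + 2) * norm x ^ (n + 3)" by (simp only:)
    then show "\<bar>norm x ^ (2 * ?k) * norm x\<bar> \<le> \<rho> ^ (n + 2) * \<bar>norm x ^ (n + 3)\<bar>"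
      unfolding abs_mult power_abs abs_norm_cancel .
  qed
  then have "sym_class ?k ?S norm ?W
     (\<lambda>i x. (h i x - taylor_poly ?k (h i) x) + (taylor_poly ?k (h i) x - D i (x + e i x) \<bullet> (x + e i x))
       + (1 - ?c x) * (2 * (D i x \<bullet> e i x) + (1 + ?c x) * (D i (e i x) \<bullet> e i x)))"
    by (intro sym_class_add open_S sym_class_weaken[OF R W1] sym_class_weaken[OF poly_order_sym_class(1)[OF e_res] W2]
        sym_class_weaken[where W="\<lambda>i x. norm x ^ (n + 3)", OF _ W2])
  moreover have "(h i x - taylor_poly ?k (h i) x) + (taylor_poly ?k (h i) x - D i (x + e i x) \<bullet> (x + e i x))
       + (1 - ?c x) * (2 * (D i x \<bullet> e i x) + (1 + ?c x) * (D i (e i x) \<bullet> e i x))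
      = h i x - D i (x + \<epsilon> i x) \<bullet> (x + \<epsilon> i x)" for i x
  proof -
    have "D i (e i x) \<bullet> x = D i x \<bullet> e i x" by (metis D_adjoint inner_commute)
    then show ?thesis
      unfolding \<epsilon>_def by (simp add: D_simps inner_add_left inner_add_right algebra_simps)
  qed
  ultimately have "sym_class ?k ?S norm ?W (\<lambda>i x. h i x - D i (x + \<epsilon> i x) \<bullet> (x + \<epsilon> i x))" by (simp only:)
  moreover have "\<forall>i. \<forall>x\<in>ball 0 \<rho>. norm (\<epsilon> i x) \<le> \<eta> * norm x \<and>
      (\<forall>v. norm (frechet_derivative (\<epsilon> i) (at x) v) \<le> \<eta> * norm v)"
    unfolding \<epsilon>_def using small by simp
  ultimately show ?thesis
    using \<Omega> \<epsilon>_ball \<epsilon>_sym by (intro exI[of _ \<epsilon>] exI[of _ \<Omega>] conjI)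
qed

end

subsection \<open>The normal form\<close>

context reflection_family
begin

text \<open>Symbol classes give the smoothness of the flat correction but no usable number for its
  C^1 size, since their constants are unknown. The numerical bound is obtained separately, by
  differentiating implicitly the quadratic equation that the coefficient \<open>u\<close>
  solves.\<close>

lemma normal_form_map:
  fixes h :: "'i \<Rightarrow> 'a \<Rightarrow> real"
  assumes \<rho>: "\<rho> > 0" and h: "unif_class (n + 2) (ball 0 \<rho>) h"
    and h0: "\<And>i. h i 0 = 0" and dh0: "\<And>i v. frechet_derivative (h i) (at 0) v = 0"
    and d2h: "\<And>i v w. frechet_derivative (\<lambda>y. frechet_derivative (h i) (at y) v) (at 0) w = 2 * (D i v \<bullet> w)"
    and near: "\<And>i x v. x \<in> ball 0 \<rho> \<Longrightarrow>
      \<bar>frechet_derivative (h i) (at x) v - 2 * (D i x \<bullet> v)\<bar> \<le> norm x * norm v / 20"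
  shows "\<exists>\<Xi>. unif_class (n + 1) (ball 0 \<rho>) \<Xi> \<and>
    (\<forall>i. \<Xi> i 0 = 0 \<and> (\<forall>x\<in>ball 0 \<rho>. D i (\<Xi> i x) \<bullet> \<Xi> i x = h i x \<and>
      (\<forall>v. norm (frechet_derivative (\<Xi> i) (at x) v - v) \<le> norm v / 2)))"
proof -
  let ?S = "ball (0::'a) \<rho> - {0}" and ?k = "n + 2"
  have open_S: "open (ball (0::'a) \<rho>)" "open ?S" by auto
  obtain \<epsilon> \<omega> where \<omega>: "modulus \<rho> \<omega>" and
    \<epsilon>_ball: "unif_class ?k (ball 0 \<rho>) \<epsilon>" and
    \<epsilon>_sym: "sym_class ?k ?S norm (\<lambda>i x. (norm x)\<^sup>2) \<epsilon>" and
    g_sym: "sym_class ?k ?S norm (\<lambda>i x. \<omega> i (norm x) * norm x ^ ?k)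
      (\<lambda>i x. h i x - D i (x + \<epsilon> i x) \<bullet> (x + \<epsilon> i x))" and
    \<epsilon>: "\<And>i x. x \<in> ball 0 \<rho> \<Longrightarrow> norm (\<epsilon> i x) \<le> 1/100 * norm x"
      "\<And>i x v. x \<in> ball 0 \<rho> \<Longrightarrow> norm (frechet_derivative (\<epsilon> i) (at x) v) \<le> 1/100 * norm v"
    using flat_remainder[OF \<rho> h h0 dh0 d2h, of "1/100"] by auto
  define \<psi> where "\<psi> i x = x + \<epsilon> i x" for i x
  define g where "g i x = h i x - D i (\<psi> i x) \<bullet> \<psi> i x" for i x
  have g_sym: "sym_class ?k ?S norm (\<lambda>i x. \<omega> i (norm x) * norm x ^ ?k) g"
    using g_sym unfolding g_def[abs_def] \<psi>_def .
  let ?\<psi>' = "\<lambda>i x v. v + frechet_derivative (\<epsilon> i) (at x) v"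
  have \<psi>_deriv: "(\<psi> i has_derivative ?\<psi>' i x) (at x)" if "x \<in> ball 0 \<rho>" for i x
    unfolding \<psi>_def[abs_def]
    by (intro has_derivative_add has_derivative_ident sym_class_derivative[OF \<epsilon>_ball[unfolded add_2_eq_Suc'] that])
  have \<psi>_norm: "norm (\<psi> i x) \<le> 101/100 * norm x" if "x \<in> ball 0 \<rho>" for i x
    unfolding \<psi>_def using norm_triangle_ineq[of x "\<epsilon> i x"] \<epsilon>(1)[OF that, of i] by simp
  have \<psi>'_norm: "norm (?\<psi>' i x v) \<le> 101/100 * norm v" if "x \<in> ball 0 \<rho>" for i x v
    using norm_triangle_ineq[of v "frechet_derivative (\<epsilon> i) (at x) v"] \<epsilon>(2)[OF that, of i v] by simp
  let ?g' = "\<lambda>i x v. frechet_derivative (h i) (at x) v - 2 * (D i (\<psi> i x) \<bullet> ?\<psi>' i x v)"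
  have g_deriv: "(g i has_derivative ?g' i x) (at x)" if "x \<in> ball 0 \<rho>" for i x
    unfolding g_def[abs_def]
    by (intro has_derivative_diff sym_class_derivative[OF h[unfolded add_2_eq_Suc'] that]
        quadratic_form_has_derivative \<psi>_deriv[OF that])
  \<comment> \<open>The three contributions are 1/20, 2/100 and 2 * 101/10000, with sum below
    1/10.\<close>
  have g'_bound: "\<bar>?g' i x v\<bar> \<le> 1/10 * norm x * norm v" if x: "x \<in> ball 0 \<rho>" for i x v
  proof -
    let ?d = "frechet_derivative (\<epsilon> i) (at x) v"
    have "?g' i x v = (frechet_derivative (h i) (at x) v - 2 * (D i x \<bullet> v))
       - 2 * (D i (\<epsilon> i x) \<bullet> v) - 2 * (D i (\<psi> i x) \<bullet> ?d)"
      by (simp add: \<psi>_def D_simps inner_add_left inner_add_right algebra_simps)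
    moreover have "\<bar>D i (\<epsilon> i x) \<bullet> v\<bar> \<le> 1/100 * (norm x * norm v)"
      using Cauchy_Schwarz_ineq2[of "D i (\<epsilon> i x)" v] mult_right_mono[OF \<epsilon>(1)[OF x, of i] norm_ge_zero[of v]]
      by simp
    moreover have "\<bar>D i (\<psi> i x) \<bullet> ?d\<bar> \<le> 101/10000 * (norm x * norm v)"
      using Cauchy_Schwarz_ineq2[of "D i (\<psi> i x)" ?d]
        mult_mono[OF \<psi>_norm[OF x, of i] \<epsilon>(2)[OF x, of i v]] by simp
    moreover have "\<bar>frechet_derivative (h i) (at x) v - 2 * (D i x \<bullet> v)\<bar> \<le> 1/20 * (norm x * norm v)"
      using near[OF x, of i v] by simp
    moreover have "0 \<le> norm x * norm v" by simp
    ultimately show ?thesis unfolding mult.assoc by linarith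
  qed
  have \<epsilon>0: "\<epsilon> i 0 = 0" for i
    using \<epsilon>(1)[of 0 i] \<rho> by simp
  have g_bound: "\<bar>g i x\<bar> \<le> 1/10 * (norm x)\<^sup>2" if x: "x \<in> ball 0 \<rho>" for i x
  proof -
    have in_ball: "y \<in> ball 0 \<rho>" if "y \<in> cball 0 (norm x)" for y using x that by auto
    have "norm (g i x - g i 0) \<le> (1/10 * norm x) * norm x"
    proof (rule derivative_bound_from_0)
      fix y :: 'a assume y: "y \<in> cball 0 (norm x)"
      show "(g i has_derivative ?g' i y) (at y)" by (rule g_deriv[OF in_ball[OF y]])
      fix v :: 'a
      have "1/10 * norm y * norm v \<le> 1/10 * norm x * norm v"
        using y by (intro mult_right_mono) auto
      then show "norm (?g' i y v) \<le> (1/10 * norm x) * norm v"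
        using g'_bound[OF in_ball[OF y], of i v] by simp
    qed
    moreover have "g i 0 = 0" using h0 \<epsilon>0 by (simp add: g_def \<psi>_def)
    ultimately show ?thesis by (simp add: power2_eq_square)
  qed

  \<comment> \<open>Since D is an involution, moving \<psi> x by u D x changes the quadratic form by
    2 u (\<psi> x \<bullet> x) + u^2 (D x \<bullet> x), which has to equal g x. Division by |x|^2
    gives the bounded coefficients 2 \<beta> and \<tau> and the right-hand side \<gamma>.\<close>
  define I where "I x = inverse (x \<bullet> x)" for x :: 'a
  define \<beta> where "\<beta> i x = 1 + (\<epsilon> i x \<bullet> x) * I x" for i x
  define \<tau> where "\<tau> i x = (D i x \<bullet> x) * I x" for i x
  define \<gamma> where "\<gamma> i x = g i x * I x" for i x
  \<comment> \<open>The small root of \<open>\<tau> * v\<^sup>2 + 2 * \<beta> * v = \<gamma>\<close>, in the form that also makes sense where \<open>\<tau> = 0\<close>.\<close>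
  define u where "u i x = \<gamma> i x * inverse (\<beta> i x + sqrt ((\<beta> i x)\<^sup>2 + \<gamma> i x * \<tau> i x))" for i x
  have I: "I x * (norm x)\<^sup>2 = 1" "I x > 0" if "x \<noteq> 0" for x :: 'a
    using that by (simp_all add: I_def dot_square_norm)
  have mult_I: "\<bar>a * I x\<bar> \<le> c" if "\<bar>a\<bar> \<le> c * (norm x)\<^sup>2" "x \<noteq> 0" for a c and x :: 'a
  proof -
    have "\<bar>a * I x\<bar> \<le> (c * (norm x)\<^sup>2) * I x"
      unfolding abs_mult using I(2)[OF that(2)] that(1) by (intro mult_mono) auto
    also have "\<dots> = c" using I(1)[OF that(2)] by (simp add: mult_ac)
    finally show ?thesis .
  qed
  have \<beta>_ge: "99/100 \<le> \<beta> i x" if "x \<in> ?S" for i x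
  proof -
    have "\<bar>\<epsilon> i x \<bullet> x\<bar> \<le> (1/100 * norm x) * norm x"
      by (rule order_trans[OF Cauchy_Schwarz_ineq2 mult_right_mono[OF \<epsilon>(1)[OF DiffD1[OF that]] norm_ge_zero]])
    then have "\<bar>(\<epsilon> i x \<bullet> x) * I x\<bar> \<le> 1/100"
      using that by (intro mult_I) (auto simp: power2_eq_square)
    then show ?thesis unfolding \<beta>_def by linarith
  qed
  have \<tau>_le: "\<bar>\<tau> i x\<bar> \<le> 1" if "x \<in> ?S" for i x
    unfolding \<tau>_def using Cauchy_Schwarz_ineq2[of "D i x" x] that
    by (intro mult_I) (auto simp: power2_eq_square)
  have \<gamma>_le: "\<bar>\<gamma> i x\<bar> \<le> 1/10" if "x \<in> ?S" for i x
    unfolding \<gamma>_def using g_bound[of x i] that by (intro mult_I) auto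
  note est = quadratic_root_estimate[OF \<beta>_ge \<tau>_le \<gamma>_le]
  have root: "4/5 \<le> (\<beta> i x)\<^sup>2 + \<gamma> i x * \<tau> i x" if "x \<in> ?S" for i x
    by (rule est(1)[OF that that that])
  have u_le: "\<bar>u i x\<bar> \<le> 3/50" if "x \<in> ?S" for i x
    unfolding u_def by (rule est(2)[OF that that that])
  have u_root: "(u i x)\<^sup>2 * \<tau> i x + 2 * \<beta> i x * u i x = \<gamma> i x" if "x \<in> ?S" for i x
    unfolding u_def by (rule est(3)[OF that that that])

  have id_sym: "sym_class ?k ?S norm (\<lambda>i::'i. norm) (\<lambda>i x. x)"
    by (rule sym_class_ident[OF open_S(2), where C=1]) auto
  have one: "sym_class ?k ?S norm (\<lambda>_ _. 1) (\<lambda>(i::'i) (x::'a). 1::real)"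
    by (rule sym_class_const[where C=1]) simp
  have I_sym: "sym_class ?k ?S norm (\<lambda>i x. inverse (norm x * norm x)) (\<lambda>(i::'i) x. I x)"
    unfolding I_def
    by (rule sym_class_inverse[OF open_S(2) zero_less_one sym_class_inner[OF open_S(2) id_sym id_sym]])
       (auto simp: dot_square_norm power2_eq_square)
  have bounded: "sym_class ?k ?S norm (\<lambda>_ _. 1) F"
    if "sym_class ?k ?S norm (\<lambda>i x. norm x ^ j * (norm x)\<^sup>2 * inverse (norm x * norm x)) F"
    for j and F :: "'i \<Rightarrow> 'a \<Rightarrow> real"
  proof (rule sym_class_weaken[OF that, where c="\<rho> ^ j"])
    fix i :: 'i and x :: 'a assume x: "x \<in> ?S"
    then have eq: "norm x ^ j * (norm x)\<^sup>2 * inverse (norm x * norm x) = norm x ^ j"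
      by (simp add: power2_eq_square field_simps)
    show "\<bar>norm x ^ j * (norm x)\<^sup>2 * inverse (norm x * norm x)\<bar> \<le> \<rho> ^ j * \<bar>1\<bar>"
      unfolding eq using x by (simp add: power_mono)
  qed
  have \<beta>_sym: "sym_class ?k ?S norm (\<lambda>_ _. 1) \<beta>"
  proof -
    have "sym_class ?k ?S norm (\<lambda>i x. norm x ^ 1 * (norm x)\<^sup>2 * inverse (norm x * norm x)) (\<lambda>i x. (\<epsilon> i x \<bullet> x) * I x)"
      using sym_class_mult[OF open_S(2) sym_class_inner[OF open_S(2) \<epsilon>_sym id_sym] I_sym] by (simp add: mult.commute)
    from sym_class_add[OF open_S(2) one bounded[OF this]] show ?thesis
      by (simp add: \<beta>_def[abs_def])
  qed
  have \<tau>_sym: "sym_class ?k ?S norm (\<lambda>_ _. 1) \<tau>"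
  proof -
    have "sym_class ?k ?S norm (\<lambda>i x. norm x ^ 0 * (norm x)\<^sup>2 * inverse (norm x * norm x)) (\<lambda>i x. (D i x \<bullet> x) * I x)"
      using sym_class_mult[OF open_S(2) sym_class_inner[OF open_S(2) sym_class_D[OF open_S(2) id_sym] id_sym] I_sym]
      by (simp add: power2_eq_square)
    from bounded[OF this] show ?thesis by (simp add: \<tau>_def[abs_def])
  qed
  have \<gamma>_sym: "sym_class ?k ?S norm (\<lambda>i x. \<omega> i (norm x) * norm x ^ n) \<gamma>"
  proof (rule sym_class_weaken[where c=1])
    show "sym_class ?k ?S norm (\<lambda>i x. (\<omega> i (norm x) * norm x ^ ?k) * inverse (norm x * norm x)) \<gamma>"
      using sym_class_mult[OF open_S(2) g_sym I_sym] by (simp add: \<gamma>_def[abs_def])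
    show "\<bar>(\<omega> i (norm x) * norm x ^ ?k) * inverse (norm x * norm x)\<bar> \<le> 1 * \<bar>\<omega> i (norm x) * norm x ^ n\<bar>"
      if "x \<in> ?S" for i x
    proof -
      have "(\<omega> i (norm x) * norm x ^ ?k) * inverse (norm x * norm x) = \<omega> i (norm x) * norm x ^ n"
        using that by (simp add: field_simps)
      then show ?thesis by (simp only: mult_1 order_refl)
    qed
  qed
  obtain A where A: "\<And>i r. 0 \<le> r \<Longrightarrow> r < \<rho> \<Longrightarrow> 0 \<le> \<omega> i r \<and> \<omega> i r \<le> A"
    using \<omega> unfolding modulus_def by blast
  \<comment> \<open>Under the square root only boundedness of \<gamma> matters, so its decay is
    given up there and kept for the factor in front.\<close>
  have \<gamma>_bdd: "sym_class ?k ?S norm (\<lambda>_ _. 1) \<gamma>"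
  proof (rule sym_class_weaken[OF \<gamma>_sym, where c="A * \<rho> ^ n"])
    fix i and x :: 'a assume "x \<in> ?S"
    then show "\<bar>\<omega> i (norm x) * norm x ^ n\<bar> \<le> A * \<rho> ^ n * \<bar>1\<bar>"
      using A[of "norm x" i] by (auto simp: abs_mult intro!: mult_mono power_mono)
  qed
  have "sym_class ?k ?S norm (\<lambda>_ _. 1) (\<lambda>i x. (\<beta> i x)\<^sup>2 + \<gamma> i x * \<tau> i x)"
    using sym_class_add[OF open_S(2) sym_class_power[OF open_S(2) \<beta>_sym, where m=2, simplified]
        sym_class_mult[OF open_S(2) \<gamma>_bdd \<tau>_sym, simplified]] by simp
  from sym_class_sqrt[OF open_S(2) _ this root, simplified]
  have sqrt_sym: "sym_class ?k ?S norm (\<lambda>_ _. 1) (\<lambda>i x. sqrt ((\<beta> i x)\<^sup>2 + \<gamma> i x * \<tau> i x))"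
    by simp
  have "sym_class ?k ?S norm (\<lambda>_ _. inverse 1) (\<lambda>i x. inverse (\<beta> i x + sqrt ((\<beta> i x)\<^sup>2 + \<gamma> i x * \<tau> i x)))"
  proof (rule sym_class_inverse[OF open_S(2), where c="99/100"])
    show "sym_class ?k ?S norm (\<lambda>_ _. 1) (\<lambda>i x. \<beta> i x + sqrt ((\<beta> i x)\<^sup>2 + \<gamma> i x * \<tau> i x))"
      by (rule sym_class_add[OF open_S(2) \<beta>_sym sqrt_sym])
    fix i and x :: 'a assume x: "x \<in> ?S"
    have "0 \<le> sqrt ((\<beta> i x)\<^sup>2 + \<gamma> i x * \<tau> i x)" using root[OF x, of i] by simp
    then show "99/100 * \<bar>1\<bar> \<le> \<bar>\<beta> i x + sqrt ((\<beta> i x)\<^sup>2 + \<gamma> i x * \<tau> i x)\<bar>"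
      using \<beta>_ge[OF x, of i] by linarith
  qed simp_all
  from sym_class_mult[OF open_S(2) \<gamma>_sym this]
  have u_sym: "sym_class ?k ?S norm (\<lambda>i x. \<omega> i (norm x) * norm x ^ n) u"
    by (simp add: u_def[abs_def])
  \<comment> \<open>The factor D x raises the order of flatness from n to n + 1, and this is the
    number of derivatives that survive at 0.\<close>
  define w where "w i x = u i x *\<^sub>R D i x" for i x
  have w0: "w i 0 = 0" for i
    by (simp add: w_def linear_0[OF linear_D])
  have "sym_class ?k ?S norm (\<lambda>i x. \<omega> i (norm x) * norm x ^ (n + 1)) w"
    using sym_class_scaleR[OF open_S(2) u_sym sym_class_D[OF open_S(2) id_sym]]
    by (simp add: w_def[abs_def] mult_ac)
  then have w_sym: "sym_class (n + 1) ?S norm (\<lambda>i x. \<omega> i (norm x) * norm x ^ (n + 1)) w"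
    by (rule sym_class_antimono) simp
  have w_ball: "unif_class (n + 1) (ball 0 \<rho>) w"
    by (rule sym_class_removable(1)[OF \<rho> \<omega> w0 w_sym])
  have w_deriv0: "(w i has_derivative (\<lambda>_. 0)) (at 0)" for i
    by (rule sym_class_removable(2)[OF \<rho> \<omega> w0 w_sym]) simp

  have u_eq: "2 * u i x * (\<psi> i x \<bullet> x) + (u i x)\<^sup>2 * (D i x \<bullet> x) = g i x" if x: "x \<in> ?S" for i x
  proof -
    have nz: "x \<noteq> 0" using x by simp
    have scale: "(a * I x) * (norm x)\<^sup>2 = a" for a using I(1)[OF nz] by simp
    have "\<psi> i x \<bullet> x = \<beta> i x * (norm x)\<^sup>2"
      using scale[of "\<epsilon> i x \<bullet> x"]
      by (simp add: \<psi>_def \<beta>_def inner_add_left distrib_right dot_square_norm)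
    moreover have "D i x \<bullet> x = \<tau> i x * (norm x)\<^sup>2" "g i x = \<gamma> i x * (norm x)\<^sup>2"
      using scale by (simp_all add: \<tau>_def \<gamma>_def)
    moreover have "(u i x)\<^sup>2 * \<tau> i x + 2 * \<beta> i x * u i x = \<gamma> i x"
      by (rule u_root[OF x])
    then have "((u i x)\<^sup>2 * \<tau> i x + 2 * \<beta> i x * u i x) * (norm x)\<^sup>2 = \<gamma> i x * (norm x)\<^sup>2" by simp
    ultimately show ?thesis by (simp add: algebra_simps)
  qed

  \<comment> \<open>Differentiating \<open>u_eq\<close> expresses the derivative of \<open>u\<close>
    as a quotient whose denominator is at least 1.86 |x|^2, where 1.86 = 2 * 0.99 - 2 *
    0.06.\<close>
  have w'_bound: "norm (frechet_derivative (w i) (at x) v) \<le> 1/4 * norm v" if x: "x \<in> ball 0 \<rho>" for i x v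
  proof (cases "x = 0")
    case True
    then show ?thesis using fun_cong[OF frechet_derivative_at[OF w_deriv0[of i]], of v] by simp
  next
    case False
    then have xS: "x \<in> ?S" using x by simp
    let ?u' = "frechet_derivative (u i) (at x) v"
    have du: "(u i has_derivative frechet_derivative (u i) (at x)) (at x)"
      by (rule sym_class_derivative[OF u_sym[unfolded add_2_eq_Suc'] xS])
    have dD: "(D i has_derivative D i) (at x)"
      using bounded_linear_imp_has_derivative[OF bounded_linear_D] .
    have dq: "((\<lambda>x. D i x \<bullet> x) has_derivative (\<lambda>v. 2 * (D i x \<bullet> v))) (at x)"
      by (rule quadratic_form_has_derivative[OF has_derivative_ident])
    have "((\<lambda>x. 2 * u i x * (\<psi> i x \<bullet> x) + (u i x)\<^sup>2 * (D i x \<bullet> x)) has_derivative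
        (\<lambda>v. (2 * u i x) * (\<psi> i x \<bullet> v + ?\<psi>' i x v \<bullet> x) + (2 * frechet_derivative (u i) (at x) v) * (\<psi> i x \<bullet> x)
          + ((u i x)\<^sup>2 * (2 * (D i x \<bullet> v)) + (real 2 * frechet_derivative (u i) (at x) v * u i x ^ (2 - 1)) * (D i x \<bullet> x)))) (at x)"
      by (intro has_derivative_add has_derivative_mult has_derivative_mult_right has_derivative_inner
          has_derivative_power du dq \<psi>_deriv[OF x] has_derivative_ident)
    moreover have "((\<lambda>x. 2 * u i x * (\<psi> i x \<bullet> x) + (u i x)\<^sup>2 * (D i x \<bullet> x)) has_derivative ?g' i x) (at x)"
      by (rule has_derivative_transform_within_open[OF g_deriv[OF x] open_S(2) xS]) (simp add: u_eq)
    ultimately have "(\<lambda>v. (2 * u i x) * (\<psi> i x \<bullet> v + ?\<psi>' i x v \<bullet> x) + (2 * frechet_derivative (u i) (at x) v) * (\<psi> i x \<bullet> x)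
          + ((u i x)\<^sup>2 * (2 * (D i x \<bullet> v)) + (real 2 * frechet_derivative (u i) (at x) v * u i x ^ (2 - 1)) * (D i x \<bullet> x))) = ?g' i x"
      by (rule has_derivative_unique)
    from fun_cong[OF this, of v]
    have eq: "?u' * (2 * (\<psi> i x \<bullet> x) + 2 * u i x * (D i x \<bullet> x)) =
       ?g' i x v - 2 * (u i x * (\<psi> i x \<bullet> v + ?\<psi>' i x v \<bullet> x)) - 2 * ((u i x)\<^sup>2 * (D i x \<bullet> v))"
      by (simp add: algebra_simps)
    have u: "\<bar>u i x\<bar> \<le> 3/50" by (rule u_le[OF xS])
    have "(99/100) * (norm x)\<^sup>2 \<le> \<psi> i x \<bullet> x"
    proof -
      have "\<bar>\<epsilon> i x \<bullet> x\<bar> \<le> (1/100 * norm x) * norm x"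
        by (rule order_trans[OF Cauchy_Schwarz_ineq2 mult_right_mono[OF \<epsilon>(1)[OF x] norm_ge_zero]])
      then show ?thesis
        by (simp add: \<psi>_def inner_add_left dot_square_norm power2_eq_square abs_le_iff)
    qed
    moreover have "\<bar>u i x * (D i x \<bullet> x)\<bar> \<le> 3/50 * (norm x)\<^sup>2"
      unfolding abs_mult using u Cauchy_Schwarz_ineq2[of "D i x" x]
      by (intro mult_mono) (auto simp: power2_eq_square)
    ultimately have lower: "186/100 * (norm x)\<^sup>2 \<le> 2 * (\<psi> i x \<bullet> x) + 2 * u i x * (D i x \<bullet> x)"
      by (simp add: abs_le_iff)
    \<comment> \<open>0.1 + 2 * 0.06 * 2.02 + 2 * 0.0036 = 0.3496. Below, 0.35 / 1.86 < 0.19, and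
      the two terms of the derivative of \<open>w\<close> add up to 0.06 + 0.19 = 1/4.\<close>
    have sum3: "\<bar>a - 2 * b - 2 * c\<bar> \<le> 35/100 * p"
      if "\<bar>a\<bar> \<le> 1/10 * p" "\<bar>b\<bar> \<le> 3/50 * (202/100 * p)" "\<bar>c\<bar> \<le> 9/2500 * p" "0 \<le> p" for a b c p :: real
      using that by linarith
    have "\<bar>u i x * (\<psi> i x \<bullet> v + ?\<psi>' i x v \<bullet> x)\<bar> \<le> 3/50 * (202/100 * (norm x * norm v))"
    proof -
      have "\<bar>\<psi> i x \<bullet> v\<bar> \<le> 101/100 * norm x * norm v"
        by (rule order_trans[OF Cauchy_Schwarz_ineq2 mult_right_mono[OF \<psi>_norm[OF x] norm_ge_zero]])
      moreover have "\<bar>?\<psi>' i x v \<bullet> x\<bar> \<le> 101/100 * norm v * norm x"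
        by (rule order_trans[OF Cauchy_Schwarz_ineq2 mult_right_mono[OF \<psi>'_norm[OF x] norm_ge_zero]])
      ultimately have "\<bar>\<psi> i x \<bullet> v + ?\<psi>' i x v \<bullet> x\<bar> \<le> 202/100 * (norm x * norm v)"
        unfolding mult.assoc mult.commute[of "norm v" "norm x"] by linarith
      then show ?thesis unfolding abs_mult[of "u i x"] using u by (intro mult_mono) auto
    qed
    moreover have "\<bar>(u i x)\<^sup>2 * (D i x \<bullet> v)\<bar> \<le> 9/2500 * (norm x * norm v)"
    proof -
      have "(u i x)\<^sup>2 \<le> (3/50)\<^sup>2" using u by (simp add: abs_le_square_iff[symmetric])
      then show ?thesis unfolding abs_mult using Cauchy_Schwarz_ineq2[of "D i x" v]
        by (intro mult_mono) (auto simp: power2_eq_square)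
    qed
    ultimately have "\<bar>?u' * (2 * (\<psi> i x \<bullet> x) + 2 * u i x * (D i x \<bullet> x))\<bar> \<le> 35/100 * (norm x * norm v)"
      unfolding eq using g'_bound[OF x, of i v] by (intro sum3) (simp_all only: mult.assoc mult_nonneg_nonneg norm_ge_zero)
    moreover have "\<bar>?u'\<bar> * (186/100 * (norm x)\<^sup>2) \<le> \<bar>?u' * (2 * (\<psi> i x \<bullet> x) + 2 * u i x * (D i x \<bullet> x))\<bar>"
      unfolding abs_mult by (intro mult_left_mono order_trans[OF lower abs_ge_self]) simp
    ultimately have "(\<bar>?u'\<bar> * norm x * (186/100)) * norm x \<le> (35/100 * norm v) * norm x"
      by (simp add: power2_eq_square mult_ac)
    then have "\<bar>?u'\<bar> * norm x * (186/100) \<le> 35/100 * norm v"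
      by (rule mult_right_le_imp_le) (use False in simp)
    then have u': "\<bar>?u'\<bar> * norm x \<le> 19/100 * norm v"
      using norm_ge_zero[of v] by linarith
    have "(w i has_derivative (\<lambda>v. u i x *\<^sub>R D i v + frechet_derivative (u i) (at x) v *\<^sub>R D i x)) (at x)"
      unfolding w_def[abs_def] by (rule has_derivative_scaleR[OF du dD])
    from fun_cong[OF frechet_derivative_at[OF this], of v]
    have "frechet_derivative (w i) (at x) v = u i x *\<^sub>R D i v + ?u' *\<^sub>R D i x" by (rule sym)
    then have "norm (frechet_derivative (w i) (at x) v) \<le> \<bar>u i x\<bar> * norm v + \<bar>?u'\<bar> * norm x"
      using norm_triangle_ineq[of "u i x *\<^sub>R D i v" "?u' *\<^sub>R D i x"] by simp
    also have "\<dots> \<le> 3/50 * norm v + 19/100 * norm v"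
      using u u' by (intro add_mono mult_right_mono) auto
    finally show ?thesis by simp
  qed

  define \<Xi> where "\<Xi> i x = \<psi> i x + w i x" for i x
  have "unif_class (n + 1) (ball 0 \<rho>) \<Xi>"
  proof -
    have "sym_class (n + 1) (ball 0 \<rho>) (\<lambda>_. 1) (\<lambda>(i::'i) _. 1) (\<lambda>i x::'a. x)"
      by (rule sym_class_ident[OF open_S(1), where C=\<rho>]) auto
    from sym_class_add[OF open_S(1) sym_class_add[OF open_S(1) this sym_class_antimono[OF \<epsilon>_ball]] w_ball]
    show ?thesis by (simp add: \<Xi>_def[abs_def] \<psi>_def)
  qed
  moreover have "\<Xi> i 0 = 0" for i
    by (simp add: \<Xi>_def \<psi>_def \<epsilon>0 w0)
  moreover have "D i (\<Xi> i x) \<bullet> \<Xi> i x = h i x" if x: "x \<in> ball 0 \<rho>" for i x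
  proof (cases "x = 0")
    case True
    then show ?thesis by (simp add: \<Xi>_def \<psi>_def \<epsilon>0 w0 h0)
  next
    case False
    then have xS: "x \<in> ?S" using x by simp
    have "D i (\<psi> i x) \<bullet> D i x = \<psi> i x \<bullet> x" "x \<bullet> D i x = D i x \<bullet> x" "x \<bullet> \<psi> i x = \<psi> i x \<bullet> x"
      by (simp_all add: inner_commute)
    then have "D i (\<Xi> i x) \<bullet> \<Xi> i x
        = D i (\<psi> i x) \<bullet> \<psi> i x + (2 * u i x * (\<psi> i x \<bullet> x) + (u i x)\<^sup>2 * (D i x \<bullet> x))"
      unfolding \<Xi>_def w_def
      by (simp add: D_simps inner_add_left inner_add_right power2_eq_square algebra_simps)
    also have "\<dots> = h i x" unfolding u_eq[OF xS] by (simp add: g_def)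
    finally show ?thesis .
  qed
  moreover have "norm (frechet_derivative (\<Xi> i) (at x) v - v) \<le> norm v / 2" if x: "x \<in> ball 0 \<rho>" for i x v
  proof -
    have "(\<Xi> i has_derivative (\<lambda>v. ?\<psi>' i x v + frechet_derivative (w i) (at x) v)) (at x)"
      unfolding \<Xi>_def[abs_def]
      by (intro has_derivative_add \<psi>_deriv[OF x] sym_class_derivative[OF w_ball[unfolded Suc_eq_plus1[symmetric]] x])
    from fun_cong[OF frechet_derivative_at[OF this], of v]
    have eq: "frechet_derivative (\<Xi> i) (at x) v - v = frechet_derivative (\<epsilon> i) (at x) v + frechet_derivative (w i) (at x) v"
      by (simp add: algebra_simps)
    show ?thesis
      unfolding eq
      using norm_triangle_ineq[of "frechet_derivative (\<epsilon> i) (at x) v" "frechet_derivative (w i) (at x) v"]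
        \<epsilon>(2)[OF x, of i v] w'_bound[OF x, of i v] norm_ge_zero[of v] by linarith
  qed
  ultimately show ?thesis by (intro exI[of _ \<Xi>]) auto
qed

end

subsection \<open>Normalized germs\<close>

definition sign_flip :: "('n \<Rightarrow> real) \<Rightarrow> real^'n \<Rightarrow> real^'n" where
  "sign_flip \<epsilon> y = (\<chi> i. \<epsilon> i * y $ i)"

lemma sign_flip_inner: "sign_flip \<epsilon> y \<bullet> z = (\<Sum>i\<in>UNIV. \<epsilon> i * (y $ i * z $ i))"
  by (simp add: sign_flip_def inner_vec_def mult.assoc)

lemma reflection_family_sign_flip:
  assumes "\<And>i j. \<epsilon> i j = 1 \<or> \<epsilon> i j = -1"
  shows "reflection_family (\<lambda>i. sign_flip (\<epsilon> i))"
proof (rule reflection_family.intro)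
  show "linear (sign_flip (\<epsilon> i))" for i
    by (rule linearI) (simp_all add: sign_flip_def vec_eq_iff algebra_simps)
  have "\<epsilon> i j * \<epsilon> i j = 1" for i j using assms[of i j] by auto
  then show "sign_flip (\<epsilon> i) (sign_flip (\<epsilon> i) x) = x" for i x
    by (simp add: sign_flip_def vec_eq_iff mult.assoc[symmetric])
  show "sign_flip (\<epsilon> i) x \<bullet> y = x \<bullet> sign_flip (\<epsilon> i) y" for i x y
    by (simp add: sign_flip_def inner_vec_def mult_ac)
qed

text \<open>What remains of the problem after the linear change of coordinates. The bounds
  \<open>C\<close> depend on the order alone, so they can be fixed before \<open>h\<close>; the
  factor 2 is that of the Hessian of the quadratic form.\<close>

definition normalized_morse_germ ::
    "nat \<Rightarrow> real \<Rightarrow> (nat \<Rightarrow> real) \<Rightarrow> (real^'n \<Rightarrow> real) \<Rightarrow> ('n \<Rightarrow> real) \<Rightarrow> bool" where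
  "normalized_morse_germ k \<rho> C h \<epsilon> \<longleftrightarrow>
     (\<forall>i. \<epsilon> i = 1 \<or> \<epsilon> i = -1) \<and> Ck_on k h (ball 0 \<rho>) \<and>
     (\<forall>vs. length vs \<le> k \<longrightarrow> (\<forall>x\<in>ball 0 \<rho>. \<bar>multi_deriv h vs x\<bar> \<le> C (length vs) * prod_list (map norm vs))) \<and>
     h 0 = 0 \<and> (\<forall>v. frechet_derivative h (at 0) v = 0) \<and>
     (\<forall>v w. frechet_derivative (\<lambda>y. frechet_derivative h (at y) v) (at 0) w = 2 * (sign_flip \<epsilon> v \<bullet> w)) \<and>
     (\<forall>x\<in>ball 0 \<rho>. \<forall>v. \<bar>frechet_derivative h (at x) v - 2 * (sign_flip \<epsilon> x \<bullet> v)\<bar> \<le> norm x * norm v / 20)"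

text \<open>The order of quantifiers is the point: \<open>M\<close> precedes the germ. \<Xi> is kept
  beside \<Phi> because the smoothness of the inverse chart will be read off from it.\<close>

lemma uniform_morse_chart:
  assumes "\<rho> > 0" "k \<ge> 2"
  shows "\<exists>M>0. \<forall>(h :: real^'n \<Rightarrow> real) \<epsilon>. normalized_morse_germ k \<rho> C h \<epsilon> \<longrightarrow>
    (\<exists>\<Xi> \<Phi>. Ck_on (k - 1) \<Xi> (ball 0 \<rho>) \<and> Ck_on (k - 1) \<Phi> (ball 0 (\<rho>/2)) \<and>
      (\<forall>y\<in>ball 0 (\<rho>/2). \<Phi> y \<in> ball 0 \<rho> \<and> \<Xi> (\<Phi> y) = y \<and> h (\<Phi> y) = sign_flip \<epsilon> y \<bullet> y \<and>
        (\<forall>v. norm (frechet_derivative \<Phi> (at y) v) \<le> 2 * norm v) \<and>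
        (\<forall>vs. length vs \<le> k - 1 \<and> (\<forall>v\<in>set vs. norm v = 1) \<longrightarrow> norm (multi_deriv \<Phi> vs y) \<le> M)) \<and>
      (\<forall>x\<in>ball 0 \<rho>. \<Xi> x \<in> ball 0 (\<rho>/2) \<longrightarrow> \<Phi> (\<Xi> x) = x) \<and> \<Phi> 0 = 0)"
\<comment> \<open>A family indexed by all pairs needs one germ as a default value; if there is none,
  every \<open>M\<close> works.\<close>
proof (cases "\<exists>(h :: real^'n \<Rightarrow> real) \<epsilon>. normalized_morse_germ k \<rho> C h \<epsilon>")
  case False
  then show ?thesis by (intro exI[of _ 1]) simp
next
  case True
  then obtain h0 :: "real^'n \<Rightarrow> real" and \<epsilon>0 where germ0: "normalized_morse_germ k \<rho> C h0 \<epsilon>0" by blast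
  obtain n where n: "k = n + 2" using assms(2) by (metis add.commute le_Suc_ex)
  \<comment> \<open>All admissible germs form one family; the other indices are sent to a fixed germ.\<close>
  define G where "G p = (if normalized_morse_germ k \<rho> C (fst p) (snd p) then p else (h0, \<epsilon>0))"
    for p :: "(real^'n \<Rightarrow> real) \<times> ('n \<Rightarrow> real)"
  define h where "h p = fst (G p)" for p
  define \<epsilon> where "\<epsilon> p = snd (G p)" for p
  have germ: "normalized_morse_germ k \<rho> C (h p) (\<epsilon> p)" for p
    using germ0 by (simp add: h_def \<epsilon>_def G_def)
  note facts = germ[unfolded normalized_morse_germ_def]
  interpret reflection_family "\<lambda>p. sign_flip (\<epsilon> p)"
    using facts by (intro reflection_family_sign_flip) blast
  have h_sym: "unif_class (n + 2) (ball 0 \<rho>) h"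
  proof (rule sym_class_of_multi_deriv_bound)
    show "Ck_on (n + 2) (h p) (ball 0 \<rho>)" for p using facts n by blast
    show "\<exists>C. \<forall>p. \<forall>x\<in>ball 0 \<rho>. norm (multi_deriv (h p) vs x) \<le> C" if "length vs \<le> n + 2" for vs
      using facts that n by (intro exI[of _ "C (length vs) * prod_list (map norm vs)"]) simp
  qed
  have "\<exists>\<Xi>. unif_class (n + 1) (ball 0 \<rho>) \<Xi> \<and>
    (\<forall>p. \<Xi> p 0 = 0 \<and> (\<forall>x\<in>ball 0 \<rho>. sign_flip (\<epsilon> p) (\<Xi> p x) \<bullet> \<Xi> p x = h p x \<and>
      (\<forall>v. norm (frechet_derivative (\<Xi> p) (at x) v - v) \<le> norm v / 2)))"
    by (rule normal_form_map[OF assms(1) h_sym]) (use facts in simp_all)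
  then obtain \<Xi> where \<Xi>: "unif_class (Suc n) (ball 0 \<rho>) \<Xi>" "\<And>p. \<Xi> p 0 = 0"
    "\<And>p x. x \<in> ball 0 \<rho> \<Longrightarrow> sign_flip (\<epsilon> p) (\<Xi> p x) \<bullet> \<Xi> p x = h p x"
    "\<And>p x v. x \<in> ball 0 \<rho> \<Longrightarrow> norm (frechet_derivative (\<Xi> p) (at x) v - v) \<le> norm v / 2"
    unfolding Suc_eq_plus1 by blast
  obtain \<Phi> where \<Phi>: "unif_class (Suc n) (ball 0 (\<rho>/2)) \<Phi>"
    "\<And>p y. y \<in> ball 0 (\<rho>/2) \<Longrightarrow> \<Phi> p y \<in> ball 0 \<rho> \<and> \<Xi> p (\<Phi> p y) = y \<and>
      (\<forall>v. norm (frechet_derivative (\<Phi> p) (at y) v) \<le> 2 * norm v)"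
    "\<And>p x. x \<in> ball 0 \<rho> \<Longrightarrow> \<Xi> p x \<in> ball 0 (\<rho>/2) \<Longrightarrow> \<Phi> p (\<Xi> p x) = x"
    using near_identity_inverse[OF assms(1) \<Xi>(1,2,4)] by blast
  obtain M where M: "M > 0" "\<And>p y vs. y \<in> ball 0 (\<rho>/2) \<Longrightarrow> length vs \<le> Suc n \<Longrightarrow> \<forall>v\<in>set vs. norm v = 1 \<Longrightarrow>
      norm (multi_deriv (\<Phi> p) vs y) \<le> M"
    using sym_class_uniform_multi_deriv_bound[OF open_ball \<Phi>(1)] by blast
  show ?thesis
  proof (intro exI[of _ M] conjI M(1) allI impI)
    fix h' :: "real^'n \<Rightarrow> real" and \<epsilon>' assume g: "normalized_morse_germ k \<rho> C h' \<epsilon>'"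
    let ?p = "(h', \<epsilon>')"
    have p: "h ?p = h'" "\<epsilon> ?p = \<epsilon>'" using g by (simp_all add: h_def \<epsilon>_def G_def)
    have k1: "k - 1 = Suc n" using n by simp
    show "\<exists>\<Xi> \<Phi>. Ck_on (k - 1) \<Xi> (ball 0 \<rho>) \<and> Ck_on (k - 1) \<Phi> (ball 0 (\<rho>/2)) \<and>
      (\<forall>y\<in>ball 0 (\<rho>/2). \<Phi> y \<in> ball 0 \<rho> \<and> \<Xi> (\<Phi> y) = y \<and> h' (\<Phi> y) = sign_flip \<epsilon>' y \<bullet> y \<and>
        (\<forall>v. norm (frechet_derivative \<Phi> (at y) v) \<le> 2 * norm v) \<and>
        (\<forall>vs. length vs \<le> k - 1 \<and> (\<forall>v\<in>set vs. norm v = 1) \<longrightarrow> norm (multi_deriv \<Phi> vs y) \<le> M)) \<and>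
      (\<forall>x\<in>ball 0 \<rho>. \<Xi> x \<in> ball 0 (\<rho>/2) \<longrightarrow> \<Phi> (\<Xi> x) = x) \<and> \<Phi> 0 = 0"
    proof (rule exI[of _ "\<Xi> ?p"], rule exI[of _ "\<Phi> ?p"], intro conjI ballI allI impI)
      show "Ck_on (k - 1) (\<Xi> ?p) (ball 0 \<rho>)" "Ck_on (k - 1) (\<Phi> ?p) (ball 0 (\<rho>/2))"
        unfolding k1 by (rule sym_class_imp_Ck_on[OF \<Xi>(1)], rule sym_class_imp_Ck_on[OF \<Phi>(1)])
      show "\<Phi> ?p 0 = 0" using \<Phi>(3)[of 0 ?p] \<Xi>(2)[of ?p] assms(1) by simp
      fix y :: "real^'n" assume y: "y \<in> ball 0 (\<rho>/2)"
      show "\<Phi> ?p y \<in> ball 0 \<rho>" "\<Xi> ?p (\<Phi> ?p y) = y" using \<Phi>(2)[OF y] by blast+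
      then show "h' (\<Phi> ?p y) = sign_flip \<epsilon>' y \<bullet> y" using \<Xi>(3)[of "\<Phi> ?p y" ?p] p by simp
      show "norm (frechet_derivative (\<Phi> ?p) (at y) v) \<le> 2 * norm v" for v using \<Phi>(2)[OF y] by blast
      show "norm (multi_deriv (\<Phi> ?p) vs y) \<le> M" if "length vs \<le> k - 1 \<and> (\<forall>v\<in>set vs. norm v = 1)" for vs
        using M(2)[OF y, of vs ?p] that k1 by simp
    next
      fix x :: "real^'n" assume "x \<in> ball 0 \<rho>" "\<Xi> ?p x \<in> ball 0 (\<rho>/2)"
      then show "\<Phi> ?p (\<Xi> ?p x) = x" by (rule \<Phi>(3))
    qed
  qed
qed

section \<open>From a function at a nondegenerate critical point to a normalized germ\<close>

lemma hessian_quadratic_form: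
  fixes f :: "real^'n \<Rightarrow> real"
  assumes "open U" "x \<in> U" "Ck_on 2 f U"
  shows "multi_deriv f [v, w] x = v \<bullet> (hessian f x *v w)"
proof -
  let ?d = "\<lambda>v y. frechet_derivative f (at y) v"
  have C: "Ck_on (Suc 1) f U" "Ck_on (Suc 0) (?d v) U" for v
    using assms(3) by (simp_all add: numeral_2_eq_2)
  have "multi_deriv f [v, w] x = frechet_derivative (\<lambda>y. \<Sum>i\<in>UNIV. v $ i *\<^sub>R ?d (axis i 1) y) (at x) w"
    unfolding multi_deriv.simps
  proof (rule fun_cong[OF frechet_derivative_cong_open[OF assms(1,2)]])
    fix y assume "y \<in> U"
    have lin: "linear (frechet_derivative f (at y))"
      using has_derivative_linear[OF Ck_on_has_derivative[OF C(1) \<open>y \<in> U\<close>]] .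
    have "?d v y = ?d (\<Sum>i\<in>UNIV. v $ i *\<^sub>R axis i 1) y"
      using basis_expansion[of v] by (simp add: scalar_mult_eq_scaleR)
    then show "?d v y = (\<Sum>i\<in>UNIV. v $ i *\<^sub>R ?d (axis i 1) y)"
      by (simp add: linear_sum[OF lin] linear_cmul[OF lin])
  qed
  also have "\<dots> = (\<Sum>i\<in>UNIV. v $ i *\<^sub>R frechet_derivative (?d (axis i 1)) (at x) w)"
  proof -
    have "((\<lambda>y. \<Sum>i\<in>UNIV. v $ i *\<^sub>R ?d (axis i 1) y) has_derivative
        (\<lambda>w. \<Sum>i\<in>UNIV. v $ i *\<^sub>R frechet_derivative (?d (axis i 1)) (at x) w)) (at x)"
      by (intro has_derivative_sum has_derivative_scaleR_right Ck_on_has_derivative[OF C(2) assms(2)])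
    from fun_cong[OF frechet_derivative_at[OF this], of w] show ?thesis by (rule sym)
  qed
  also have "\<dots> = (\<Sum>i\<in>UNIV. v $ i * (\<Sum>j\<in>UNIV. hessian f x $ i $ j * w $ j))"
  proof (intro sum.cong refl)
    fix i
    have lin: "linear (frechet_derivative (?d (axis i 1)) (at x))"
      using has_derivative_linear[OF Ck_on_has_derivative[OF C(2) assms(2)]] .
    have "frechet_derivative (?d (axis i 1)) (at x) w = frechet_derivative (?d (axis i 1)) (at x) (\<Sum>j\<in>UNIV. w $ j *\<^sub>R axis j 1)"
      using basis_expansion[of w] by (simp add: scalar_mult_eq_scaleR)
    also have "\<dots> = (\<Sum>j\<in>UNIV. hessian f x $ i $ j * w $ j)"
      by (simp add: linear_sum[OF lin] linear_cmul[OF lin] hessian_def mult.commute)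
    finally show "v $ i *\<^sub>R frechet_derivative (?d (axis i 1)) (at x) w = v $ i * (\<Sum>j\<in>UNIV. hessian f x $ i $ j * w $ j)"
      by simp
  qed
  also have "\<dots> = v \<bullet> (hessian f x *v w)"
    by (simp add: inner_vec_def matrix_vector_mult_def)
  finally show ?thesis .
qed

lemma smallest_singular_value_le:
  "smallest_singular_value H * norm x \<le> norm (H *v x)"
proof (cases "x = 0")
  case False
  let ?u = "(1 / norm x) *\<^sub>R x"
  have "smallest_singular_value H \<le> norm (H *v ?u)"
    unfolding smallest_singular_value_def using False
    by (intro cINF_lower bdd_belowI2[where m=0]) auto
  also have "\<dots> = norm (H *v x) / norm x"
    by (simp add: matrix_vector_mult_scaleR)
  finally show ?thesis using False by (simp add: field_simps)
qed simp

text \<open>By compactness the infimum is attained, at a vector that an injective matrix does not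
  annihilate.\<close>

lemma smallest_singular_value_pos:
  fixes H :: "real^'n^'n"
  assumes "rank H = CARD('n)"
  shows "smallest_singular_value H > 0"
proof -
  have inj: "inj ((*v) H)" using assms by (simp add: full_rank_injective)
  have "axis undefined 1 \<in> sphere (0::real^'n) 1" by simp
  then have ne: "sphere (0::real^'n) 1 \<noteq> {}" by blast
  have "continuous_on (sphere 0 1) (\<lambda>x. norm (H *v x))"
    by (rule continuous_on_norm[OF linear_continuous_on[OF matrix_vector_mul_bounded_linear]])
  from continuous_attains_inf[OF compact_sphere ne this]
  obtain u where u: "u \<in> sphere 0 1" "\<And>x. x \<in> sphere 0 1 \<Longrightarrow> norm (H *v u) \<le> norm (H *v x)"
    by blast
  have "u \<noteq> 0" using u(1) by auto
  then have "H *v u \<noteq> H *v 0" by (subst inj_eq[OF inj])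
  then have "0 < norm (H *v u)" by simp
  also have "\<dots> \<le> smallest_singular_value H"
    unfolding smallest_singular_value_def by (rule cINF_greatest[OF ne u(2)])
  finally show ?thesis .
qed

lemma prod_list_norm_map_le:
  assumes "\<And>v. norm (A v) \<le> a * norm v" "a \<ge> 0"
  shows "prod_list (map norm (map A vs)) \<le> a ^ length vs * prod_list (map norm vs)"
proof (induction vs)
  case (Cons v vs)
  have "0 \<le> prod_list (map norm (map A vs))" by (induction vs) auto
  then have "norm (A v) * prod_list (map norm (map A vs)) \<le> (a * norm v) * (a ^ length vs * prod_list (map norm vs))"
    using assms Cons by (intro mult_mono) auto
  then show ?case by (simp add: mult_ac)
qed simp

text \<open>Each direction passes through \<open>A\<close>, so derivatives of order p are bounded by
  K a^p. In particular the Hessian moves by at most K a^3 \<rho> \<le> 1/20 over the ball, and one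
  more integration from the critical point gives the gradient estimate required of a germ.\<close>

lemma normalized_germ_of_function:
  fixes f :: "real^'n \<Rightarrow> real"
  assumes "open U" and f: "Ck_on k f U" and k: "k \<ge> 3" and norm_f: "Ck_norm k f U \<le> ereal K"
    and "x0 \<in> U" and crit: "frechet_derivative f (at x0) = (\<lambda>v. 0)"
    and s: "s = smallest_singular_value (hessian f x0)" "s > 0" and "\<rho> > 0"
    and a: "a = sqrt (2 / s)" "ball x0 (a * \<rho>) \<subseteq> U" "K * a ^ 3 * \<rho> \<le> 1/20"
  shows "\<exists>(A :: real^'n \<Rightarrow> real^'n) \<epsilon>. linear A \<and> bij A \<and> (\<forall>y. norm (A y) \<le> a * norm y) \<and>
    normalized_morse_germ k \<rho> (\<lambda>p. if p = 0 then K * a * \<rho> else K * a ^ p) (\<lambda>y. - f x0 + f (x0 + A y)) \<epsilon>"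
proof -
  let ?H = "hessian f x0"
  have f2: "Ck_on 2 f U" using Ck_on_mono[OF f] k by simp
  have form: "multi_deriv f [v, w] x0 = v \<bullet> (?H *v w)" for v w
    by (rule hessian_quadratic_form[OF assms(1,5) f2])
  have "v \<bullet> (?H *v w) = w \<bullet> (?H *v v)" for v w
    using frechet_derivative_commute[OF assms(1,5) f2, of v w] form[of v w] form[of w v] by simp
  then have adj: "(?H *v v) \<bullet> w = v \<bullet> (?H *v w)" for v w
    by (metis inner_commute)
  obtain A :: "real^'n \<Rightarrow> real^'n" and \<epsilon> where A: "linear A" "bij A" "\<And>y. norm (A y) \<le> a * norm y"
    and \<epsilon>: "\<And>i. \<epsilon> i = 1 \<or> \<epsilon> i = -1"
    and A_form: "\<And>y z. A y \<bullet> (?H *v A z) = 2 * (\<Sum>i\<in>UNIV. \<epsilon> i * (y $ i * z $ i))"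
    using signature_coordinates[OF matrix_vector_mul_linear adj s(2)] smallest_singular_value_le[of ?H]
    unfolding s(1)[symmetric] a(1)[symmetric] by blast
  have a0: "a > 0" using s(2) a(1) by simp
  let ?V = "ball (0::real^'n) \<rho>"
  define h where "h y = - f x0 + f (x0 + A y)" for y
  have inU: "x0 + A y \<in> U" if "y \<in> ?V" for y
  proof -
    have "norm (A y) < a * \<rho>"
      by (rule order.strict_trans1[OF A(3) mult_strict_left_mono]) (use that a0 in auto)
    then have "x0 + A y \<in> ball x0 (a * \<rho>)" by (simp add: dist_norm)
    then show ?thesis using a(2) by blast
  qed
  have h: "Ck_on k h ?V"
    unfolding h_def[abs_def] by (intro Ck_on_add_const Ck_on_affine_composition[OF open_ball A(1) inU f])
  have A0: "A 0 = 0" using A(1) by (rule linear_0)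
  have h0: "h 0 = 0" by (simp add: h_def A0)
  have K0: "K \<ge> 0"
  proof -
    have "norm (multi_deriv f [axis undefined 1] x0) \<le> K * prod_list (map norm [axis undefined 1 :: real^'n])"
      by (rule multi_deriv_le_Ck_norm[OF assms(1,5) f norm_f]) (use k in auto)
    then show ?thesis by (simp add: crit)
  qed
  have md: "multi_deriv h vs y = multi_deriv f (map A vs) (x0 + A y)"
    if "y \<in> ?V" "vs \<noteq> []" "length vs \<le> k" for y vs
    unfolding h_def[abs_def] multi_deriv_add_const[OF that(2)]
    by (rule multi_deriv_affine_composition[OF open_ball A(1) inU that(1) Ck_on_mono[OF f that(3)]])
  have md_bound: "\<bar>multi_deriv h vs y\<bar> \<le> K * a ^ length vs * prod_list (map norm vs)"
    if "y \<in> ?V" "vs \<noteq> []" "length vs \<le> k" for y vs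
  proof -
    have "\<bar>multi_deriv h vs y\<bar> \<le> K * prod_list (map norm (map A vs))"
      using multi_deriv_le_Ck_norm[OF assms(1) inU[OF that(1)] f norm_f, of "map A vs"] that
      unfolding md[OF that] by simp
    also have "\<dots> \<le> K * (a ^ length vs * prod_list (map norm vs))"
      using K0 a0 by (intro mult_left_mono prod_list_norm_map_le A(3)) auto
    finally show ?thesis by (simp add: mult.assoc)
  qed
  have C1: "Ck_on (Suc 0) h ?V" and C2: "Ck_on (Suc 0) (\<lambda>y. frechet_derivative h (at y) v) ?V"
    and C3: "Ck_on (Suc 0) (\<lambda>y. frechet_derivative (\<lambda>y. frechet_derivative h (at y) v) (at y) w) ?V" for v w
    using Ck_on_mono[OF h, of 3] k Ck_on_mono[of 3 h ?V "Suc 0"]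
      Ck_on_mono[of 2 "\<lambda>y. frechet_derivative h (at y) v" ?V "Suc 0"] by (auto simp: numeral_eq_Suc)
  \<comment> \<open>\<open>Ck_norm\<close> does not control values; the constant for order 0 comes
    from the gradient bound and h 0 = 0.\<close>
  have h_small: "\<bar>h y\<bar> \<le> K * a * \<rho>" if y: "y \<in> ?V" for y
  proof -
    have in_V: "z \<in> ?V" if "z \<in> cball 0 (norm y)" for z using that y by simp
    have "norm (h y - h 0) \<le> (K * a) * norm y"
    proof (rule derivative_bound_from_0)
      fix z :: "real^'n" assume z: "z \<in> cball 0 (norm y)"
      show "(h has_derivative frechet_derivative h (at z)) (at z)"
        by (rule Ck_on_has_derivative[OF C1 in_V[OF z]])
      show "norm (frechet_derivative h (at z) v) \<le> K * a * norm v" for v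
        using md_bound[OF in_V[OF z], of "[v]"] k by simp
    qed
    also have "\<dots> \<le> (K * a) * \<rho>" using y K0 a0 by (intro mult_left_mono) auto
    finally show ?thesis by (simp add: h0)
  qed
  have zero_V: "0 \<in> ?V" using \<open>\<rho> > 0\<close> by simp
  have dh0: "frechet_derivative h (at 0) v = 0" for v
    using md[OF zero_V, of "[v]"] k by (simp add: A0 crit)
  let ?d2 = "\<lambda>v w y. frechet_derivative (\<lambda>y. frechet_derivative h (at y) v) (at y) w"
  have d2h0: "?d2 v w 0 = 2 * (sign_flip \<epsilon> v \<bullet> w)" for v w
    using md[OF zero_V, of "[v, w]"] k form[of "A v" "A w"] A_form[of v w] by (simp add: A0 sign_flip_inner)
  have near2: "\<bar>?d2 v w y - ?d2 v w 0\<bar> \<le> 1/20 * norm v * norm w" if y: "y \<in> ?V" for v w y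
  proof -
    have in_V: "z \<in> ?V" if "z \<in> cball 0 (norm y)" for z using that y by simp
    have "norm (?d2 v w y - ?d2 v w 0) \<le> (K * a ^ 3 * norm v * norm w) * norm y"
    proof (rule derivative_bound_from_0)
      fix z :: "real^'n" assume z: "z \<in> cball 0 (norm y)"
      show "(?d2 v w has_derivative frechet_derivative (?d2 v w) (at z)) (at z)"
        by (rule Ck_on_has_derivative[OF C3 in_V[OF z]])
      show "norm (frechet_derivative (?d2 v w) (at z) u) \<le> K * a ^ 3 * norm v * norm w * norm u" for u
        using md_bound[OF in_V[OF z], of "[v, w, u]"] k by (simp add: mult.assoc power3_eq_cube)
    qed
    also have "\<dots> \<le> (K * a ^ 3 * norm v * norm w) * \<rho>"
      using y K0 a0 by (intro mult_left_mono) auto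
    also have "\<dots> = (K * a ^ 3 * \<rho>) * (norm v * norm w)" by simp
    also have "\<dots> \<le> 1/20 * (norm v * norm w)" by (intro mult_right_mono a(3)) simp
    finally show ?thesis by simp
  qed
  have near: "\<bar>frechet_derivative h (at y) v - 2 * (sign_flip \<epsilon> y \<bullet> v)\<bar> \<le> norm y * norm v / 20"
    if y: "y \<in> ?V" for y v
  proof -
    interpret reflection_family "\<lambda>_::unit. sign_flip \<epsilon>"
      by (rule reflection_family_sign_flip) (rule \<epsilon>)
    have in_V: "z \<in> ?V" if "z \<in> cball 0 (norm y)" for z using that y by simp
    have "norm ((frechet_derivative h (at y) v - 2 * (sign_flip \<epsilon> y \<bullet> v))
        - (frechet_derivative h (at 0) v - 2 * (sign_flip \<epsilon> 0 \<bullet> v))) \<le> (1/20 * norm v) * norm y"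
    proof (rule derivative_bound_from_0)
      fix z :: "real^'n" assume z: "z \<in> cball 0 (norm y)"
      show "((\<lambda>y. frechet_derivative h (at y) v - 2 * (sign_flip \<epsilon> y \<bullet> v)) has_derivative
          (\<lambda>w. ?d2 v w z - 2 * (sign_flip \<epsilon> w \<bullet> v))) (at z)"
        by (intro has_derivative_diff Ck_on_has_derivative[OF C2 in_V[OF z]] has_derivative_mult_right
            has_derivative_inner_left bounded_linear_imp_has_derivative bounded_linear_D)
      fix w
      have "sign_flip \<epsilon> w \<bullet> v = sign_flip \<epsilon> v \<bullet> w" by (metis D_adjoint inner_commute)
      then show "norm (?d2 v w z - 2 * (sign_flip \<epsilon> w \<bullet> v)) \<le> (1/20 * norm v) * norm w"
        using near2[OF in_V[OF z], of v w] unfolding d2h0 by simp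
    qed
    moreover have "sign_flip \<epsilon> 0 \<bullet> v = 0" by (simp add: sign_flip_inner)
    ultimately show ?thesis by (simp add: dh0 mult.commute)
  qed
  have "normalized_morse_germ k \<rho> (\<lambda>p. if p = 0 then K * a * \<rho> else K * a ^ p) h \<epsilon>"
    unfolding normalized_morse_germ_def
  proof (intro conjI allI impI ballI \<epsilon> h h0 dh0 d2h0 near)
    fix vs :: "(real^'n) list" and y assume "length vs \<le> k" "y \<in> ?V"
    then show "\<bar>multi_deriv h vs y\<bar> \<le> (if length vs = 0 then K * a * \<rho> else K * a ^ length vs) * prod_list (map norm vs)"
      using md_bound[of y vs] h_small[of y] by (cases "vs = []") auto
  qed
  then show ?thesis
    using A unfolding h_def[abs_def] by blast
qed

text \<open>Testing the second derivative on the pair (H u, u) gives |H u|^2 \<le> K |H u| for a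
  unit vector u. The resulting comparison of s with K is what the numerical estimates need.\<close>

lemma singular_value_le_Ck_norm:
  fixes f :: "real^'n \<Rightarrow> real"
  assumes "open U" "x0 \<in> U" "Ck_on k f U" "k \<ge> 2" "Ck_norm k f U \<le> ereal K"
  shows "smallest_singular_value (hessian f x0) \<le> K"
proof -
  let ?H = "hessian f x0" and ?u = "axis undefined 1 :: real^'n"
  have "(norm (?H *v ?u))\<^sup>2 = multi_deriv f [?H *v ?u, ?u] x0"
    unfolding hessian_quadratic_form[OF assms(1,2) Ck_on_mono[OF assms(3,4)]] by (rule dot_square_norm[symmetric])
  also have "\<dots> \<le> norm (multi_deriv f [?H *v ?u, ?u] x0)" by simp
  also have "\<dots> \<le> K * prod_list (map norm [?H *v ?u, ?u])"
    by (rule multi_deriv_le_Ck_norm[OF assms(1,2,3,5)]) (use assms(4) in auto)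
  finally have "norm (?H *v ?u) * norm (?H *v ?u) \<le> K * norm (?H *v ?u)"
    by (simp add: power2_eq_square)
  moreover have "smallest_singular_value ?H \<le> norm (?H *v ?u)"
    using smallest_singular_value_le[of ?H ?u] by simp
  moreover have "0 \<le> K"
  proof -
    have "0 \<le> norm (multi_deriv f [?u] x0)" by simp
    also have "\<dots> \<le> K * prod_list (map norm [?u])"
      by (rule multi_deriv_le_Ck_norm[OF assms(1,2,3,5)]) (use assms(4) in auto)
    finally show ?thesis by simp
  qed
  ultimately show ?thesis
    by (cases "norm (?H *v ?u) = 0") (auto dest: mult_right_le_imp_le)
qed

text \<open>With r = sqrt s the power s^(5/2) is r^5 and a r = sqrt 2. The third estimate reduces to
  3 K^2 / (16 (K+1)^4), and 4 K \<le> (K+1)^2 brings this down to 3/256. The factor \<open>m\<close>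
  stands for the minimum in the radius.\<close>

lemma radius_estimates:
  fixes s K m :: real
  assumes "0 < s" "s \<le> K" "0 < m" "m \<le> 1"
  defines "\<delta> \<equiv> s powr (5/2) / (32 * (K + 1) powr (9/2)) * m"
    and "L \<equiv> 32 * (K + 1) ^ 5 / s powr (5/2)" and "a \<equiv> sqrt (2 / s)"
  shows "0 < \<delta>" "a * 2 \<le> L" "K * a ^ 3 * (2 * \<delta>) \<le> 1/20"
proof -
  define r where "r = sqrt s"
  have r: "r > 0" "r\<^sup>2 = s" using assms(1) by (simp_all add: r_def)
  have sp: "s powr (5/2) = r ^ 5"
  proof -
    have "s powr (5/2) = (s powr (1/2)) powr 5" by (simp add: powr_powr)
    also have "s powr (1/2) = r" using assms(1) by (simp add: r_def powr_half_sqrt)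
    also have "r powr 5 = r ^ 5" using r(1) powr_realpow[of r 5] by simp
    finally show ?thesis .
  qed
  have a: "a * r = sqrt 2" "a > 0"
    using assms(1) by (simp_all add: a_def r_def real_sqrt_divide)
  have K1: "1 \<le> K + 1" "0 \<le> K" using assms(1,2) by auto
  have Kp: "(K + 1) ^ 4 \<le> (K + 1) powr (9/2)"
    using K1 powr_mono[of 4 "9/2" "K + 1"] powr_realpow[of "K + 1" 4] by simp
  have K4: "(K + 1) ^ 4 > 0" using K1 by simp
  show "0 < \<delta>" using assms(1,3) K1 by (auto simp: \<delta>_def)
  have sqrt2: "sqrt 2 \<le> 3/2" by (rule real_le_lsqrt) (auto simp: power2_eq_square)
  have "s\<^sup>2 \<le> (K + 1) ^ 5"
  proof -
    have "s\<^sup>2 \<le> (K + 1)\<^sup>2" using assms(1,2) by (intro power_mono) auto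
    also have "\<dots> \<le> (K + 1) ^ 5" using K1 by (intro power_increasing) auto
    finally show ?thesis .
  qed
  then have "(a * r) * 2 * s\<^sup>2 \<le> 3/2 * 2 * (K + 1) ^ 5"
    unfolding a(1) using sqrt2 K1 by (intro mult_mono) auto
  moreover have "(a * r) * 2 * s\<^sup>2 = a * 2 * r ^ 5"
    by (simp add: r(2)[symmetric] numeral_eq_Suc mult_ac)
  moreover have "0 \<le> (K + 1) ^ 5" using K1 by simp
  ultimately have "a * 2 * r ^ 5 \<le> 32 * (K + 1) ^ 5" by linarith
  then show "a * 2 \<le> L"
    unfolding L_def sp using r(1) by (simp add: field_simps)
  have "\<delta> \<le> r ^ 5 / (32 * (K + 1) ^ 4) * 1"
    unfolding \<delta>_def sp using Kp K4 r(1) assms(3,4)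
    by (intro mult_mono divide_left_mono) auto
  then have "K * a ^ 3 * (2 * \<delta>) \<le> K * a ^ 3 * (2 * (r ^ 5 / (32 * (K + 1) ^ 4)))"
    using K1 a(2) by (intro mult_left_mono) auto
  also have "\<dots> = K * (a * r) ^ 3 * r\<^sup>2 / (16 * (K + 1) ^ 4)"
  proof -
    have "r ^ 5 = r ^ 3 * r\<^sup>2" by (simp add: power_add[symmetric])
    then have "K * a ^ 3 * (2 * (r ^ 5 / (32 * P))) = K * (a * r) ^ 3 * r\<^sup>2 / (16 * P)" for P
      by (simp add: power_mult_distrib)
    then show ?thesis .
  qed
  also have "\<dots> = (K * s) * (2 * sqrt 2) / (16 * (K + 1) ^ 4)"
    unfolding a(1) r(2) by (simp add: power3_eq_cube)
  also have "\<dots> \<le> (K * K) * (2 * (3/2)) / (16 * (K + 1) ^ 4)"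
    using assms(1,2) sqrt2 K4 K1 by (intro divide_right_mono mult_mono) auto
  also have "\<dots> \<le> 1/20"
  proof -
    have "4 * K \<le> (K + 1)\<^sup>2"
      using zero_le_power2[of "K - 1"] by (simp add: power2_eq_square algebra_simps)
    then have "(4 * K) * (4 * K) \<le> (K + 1)\<^sup>2 * (K + 1)\<^sup>2" using K1 by (intro mult_mono) auto
    also have "(K + 1)\<^sup>2 * (K + 1)\<^sup>2 = (K + 1) ^ 4" by (simp add: power_add[symmetric])
    finally have "16 * (K * K) \<le> (K + 1) ^ 4" by simp
    then have "(K * K) * 3 * 20 \<le> 16 * (K + 1) ^ 4" using K4 by linarith
    then show ?thesis using K4 by (simp add: field_simps)
  qed
  finally show "K * a ^ 3 * (2 * \<delta>) \<le> 1/20" .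
qed

subsection \<open>The quantitative Morse theorem\<close>

text \<open>The inverse of \<phi> is \<Xi> composed with the affine map x to B x - B x0, so it is as
  smooth as \<Xi>; the image is open, being the preimage of an open set under that affine
  map.\<close>

lemma affine_image_chart:
  fixes A \<Xi> \<Phi> :: "real^'n \<Rightarrow> real^'n" and x0 :: "real^'n"
  assumes "\<delta> > 0" "m \<ge> 1" "a \<ge> 0" and A: "linear A" "bij A" "\<And>y. norm (A y) \<le> a * norm y"
    and \<Xi>: "Ck_on m \<Xi> (ball 0 \<rho>)" and \<Phi>: "Ck_on m \<Phi> (ball 0 \<delta>)" "\<Phi> 0 = 0"
    and inv: "\<And>y. y \<in> ball 0 \<delta> \<Longrightarrow> \<Phi> y \<in> ball 0 \<rho>" "\<And>y. y \<in> ball 0 \<delta> \<Longrightarrow> \<Xi> (\<Phi> y) = y"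
      "\<And>x. x \<in> ball 0 \<rho> \<Longrightarrow> \<Xi> x \<in> ball 0 \<delta> \<Longrightarrow> \<Phi> (\<Xi> x) = x"
    and D\<Phi>: "\<And>y v. y \<in> ball 0 \<delta> \<Longrightarrow> norm (frechet_derivative \<Phi> (at y) v) \<le> 2 * norm v"
    and M: "\<And>y vs. y \<in> ball 0 \<delta> \<Longrightarrow> length vs \<le> m \<Longrightarrow> \<forall>v\<in>set vs. norm v = 1 \<Longrightarrow> norm (multi_deriv \<Phi> vs y) \<le> M"
  defines "\<phi> \<equiv> \<lambda>y. x0 + A (\<Phi> y)"
  shows "Ck_diffeomorphism m \<phi> (ball 0 \<delta>) (\<phi> ` ball 0 \<delta>)"
    and "sup_deriv_norm \<phi> (ball 0 \<delta>) \<le> ereal (a * 2)"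
    and "Ck_norm m \<phi> (ball 0 \<delta>) \<le> ereal (a * M)"
proof -
  let ?S = "ball (0::real^'n) \<delta>"
  define B where "B = inv A"
  have BA: "B (A y) = y" and AB: "A (B x) = x" for x y
    using A(2) by (auto simp: B_def bij_def surj_f_inv_f)
  have linB: "linear B"
    by (rule linearI; rule injD[OF bij_is_inj[OF A(2)]])
       (simp_all add: AB linear_add[OF A(1)] linear_cmul[OF A(1)])
  have \<phi>_eq: "\<phi> = (\<lambda>y. x0 + A (\<Phi> y))" by (simp add: \<phi>_def)
  have deriv: "(\<phi> has_derivative (\<lambda>v. A (frechet_derivative \<Phi> (at y) v))) (at y)" if "y \<in> ?S" for y
  proof -
    have "(\<Phi> has_derivative frechet_derivative \<Phi> (at y)) (at y)"
      using Ck_on_mono[OF \<Phi>(1) assms(2)] that by (simp add: frechet_derivative_works)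
    from bounded_linear.has_derivative[OF A(1)[unfolded linear_conv_bounded_linear] this]
    have "((\<lambda>y. x0 + A (\<Phi> y)) has_derivative (\<lambda>v. 0 + A (frechet_derivative \<Phi> (at y) v))) (at y)"
      by (intro has_derivative_add has_derivative_const)
    then show ?thesis by (simp add: \<phi>_eq)
  qed
  have \<phi>_image: "\<phi> ` ?S = (\<lambda>x. - (B x0) + B x) -` {z \<in> ball 0 \<rho>. \<Xi> z \<in> ?S}"
  proof (intro set_eqI iffI)
    fix x assume "x \<in> \<phi> ` ?S"
    then obtain y where y: "y \<in> ?S" "x = x0 + A (\<Phi> y)" by (auto simp: \<phi>_eq)
    then have "- (B x0) + B x = \<Phi> y" by (simp add: linear_add[OF linB] BA)
    then show "x \<in> (\<lambda>x. - (B x0) + B x) -` {z \<in> ball 0 \<rho>. \<Xi> z \<in> ?S}"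
      using inv(1,2)[OF y(1)] y(1) by simp
  next
    fix x assume x: "x \<in> (\<lambda>x. - (B x0) + B x) -` {z \<in> ball 0 \<rho>. \<Xi> z \<in> ?S}"
    let ?z = "- (B x0) + B x"
    have z: "?z \<in> ball 0 \<rho>" "\<Xi> ?z \<in> ?S" using x by auto
    have "\<phi> (\<Xi> ?z) = x"
      unfolding \<phi>_eq inv(3)[OF z] by (simp add: linear_diff[OF A(1)] AB)
    then show "x \<in> \<phi> ` ?S" using z(2) by (metis imageI)
  qed
  have \<Xi>_cont: "continuous_on (ball 0 \<rho>) \<Xi>"
    using Ck_on_mono[OF \<Xi>, of 0] by simp
  have contB: "continuous_on T (\<lambda>x. - (B x0) + B x)" for T
    by (intro continuous_intros linear_continuous_on linB[unfolded linear_conv_bounded_linear])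
  have "{z \<in> ball 0 \<rho>. \<Xi> z \<in> ?S} = ball 0 \<rho> \<inter> \<Xi> -` ?S" by blast
  then have "open {z \<in> ball 0 \<rho>. \<Xi> z \<in> ?S}"
    using continuous_open_preimage[OF \<Xi>_cont open_ball open_ball, of 0 \<delta>] by (simp only:)
  then have open_T: "open (\<phi> ` ?S)"
    unfolding \<phi>_image by (intro open_vimage contB)
  have inj: "inj_on \<phi> ?S"
  proof (rule inj_onI)
    fix y z assume "y \<in> ?S" "z \<in> ?S" "\<phi> y = \<phi> z"
    then have "A (\<Phi> y) = A (\<Phi> z)" by (simp add: \<phi>_eq)
    then have "\<Phi> y = \<Phi> z" by (rule injD[OF bij_is_inj[OF A(2)]])
    then have "\<Xi> (\<Phi> y) = \<Xi> (\<Phi> z)" by (rule arg_cong)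
    then show "y = z" unfolding inv(2)[OF \<open>y \<in> ?S\<close>] inv(2)[OF \<open>z \<in> ?S\<close>] .
  qed
  have A\<Phi>: "Ck_on m (\<lambda>y. A (\<Phi> y)) ?S"
    by (rule Ck_on_linear_image[OF open_ball A(1) \<Phi>(1)])
  have "Ck_on m (inv_into ?S \<phi>) (\<phi> ` ?S)"
  proof (rule Ck_on_cong[OF open_T])
    show "Ck_on m (\<lambda>x. \<Xi> (- (B x0) + B x)) (\<phi> ` ?S)"
      by (rule Ck_on_affine_composition[OF open_T linB _ \<Xi>]) (simp add: \<phi>_image)
    fix x assume "x \<in> \<phi> ` ?S"
    then obtain y where y: "y \<in> ?S" "x = \<phi> y" by blast
    then have "- (B x0) + B x = \<Phi> y" by (simp add: \<phi>_eq linear_add[OF linB] BA)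
    then show "\<Xi> (- (B x0) + B x) = inv_into ?S \<phi> x"
      using inv(2)[OF y(1)] inv_into_f_f[OF inj y(1)] y(2) by simp
  qed
  then show "Ck_diffeomorphism m \<phi> ?S (\<phi> ` ?S)"
    unfolding Ck_diffeomorphism_def using open_T inj Ck_on_add_const[OF A\<Phi>, of x0]
    by (simp add: \<phi>_eq bij_betw_def)
  show "sup_deriv_norm \<phi> ?S \<le> ereal (a * 2)"
    unfolding sup_deriv_norm_def
  proof (intro SUP_least)
    fix y assume y: "y \<in> ?S"
    have "onorm (\<lambda>v. A (frechet_derivative \<Phi> (at y) v)) \<le> a * 2"
    proof (rule onorm_bound)
      show "norm (A (frechet_derivative \<Phi> (at y) v)) \<le> a * 2 * norm v" for v
        using order_trans[OF A(3) mult_left_mono[OF D\<Phi>[OF y] assms(3)]] by (simp add: mult.assoc)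
    qed (use assms(3) in simp)
    then show "ereal (onorm (frechet_derivative \<phi> (at y))) \<le> ereal (a * 2)"
      unfolding frechet_derivative_at[OF deriv[OF y], symmetric] by simp
  qed
  show "Ck_norm m \<phi> ?S \<le> ereal (a * M)"
  proof (rule Ck_norm_leI[OF assms(2)])
    fix y and vs :: "(real^'n) list"
    assume y: "y \<in> ?S" and vs: "1 \<le> length vs" "length vs \<le> m" "\<forall>v\<in>set vs. norm v = 1"
    have ne: "vs \<noteq> []" using vs(1) by auto
    have "multi_deriv \<phi> vs y = A (multi_deriv \<Phi> vs y)"
      unfolding \<phi>_eq multi_deriv_add_const[OF ne]
      by (rule multi_deriv_linear_image[OF open_ball y A(1) Ck_on_mono[OF \<Phi>(1) vs(2)]])
    also have "norm \<dots> \<le> a * M"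
      by (rule order_trans[OF A(3) mult_left_mono[OF M[OF y vs(2,3)] assms(3)]])
    finally show "norm (multi_deriv \<phi> vs y) \<le> a * M" .
  qed
qed

lemma linear_image_in_ball:
  fixes \<phi> :: "real^'n \<Rightarrow> real^'n"
  assumes "0 < a" "norm (A z) \<le> a * norm z" "norm z < \<rho>" "a * \<rho> \<le> R"
  shows "x0 + A z \<in> ball x0 R"
proof -
  have "norm (A z) < a * \<rho>"
    by (rule order.strict_trans1[OF assms(2) mult_strict_left_mono[OF assms(3,1)]])
  then show ?thesis using assms(4) by (simp add: dist_norm)
qed

section \<open>The theorem for fixed K, s and k\<close>

definition morse_radius :: "nat \<Rightarrow> real \<Rightarrow> real \<Rightarrow> real" where
  "morse_radius d K s = s powr (5/2) / (32 * (K + 1) powr (9/2)) *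
     min 1 (min (2 * s^2 / (3 * ((real d)^2 + real d + 1))) (s powr (3/2) / (2 * ((real d)^2 + real d + 1))))"

definition morse_lipschitz :: "real \<Rightarrow> real \<Rightarrow> real" where
  "morse_lipschitz K s = 32 * (K + 1)^5 / s powr (5/2)"

definition morse_chart ::
    "nat \<Rightarrow> real \<Rightarrow> real \<Rightarrow> real \<Rightarrow> (real^'n \<Rightarrow> real) \<Rightarrow> (real^'n) set \<Rightarrow> real^'n \<Rightarrow> (real^'n \<Rightarrow> real^'n) \<Rightarrow> bool" where
  "morse_chart m \<delta> L M f U x0 \<phi> \<longleftrightarrow>
     Ck_diffeomorphism m \<phi> (ball 0 \<delta>) (\<phi> ` ball 0 \<delta>) \<and>
     \<phi> ` ball 0 \<delta> \<subseteq> U \<and>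
     sup_deriv_norm \<phi> (ball 0 \<delta>) \<le> ereal L \<and>
     (\<exists>\<epsilon> :: 'n \<Rightarrow> real.
        (\<forall>i. \<epsilon> i = 1 \<or> \<epsilon> i = -1) \<and>
        (\<forall>x\<in>ball 0 \<delta>. f (\<phi> x) = f x0 + (\<Sum>i\<in>UNIV. \<epsilon> i * (x $ i)^2))) \<and>
     Ck_norm m \<phi> (ball 0 \<delta>) \<le> ereal M"

text \<open>Making \<open>s\<close> a parameter rather than a function of \<open>f\<close> is what
  lets \<open>M\<close> depend on the singular value but on nothing else about
  \<open>f\<close>.\<close>

lemma quantitative_morse_chart:
  "\<exists>M>0. \<forall>(f :: real^'n \<Rightarrow> real) U x0.
     s = smallest_singular_value (hessian f x0) \<and> open U \<and> x0 \<in> U \<and>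
     ball x0 (morse_lipschitz K s * morse_radius CARD('n) K s) \<subseteq> U \<and>
     k \<ge> 3 \<and> Ck_on k f U \<and> Ck_norm k f U \<le> ereal K \<and>
     frechet_derivative f (at x0) = (\<lambda>v. 0) \<and> rank (hessian f x0) = CARD('n) \<longrightarrow>
     (\<exists>\<phi>. morse_chart (k - 1) (morse_radius CARD('n) K s) (morse_lipschitz K s) M f U x0 \<phi>)"
proof (cases "0 < s \<and> s \<le> K \<and> k \<ge> 3")
  case False
  \<comment> \<open>Full rank forces s > 0 and the C^k bound forces s \<le> K; otherwise no function
    qualifies and any \<open>M\<close> will do.\<close>
  have "\<not> (s = smallest_singular_value (hessian f x0) \<and> open U \<and> x0 \<in> U \<and> k \<ge> 3 \<and> Ck_on k f U \<and>
     Ck_norm k f U \<le> ereal K \<and> rank (hessian f x0) = CARD('n))" for f :: "real^'n \<Rightarrow> real" and U x0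
    using False smallest_singular_value_pos[of "hessian f x0"] singular_value_le_Ck_norm[of U x0 k f K] by auto
  then show ?thesis by (intro exI[of _ 1]) auto
next
  case True
  then have s: "0 < s" "s \<le> K" and k: "k \<ge> 3" by auto
  define m where "m = min 1 (min (2 * s^2 / (3 * ((real CARD('n))^2 + real CARD('n) + 1)))
      (s powr (3/2) / (2 * ((real CARD('n))^2 + real CARD('n) + 1))))"
  have "0 < (real CARD('n))^2 + real CARD('n) + 1" by (intro add_nonneg_pos) auto
  then have m: "0 < m" "m \<le> 1" using s(1) by (auto simp: m_def)
  define \<delta> where "\<delta> = morse_radius CARD('n) K s"
  define L where "L = morse_lipschitz K s"
  define a where "a = sqrt (2 / s)"
  have est: "0 < \<delta>" "a * 2 \<le> L" "K * a ^ 3 * (2 * \<delta>) \<le> 1/20"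
    using radius_estimates[OF s m] by (simp_all add: \<delta>_def L_def a_def morse_radius_def morse_lipschitz_def m_def)
  have a0: "0 < a" using s by (simp add: a_def)
  \<comment> \<open>The germ lives on radius 2 \<delta> and \<open>A\<close> stretches by at most
    \<open>a\<close>; so 2 a \<le> L makes the assumed ball of radius L \<delta> around x0 large
    enough.\<close>
  have le_L: "a * (2 * \<delta>) \<le> L * \<delta>"
    using mult_right_mono[OF est(2), of \<delta>] est(1) by (simp add: mult_ac)
  obtain M where M: "M > 0" "\<And>(h :: real^'n \<Rightarrow> real) \<epsilon>.
      normalized_morse_germ k (2 * \<delta>) (\<lambda>p. if p = 0 then K * a * (2 * \<delta>) else K * a ^ p) h \<epsilon> \<Longrightarrow>
    (\<exists>\<Xi> \<Phi>. Ck_on (k - 1) \<Xi> (ball 0 (2 * \<delta>)) \<and> Ck_on (k - 1) \<Phi> (ball 0 \<delta>) \<and>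
      (\<forall>y\<in>ball 0 \<delta>. \<Phi> y \<in> ball 0 (2 * \<delta>) \<and> \<Xi> (\<Phi> y) = y \<and> h (\<Phi> y) = sign_flip \<epsilon> y \<bullet> y \<and>
        (\<forall>v. norm (frechet_derivative \<Phi> (at y) v) \<le> 2 * norm v) \<and>
        (\<forall>vs. length vs \<le> k - 1 \<and> (\<forall>v\<in>set vs. norm v = 1) \<longrightarrow> norm (multi_deriv \<Phi> vs y) \<le> M)) \<and>
      (\<forall>x\<in>ball 0 (2 * \<delta>). \<Xi> x \<in> ball 0 \<delta> \<longrightarrow> \<Phi> (\<Xi> x) = x) \<and> \<Phi> 0 = 0)"
    using uniform_morse_chart[of "2 * \<delta>" k "\<lambda>p. if p = 0 then K * a * (2 * \<delta>) else K * a ^ p", where ?'n='n] est(1) k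
    by auto
  show ?thesis
    unfolding \<delta>_def[symmetric] L_def[symmetric]
  \<comment> \<open>\<open>M\<close> bounds the derivatives of \<Phi>, and applying \<open>A\<close>
    multiplies them by at most \<open>a\<close>.\<close>
  proof (intro exI[of _ "a * M"] conjI allI impI)
    show "0 < a * M" using a0 M(1) by simp
    fix f :: "real^'n \<Rightarrow> real" and U x0
    assume H: "s = smallest_singular_value (hessian f x0) \<and> open U \<and> x0 \<in> U \<and> ball x0 (L * \<delta>) \<subseteq> U \<and>
     k \<ge> 3 \<and> Ck_on k f U \<and> Ck_norm k f U \<le> ereal K \<and>
     frechet_derivative f (at x0) = (\<lambda>v. 0) \<and> rank (hessian f x0) = CARD('n)"
    have "ball x0 (a * (2 * \<delta>)) \<subseteq> U"
      using H subset_ball[OF le_L] by (meson order_trans)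
    then obtain A :: "real^'n \<Rightarrow> real^'n" and \<epsilon> where A: "linear A" "bij A" "\<And>y. norm (A y) \<le> a * norm y"
      and germ: "normalized_morse_germ k (2 * \<delta>) (\<lambda>p. if p = 0 then K * a * (2 * \<delta>) else K * a ^ p)
        (\<lambda>y. - f x0 + f (x0 + A y)) \<epsilon>"
      using normalized_germ_of_function[of U k f K x0 s "2 * \<delta>" a] H s(1) est a_def by auto
    obtain \<Xi> \<Phi> where chart: "Ck_on (k - 1) \<Xi> (ball 0 (2 * \<delta>))" "Ck_on (k - 1) \<Phi> (ball 0 \<delta>)" "\<Phi> 0 = 0"
      and inv: "\<And>y. y \<in> ball 0 \<delta> \<Longrightarrow> \<Phi> y \<in> ball 0 (2 * \<delta>)" "\<And>y. y \<in> ball 0 \<delta> \<Longrightarrow> \<Xi> (\<Phi> y) = y"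
        "\<And>x. x \<in> ball 0 (2 * \<delta>) \<Longrightarrow> \<Xi> x \<in> ball 0 \<delta> \<Longrightarrow> \<Phi> (\<Xi> x) = x"
      and eq: "\<And>y. y \<in> ball 0 \<delta> \<Longrightarrow> - f x0 + f (x0 + A (\<Phi> y)) = sign_flip \<epsilon> y \<bullet> y"
      and D\<Phi>: "\<And>y v. y \<in> ball 0 \<delta> \<Longrightarrow> norm (frechet_derivative \<Phi> (at y) v) \<le> 2 * norm v"
      and M\<Phi>: "\<And>y vs. y \<in> ball 0 \<delta> \<Longrightarrow> length vs \<le> k - 1 \<Longrightarrow> \<forall>v\<in>set vs. norm v = 1 \<Longrightarrow>
        norm (multi_deriv \<Phi> vs y) \<le> M"
      using M(2)[OF germ] by blast
    have k1: "1 \<le> k - 1" using k by simp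
    note image = affine_image_chart[OF est(1) k1 less_imp_le[OF a0] A chart inv D\<Phi> M\<Phi>, where ?x0.0=x0]
    let ?\<phi> = "\<lambda>y. x0 + A (\<Phi> y)"
    have "?\<phi> ` ball 0 \<delta> \<subseteq> U"
    proof
      fix x assume "x \<in> ?\<phi> ` ball 0 \<delta>"
      then obtain y where y: "y \<in> ball 0 \<delta>" "x = x0 + A (\<Phi> y)" by blast
      have "x0 + A (\<Phi> y) \<in> ball x0 (L * \<delta>)"
        using inv(1)[OF y(1)] by (intro linear_image_in_ball[OF a0 A(3) _ le_L]) simp
      then show "x \<in> U" using H y(2) by blast
    qed
    moreover have "sup_deriv_norm ?\<phi> (ball 0 \<delta>) \<le> ereal L"
    proof (rule order_trans[OF image(2)])
      show "ereal (a * 2) \<le> ereal L" using est(2) by (rule ereal_less_eq(3)[THEN iffD2])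
    qed
    moreover have "\<forall>i. \<epsilon> i = 1 \<or> \<epsilon> i = -1" using germ unfolding normalized_morse_germ_def by blast
    moreover have "f (?\<phi> y) = f x0 + (\<Sum>i\<in>UNIV. \<epsilon> i * (y $ i)^2)" if "y \<in> ball 0 \<delta>" for y
      using eq[OF that] by (simp add: sign_flip_inner power2_eq_square)
    ultimately have "morse_chart (k - 1) \<delta> L (a * M) f U x0 ?\<phi>"
      unfolding morse_chart_def using image(1,3) by blast
    then show "\<exists>\<phi>. morse_chart (k - 1) \<delta> L (a * M) f U x0 \<phi>" by blast
  qed
qed

theorem theorem4p3:
  "\<exists>M :: real \<Rightarrow> real \<Rightarrow> nat \<Rightarrow> real.
     (\<forall>K s k. M K s k > 0) \<and>
     (\<forall>(f :: real^'n \<Rightarrow> real) (U :: (real^'n) set) (x0 :: real^'n) (K :: real) (k :: nat).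
        let n = real CARD('n);
            s = smallest_singular_value (hessian f x0);
            \<delta> = s powr (5/2) / (32 * (K + 1) powr (9/2)) *
                 min 1 (min (2 * s^2 / (3 * (n^2 + n + 1)))
                            (s powr (3/2) / (2 * (n^2 + n + 1))));
            L = 32 * (K + 1)^5 / s powr (5/2)
        in
          open U \<and> x0 \<in> U \<and> ball x0 (L * \<delta>) \<subseteq> U \<and>
          k \<ge> 3 \<and> Ck_on k f U \<and> Ck_norm k f U \<le> ereal K \<and>
          frechet_derivative f (at x0) = (\<lambda>v. 0) \<and>
          rank (hessian f x0) = CARD('n)
          \<longrightarrow>
          (\<exists>\<phi> :: real^'n \<Rightarrow> real^'n.
             Ck_diffeomorphism (k - 1) \<phi> (ball 0 \<delta>) (\<phi> ` ball 0 \<delta>) \<and>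
             \<phi> ` ball 0 \<delta> \<subseteq> U \<and>
             sup_deriv_norm \<phi> (ball 0 \<delta>) \<le> ereal L \<and>
             (\<exists>\<epsilon> :: 'n \<Rightarrow> real.
                (\<forall>i. \<epsilon> i = 1 \<or> \<epsilon> i = -1) \<and>
                (\<forall>x\<in>ball 0 \<delta>. f (\<phi> x) = f x0 + (\<Sum>i\<in>UNIV. \<epsilon> i * (x $ i)^2))) \<and>
             Ck_norm (k - 1) \<phi> (ball 0 \<delta>) \<le> ereal (M K s k)))"
proof -
  define P where "P K s k M \<longleftrightarrow> 0 < M \<and> (\<forall>(f :: real^'n \<Rightarrow> real) U x0.
     s = smallest_singular_value (hessian f x0) \<and> open U \<and> x0 \<in> U \<and>
     ball x0 (morse_lipschitz K s * morse_radius CARD('n) K s) \<subseteq> U \<and>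
     k \<ge> 3 \<and> Ck_on k f U \<and> Ck_norm k f U \<le> ereal K \<and>
     frechet_derivative f (at x0) = (\<lambda>v. 0) \<and> rank (hessian f x0) = CARD('n) \<longrightarrow>
     (\<exists>\<phi>. morse_chart (k - 1) (morse_radius CARD('n) K s) (morse_lipschitz K s) M f U x0 \<phi>))"
    for K s k and M :: real
  \<comment> \<open>A valid constant is chosen separately for each triple; the dimension is fixed by
    the type, so \<open>M\<close> may depend on it.\<close>
  define M where "M K s k = (SOME M. P K s k M)" for K s k
  have "P K s k (M K s k)" for K s k
    unfolding M_def by (rule someI_ex) (simp only: P_def quantitative_morse_chart)
  then show ?thesis
    unfolding Let_def morse_lipschitz_def[symmetric] morse_radius_def[symmetric] morse_chart_def[symmetric] P_def
    by (intro exI[of _ M]) blast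
qed

end
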